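(* Let $n \geq 3$ be an integer, let $d$ be a positive integer, and let $\Phi : \mathrm{SAut}(F_n) \rightarrow \mathrm{Diff}(\mathbb{T}^d)$ be a smooth action, i.e. a group homomorphism from $\mathrm{SAut}(F_n)$ to the group of diffeomorphisms of the $d$-dimensional torus. If $d < n$, then $\Phi$ is trivial, i.e. $\Phi(\alpha) = \mathrm{id}_{\mathbb{T}^d}$ for every $\alpha \in \mathrm{SAut}(F_n)$.
   Context: $F_n$ denotes the free group of rank $n$ and $\mathrm{Aut}(F_n)$ its automorphism group. The abelianization map $F_n \twoheadrightarrow \mathbb{Z}^n$ induces a natural epimorphism $\mathrm{Aut}(F_n) \twoheadrightarrow \mathrm{GL}_n(\mathbb{Z})$. The group $\mathrm{SAut}(F_n)$ is the preimage of $\mathrm{SL}_n(\mathbb{Z})$ under this epimorphism; it is the unique subgroup of index two in $\mathrm{Aut}(F_n)$. $\mathbb{T}^d = \mathbb{S}^1 \times \cdots \times \mathbb{S}^1$ ($d$ factors) is the $d$-dimensional torus with its standard smooth structure, and $\mathrm{Diff}(\mathbb{T}^d)$ is the group of smooth diffeomorphisms of $\mathbb{T}^d$ under composition. *)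

theory Defs
  imports "HOL-Analysis.Analysis" "HOL-Algebra.Bij"
begin

section \<open>The free group on a type of generators\<close>

text \<open>A letter \<open>(x, True)\<close> stands for the generator \<open>x\<close> and \<open>(x, False)\<close> for its inverse.
  Elements of the free group are the reduced words.\<close>

type_synonym 'n word = "('n \<times> bool) list"

definition inv_letter :: "'n \<times> bool \<Rightarrow> 'n \<times> bool" where
  "inv_letter a = (fst a, \<not> snd a)"

definition reduced :: "'n word \<Rightarrow> bool" where
  "reduced = successively (\<lambda>a b. b \<noteq> inv_letter a)"

fun push_letter :: "'n \<times> bool \<Rightarrow> 'n word \<Rightarrow> 'n word" where
  "push_letter a [] = [a]"
| "push_letter a (b # w) = (if b = inv_letter a then w else a # b # w)"

text \<open>Multiplication is concatenation followed by cancellation.\<close>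

definition free_group :: "'n word monoid" where
  "free_group = \<lparr>carrier = {w. reduced w}, mult = foldr push_letter, one = []\<rparr>"

lemma inv_letter_inv_letter [simp]: "inv_letter (inv_letter a) = a"
  by (simp add: inv_letter_def)

lemma inv_letter_neq [simp]: "inv_letter a \<noteq> a" "a \<noteq> inv_letter a"
  by (auto simp: inv_letter_def prod_eq_iff)

lemma reduced_Nil [simp]: "reduced []"
  by (simp add: reduced_def)

lemma reduced_Cons: "reduced (a # w) \<longleftrightarrow> reduced w \<and> (w = [] \<or> hd w \<noteq> inv_letter a)"
  by (cases w) (auto simp: reduced_def)

lemma reduced_push_letter: "reduced w \<Longrightarrow> reduced (push_letter a w)"
  by (cases w) (auto simp: reduced_Cons)

lemma reduced_foldr_push_letter: "reduced w \<Longrightarrow> reduced (foldr push_letter u w)"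
  by (induction u) (auto simp: reduced_push_letter)

lemma push_letter_inv_letter: "reduced w \<Longrightarrow> push_letter (inv_letter a) (push_letter a w) = w"
  by (cases w; cases "tl w") (auto simp: reduced_Cons)

lemma push_letter_inv_letter': "reduced w \<Longrightarrow> push_letter a (push_letter (inv_letter a) w) = w"
  using push_letter_inv_letter[of w "inv_letter a"] by simp

lemma push_letter_reduced: "reduced (a # w) \<Longrightarrow> push_letter a w = a # w"
  by (cases w) (auto simp: reduced_Cons)

lemma foldr_push_letter_push_letter:
  "reduced w \<Longrightarrow> foldr push_letter (push_letter a u) w = push_letter a (foldr push_letter u w)"
  by (cases u) (auto simp: push_letter_inv_letter' reduced_foldr_push_letter)

lemma foldr_push_letter_assoc:
  "reduced w \<Longrightarrow>
    foldr push_letter (foldr push_letter u v) w = foldr push_letter u (foldr push_letter v w)"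
  by (induction u) (auto simp: foldr_push_letter_push_letter)

lemma foldr_push_letter_Nil: "reduced w \<Longrightarrow> foldr push_letter w [] = w"
  by (induction w) (auto simp: push_letter_reduced reduced_Cons)

lemma foldr_push_letter_inverse:
  "reduced w \<Longrightarrow> foldr push_letter (rev (map inv_letter u)) (foldr push_letter u w) = w"
  by (induction u arbitrary: w) (auto simp: push_letter_inv_letter reduced_foldr_push_letter)

lemma group_free_group: "group (free_group :: 'n word monoid)"
proof (rule groupI)
  fix w :: "'n word" assume "w \<in> carrier free_group"
  then have w: "reduced w" by (simp add: free_group_def)
  let ?v = "foldr push_letter (rev (map inv_letter w)) []"
  have "foldr push_letter ?v w = foldr push_letter (rev (map inv_letter w)) w"
    using w by (simp add: foldr_push_letter_assoc)
  also have "\<dots> = []"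
    using foldr_push_letter_inverse[of "[]" w] w by (simp add: foldr_push_letter_Nil)
  finally show "\<exists>v\<in>carrier free_group. v \<otimes>\<^bsub>free_group\<^esub> w = \<one>\<^bsub>free_group\<^esub>"
    by (intro bexI[of _ ?v]) (auto simp: free_group_def reduced_foldr_push_letter)
qed (auto simp: free_group_def reduced_foldr_push_letter foldr_push_letter_assoc)


section \<open>Abelianization and \<open>SAut(F\<^sub>n)\<close>\<close>

text \<open>The abelianization map to the free abelian group on the same generators sends a word to
  its vector of exponent sums.\<close>

definition abelianize :: "'n::finite word \<Rightarrow> int ^ 'n" where
  "abelianize w = sum_list (map (\<lambda>(x, b). if b then axis x 1 else - axis x 1) w)"

text \<open>The matrix of the endomorphism induced on the abelianization; its \<open>j\<close>-th column is the
  image of the \<open>j\<close>-th basis vector.\<close>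

definition abelianized_matrix :: "('n::finite word \<Rightarrow> 'n word) \<Rightarrow> int ^ 'n ^ 'n" where
  "abelianized_matrix \<alpha> = (\<chi> i j. abelianize (\<alpha> [(j, True)]) $ i)"

definition SAut :: "('n::finite word \<Rightarrow> 'n word) monoid" where
  "SAut = AutoGroup free_group
     \<lparr>carrier := {\<alpha> \<in> carrier (AutoGroup free_group). det (abelianized_matrix \<alpha>) = 1}\<rparr>"

lemma abelianize_Nil [simp]: "abelianize [] = 0"
  by (simp add: abelianize_def)

lemma abelianize_Cons:
  "abelianize (a # w) = (if snd a then axis (fst a) 1 else - axis (fst a) 1) + abelianize w"
  by (simp add: abelianize_def case_prod_beta)

lemma abelianize_push_letter: "abelianize (push_letter a w) = abelianize (a # w)"
  by (cases w) (auto simp: abelianize_Cons inv_letter_def)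

lemma abelianize_mult:
  "abelianize (u \<otimes>\<^bsub>free_group\<^esub> v) = abelianize u + abelianize v"
  by (induction u)
    (auto simp: free_group_def abelianize_push_letter abelianize_Cons algebra_simps)

lemma abelianize_hom:
  fixes \<alpha> :: "'n::finite word \<Rightarrow> 'n word"
  assumes \<alpha>: "\<alpha> \<in> hom free_group free_group" and w: "w \<in> carrier free_group"
  shows "abelianize (\<alpha> w) = abelianized_matrix \<alpha> *v abelianize w"
proof -
  let ?M = "abelianized_matrix \<alpha>"
  have mult: "abelianize (\<alpha> (u \<otimes>\<^bsub>free_group\<^esub> v)) = abelianize (\<alpha> u) + abelianize (\<alpha> v)"
    if "reduced u" "reduced v" for u v
    using \<alpha> that by (simp add: hom_def abelianize_mult free_group_def[THEN arg_cong[of _ _ carrier]])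
  have one: "abelianize (\<alpha> []) = 0"
    using mult[of "[]" "[]"] by (simp add: free_group_def)
  have basis: "?M *v axis x 1 = abelianize (\<alpha> [(x, True)])" for x
    by (simp add: vec_eq_iff abelianized_matrix_def matrix_vector_mult_def axis_def
        if_distrib cong: if_cong)
  have letter: "abelianize (\<alpha> [a]) = ?M *v (if snd a then axis (fst a) 1 else - axis (fst a) 1)"
    for a :: "'n \<times> bool"
  proof (cases a)
    case (Pair x b)
    have "abelianize (\<alpha> [(x, False)]) + abelianize (\<alpha> [(x, True)]) = 0"
      using mult[of "[(x, False)]" "[(x, True)]"] one
      by (simp add: free_group_def reduced_Cons inv_letter_def)
    moreover have "?M *v (- axis x 1) = - (?M *v axis x 1)"
      by (simp add: vec_eq_iff matrix_vector_mult_def sum_negf)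
    ultimately show ?thesis
      using Pair by (cases b) (auto simp: basis eq_neg_iff_add_eq_0[symmetric])
  qed
  have "reduced w" using w by (simp add: free_group_def)
  then show ?thesis
  proof (induction w)
    case Nil
    show ?case by (simp add: one)
  next
    case (Cons a w)
    then have red: "reduced w" "reduced [a]" by (auto simp: reduced_Cons)
    have "[a] \<otimes>\<^bsub>free_group\<^esub> w = a # w"
      using Cons.prems by (simp add: free_group_def push_letter_reduced)
    then show ?case
      using mult[OF red(2,1)] Cons.IH[OF red(1)]
      by (simp add: letter abelianize_Cons matrix_vector_right_distrib)
  qed
qed


section \<open>Smooth maps and diffeomorphisms of the torus\<close>

text \<open>On an open set, continuous differentiability of order \<open>k\<close>, via iterated directional
  derivatives; \<open>k = 0\<close> means continuity.\<close>

primrec higher_differentiable_on ::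
    "'a::real_normed_vector set \<Rightarrow> ('a \<Rightarrow> 'b::real_normed_vector) \<Rightarrow> nat \<Rightarrow> bool" where
  "higher_differentiable_on U f 0 \<longleftrightarrow> continuous_on U f"
| "higher_differentiable_on U f (Suc k) \<longleftrightarrow>
     (\<forall>x\<in>U. f differentiable (at x)) \<and>
     (\<forall>v. higher_differentiable_on U (\<lambda>x. frechet_derivative f (at x) v) k)"

text \<open>A map on a subset of a Euclidean space is smooth if it extends locally, near each point of
  the subset, to a \<open>C\<^sup>\<infinity>\<close> map on an open set of the ambient space. For an embedded submanifold
  this is smoothness with respect to the submanifold structure.\<close>

definition smooth_map_on ::
    "'a::euclidean_space set \<Rightarrow> ('a \<Rightarrow> 'b::euclidean_space) \<Rightarrow> bool" where
  "smooth_map_on X f \<longleftrightarrow>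
     (\<forall>x\<in>X. \<exists>U g. open U \<and> x \<in> U \<and> (\<forall>k. higher_differentiable_on U g k) \<and>
        (\<forall>y\<in>X \<inter> U. g y = f y))"

text \<open>The torus is the product of unit circles, a submanifold of \<open>\<complex>\<^sup>d\<close>; the submanifold
  structure coincides with the product structure.\<close>

definition torus :: "(complex ^ 'd::finite) set" where
  "torus = {z. \<forall>j. z $ j \<in> sphere 0 1}"

definition Diff :: "'a::euclidean_space set \<Rightarrow> ('a \<Rightarrow> 'a) monoid" where
  "Diff X = BijGroup X
     \<lparr>carrier := {f \<in> Bij X. smooth_map_on X f \<and> smooth_map_on X (inv_into X f)}\<rparr>"

end

theory Submission
  imports Defs "HOL-Computational_Algebra.Polynomial" "HOL-Library.Countable_Set"
begin

text \<open>Write \<open>n\<close> and \<open>d\<close> for the number of generators and the dimension, with \<open>d < n\<close>. The action is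
killed in two stages, first on the fundamental group of the torus and then on the torus itself.
Both stages kill the sign changes \<open>eps i j\<close>, which invert two generators, before the
transvections, and both finish with Nielsen's theorem (\<open>SAut_generated_by_transvections\<close>): the
transvections, which multiply one letter by another, generate \<open>SAut\<close>.

Nielsen's theorem is proved by choosing a tuple of images that no transvection improves, first in
total length and then lexicographically on the first halves of the words. In such a tuple
cancellation never eats up a factor completely, so only single letters can be products of length
one, and the automorphism is a signed permutation.

Fundamental group. A diffeomorphism lifts to a map \<open>F\<close> of the universal cover with
\<open>F (x + k) = F x + A k\<close> for integral \<open>k\<close>, and \<open>A\<close> gives a real representation of dimension
\<open>d < n\<close>. If a sign change acts nontrivially there, a common eigenvector of all sign changes with a
nonconstant sign pattern and its translates under signed transpositions have \<open>n\<close> different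
patterns, hence are independent, which needs \<open>d \<ge> n\<close>. The count fails only for \<open>n = 4\<close> and a
pattern splitting the indices into two pairs; there three patterns span the space, and an explicit
signed permutation acts like a sign change up to a scalar, which forces a transvection into the
kernel. Once the sign changes are trivial, the transvections onto a fixed letter are commuting
involutions, and the same counting argument applies to them. So the representation is trivial
(\<open>representation_trivial\<close>) and all lifts commute with integral translations.

The torus. The key fact (\<open>bounded_involution_eq_id\<close>) is that a \<open>C\<^sup>1\<close> involution \<open>F\<close> of Euclidean
space with bounded displacement is the identity. The map \<open>h x = (x + F x) / 2\<close> is a bounded
perturbation of the identity, so it has degree one and its regular fibres have odd cardinality;
but \<open>F\<close> preserves each fibre of \<open>h\<close>, and its fixed points are fixed by \<open>h\<close>. So every regular
value of \<open>h\<close> is fixed by \<open>F\<close>, and regular values are dense by Sard's theorem. The degree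
statement comes from an integral formula that is polynomial in the size of the perturbation and
holds for small perturbations by change of variables.

If \<open>x\<close> acts as an involution and commutes with its conjugate \<open>y\<close>, suitable lifts \<open>X\<close>, \<open>Y\<close> have
the same central square \<open>a\<close> and commute, so \<open>X \<circ> Y\<close> followed by translation by \<open>-a\<close> is an
involution with bounded displacement. It is the identity, and \<open>x\<close>, \<open>y\<close> act equally
(\<open>commuting_conjugate_involution\<close>). Applied to sign changes this shows that they act trivially;
then transvections act as commuting involutions, and a second application kills them.\<close>

section \<open>Multiplication in the free group\<close>

text \<open>The product of \<open>free_group\<close> as a bare function on words, so that word computations are free of
carrier conditions on the left factor.\<close>

abbreviation fmul :: "'n word \<Rightarrow> 'n word \<Rightarrow> 'n word" where
  "fmul \<equiv> foldr push_letter"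

definition finv :: "'n word \<Rightarrow> 'n word" where
  "finv w = rev (map inv_letter w)"

lemma inv_letter_eq_iff [simp]: "inv_letter a = inv_letter b \<longleftrightarrow> a = b"
  by (metis inv_letter_inv_letter)

lemma fst_inv_letter [simp]: "fst (inv_letter a) = fst a"
  by (simp add: inv_letter_def)

lemma snd_inv_letter [simp]: "snd (inv_letter a) \<longleftrightarrow> \<not> snd a"
  by (simp add: inv_letter_def)

lemma fst_eq_iff_letter: "fst a = fst b \<longleftrightarrow> a = b \<or> a = inv_letter b"
  by (auto simp: inv_letter_def prod_eq_iff)

lemma finv_finv [simp]: "finv (finv w) = w"
  by (simp add: finv_def rev_map o_def)

lemma finv_append: "finv (u @ v) = finv v @ finv u"
  by (simp add: finv_def)

lemma finv_simps [simp]: "finv [] = []" "finv [a] = [inv_letter a]"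
    "finv [a, b] = [inv_letter b, inv_letter a]" "length (finv w) = length w"
    "finv w = [] \<longleftrightarrow> w = []"
  by (simp_all add: finv_def)

lemma reduced_finv [simp]:
  fixes w :: "'a word"
  shows "reduced (finv w) \<longleftrightarrow> reduced w"
proof -
  have "successively (\<lambda>x y. inv_letter x \<noteq> inv_letter (inv_letter y)) w =
      successively (\<lambda>x y. y \<noteq> inv_letter x) w"
    by (rule arg_cong[where f = "\<lambda>P. successively P w"]) (auto simp: fun_eq_iff)
  then show ?thesis
    by (simp only: reduced_def finv_def successively_rev successively_map)
qed

lemma fmul_assoc: "reduced w \<Longrightarrow> fmul (fmul u v) w = fmul u (fmul v w)"
  by (rule foldr_push_letter_assoc)

lemma fmul_reduced [simp]: "reduced w \<Longrightarrow> reduced (fmul u w)"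
  by (rule reduced_foldr_push_letter)

lemma fmul_Nil: "reduced w \<Longrightarrow> fmul w [] = w"
  by (rule foldr_push_letter_Nil)

lemma fmul_finv_cancel: "reduced w \<Longrightarrow> fmul (finv u) (fmul u w) = w"
  "reduced w \<Longrightarrow> fmul u (fmul (finv u) w) = w"
  using foldr_push_letter_inverse[of w u] foldr_push_letter_inverse[of w "finv u"]
  unfolding finv_def[symmetric] by simp_all

lemma fmul_finv: "reduced u \<Longrightarrow> fmul (finv u) u = []" "reduced u \<Longrightarrow> fmul u (finv u) = []"
  using fmul_finv_cancel[of "[]" u] by (simp_all add: fmul_Nil)

lemma fmul_eq_Nil:
  assumes "reduced u" "reduced v" "fmul u v = []"
  shows "u = finv v"
  using fmul_finv_cancel(1)[of v u] assms by (metis finv_finv fmul_Nil reduced_finv)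

lemma carrier_free_group: "w \<in> carrier free_group \<longleftrightarrow> reduced w"
  by (simp add: free_group_def)

lemma hom_free_group_iff:
  "\<alpha> \<in> hom free_group free_group \<longleftrightarrow>
    (\<forall>w. reduced w \<longrightarrow> reduced (\<alpha> w)) \<and>
    (\<forall>u v. reduced u \<longrightarrow> reduced v \<longrightarrow> \<alpha> (fmul u v) = fmul (\<alpha> u) (\<alpha> v))"
  by (auto simp: hom_def free_group_def)

lemma homD:
  assumes "\<alpha> \<in> hom free_group free_group"
  shows "reduced w \<Longrightarrow> reduced (\<alpha> w)"
    "reduced u \<Longrightarrow> reduced v \<Longrightarrow> \<alpha> (fmul u v) = fmul (\<alpha> u) (\<alpha> v)"
    "\<alpha> [] = []" "reduced w \<Longrightarrow> \<alpha> (finv w) = finv (\<alpha> w)"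
proof -
  show 1: "reduced w \<Longrightarrow> reduced (\<alpha> w)"
    and 2: "reduced u \<Longrightarrow> reduced v \<Longrightarrow> \<alpha> (fmul u v) = fmul (\<alpha> u) (\<alpha> v)" for u v w
    using assms by (auto simp: hom_free_group_iff)
  show 3: "\<alpha> [] = []"
    using 2[of "[]" "[]"] 1[of "[]"] fmul_finv_cancel(1)[of "\<alpha> []" "\<alpha> []"] fmul_finv(1)[of "\<alpha> []"]
    by simp
  show "\<alpha> (finv w) = finv (\<alpha> w)" if "reduced w"
    using 2[of "finv w" w] that 1 3 fmul_eq_Nil[of "\<alpha> (finv w)" "\<alpha> w"] by (simp add: fmul_finv)
qed

lemma reduced_single [simp]: "reduced [a]"
  by (simp add: reduced_Cons)

lemma hom_Cons:
  assumes "\<alpha> \<in> hom free_group free_group" "reduced (a # w)"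
  shows "\<alpha> (a # w) = fmul (\<alpha> [a]) (\<alpha> w)"
proof -
  have "a # w = fmul [a] w" using assms(2) by (simp add: push_letter_reduced)
  moreover have "\<alpha> (fmul [a] w) = fmul (\<alpha> [a]) (\<alpha> w)"
    using homD(2)[OF assms(1) reduced_single] assms(2) by (simp add: reduced_Cons)
  ultimately show ?thesis by metis
qed

lemma hom_inv_letter:
  assumes "\<alpha> \<in> hom free_group free_group"
  shows "\<alpha> [inv_letter a] = finv (\<alpha> [a])"
  using homD(4)[OF assms, of "[a]"] by simp

text \<open>An endomorphism is determined by its value on one letter for each generator. Allowing either
letter of a generator, not just the positive one, avoids a case distinction whenever a map is
defined by its effect on a letter of unknown sign.\<close>

lemma hom_eqI:
  assumes "\<alpha> \<in> hom free_group free_group" "\<beta> \<in> hom free_group free_group"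
    and "\<And>i. \<exists>a. fst a = i \<and> \<alpha> [a] = \<beta> [a]" and "reduced w"
  shows "\<alpha> w = \<beta> w"
proof -
  have *: "\<alpha> [a] = \<beta> [a]" for a
  proof -
    obtain b where b: "fst b = fst a" "\<alpha> [b] = \<beta> [b]" using assms(3) by blast
    then show ?thesis
      using hom_inv_letter[OF assms(1), of b] hom_inv_letter[OF assms(2), of b]
      by (auto simp: fst_eq_iff_letter)
  qed
  show ?thesis using \<open>reduced w\<close>
  proof (induction w)
    case Nil
    show ?case using homD(3) assms by metis
  next
    case (Cons a w)
    then show ?case using hom_Cons assms(1,2) * by (metis reduced_Cons)
  qed
qed

section \<open>Endomorphisms of the free group\<close>

definition letter_image :: "('n \<Rightarrow> 'n word) \<Rightarrow> 'n \<times> bool \<Rightarrow> 'n word" where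
  "letter_image g a = (if snd a then g (fst a) else finv (g (fst a)))"

primrec subst :: "('n \<Rightarrow> 'n word) \<Rightarrow> 'n word \<Rightarrow> 'n word" where
  "subst g [] = []"
| "subst g (a # w) = fmul (letter_image g a) (subst g w)"

lemma letter_image_inv_letter: "letter_image g (inv_letter a) = finv (letter_image g a)"
  by (simp add: letter_image_def)

lemma reduced_subst [simp]: "reduced (subst g w)"
  by (induction w) auto

lemma subst_push_letter: "subst g (push_letter a w) = fmul (letter_image g a) (subst g w)"
  by (cases w) (auto simp: letter_image_inv_letter fmul_finv_cancel)

lemma subst_fmul: "subst g (fmul u w) = fmul (subst g u) (subst g w)"
  by (induction u) (auto simp: subst_push_letter fmul_assoc)

text \<open>Automorphisms are extensional in \<open>AutoGroup\<close>, hence the restriction.\<close>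

definition endo :: "('n \<Rightarrow> 'n word) \<Rightarrow> 'n word \<Rightarrow> 'n word" where
  "endo g = restrict (subst g) (carrier free_group)"

lemma endo_apply [simp]: "reduced w \<Longrightarrow> endo g w = subst g w"
  by (simp add: endo_def carrier_free_group)

lemma endo_hom: "endo g \<in> hom free_group free_group"
  by (auto simp: hom_free_group_iff subst_fmul)

section \<open>The group of special automorphisms\<close>

lemma AutoGroup_free_group:
  "carrier (AutoGroup free_group) = auto free_group"
  "\<one>\<^bsub>AutoGroup free_group\<^esub> = (\<lambda>w\<in>carrier free_group. w)"
  by (simp_all add: AutoGroup_def BijGroup_def)

lemma autoD:
  assumes "\<alpha> \<in> auto free_group"
  shows "\<alpha> \<in> hom free_group free_group" "\<alpha> \<in> Bij (carrier free_group)"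
    "\<alpha> \<in> extensional (carrier free_group)" "bij_betw \<alpha> (carrier free_group) (carrier free_group)"
  using assms by (auto simp: auto_def Bij_def)

lemma auto_eqI:
  assumes "\<alpha> \<in> auto free_group" "\<beta> \<in> auto free_group"
    and "\<And>i. \<exists>a. fst a = i \<and> \<alpha> [a] = \<beta> [a]"
  shows "\<alpha> = \<beta>"
  using hom_eqI[OF autoD(1)[OF assms(1)] autoD(1)[OF assms(2)] assms(3)]
  by (intro extensionalityI[OF autoD(3)[OF assms(1)] autoD(3)[OF assms(2)]])
    (auto simp: carrier_free_group)

text \<open>Two endomorphisms are inverse to each other as soon as both composites fix the generators.\<close>

lemma endo_auto:
  assumes "\<And>i. subst g (g' i) = [(i, True)]" "\<And>i. subst g' (g i) = [(i, True)]"
    and "\<And>i. reduced (g i)" "\<And>i. reduced (g' i)"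
  shows "endo g \<in> auto free_group"
proof -
  have inv: "endo h (endo k w) = w"
    if hk: "\<And>i. subst h (k i) = [(i, True)]" and k: "\<And>i. reduced (k i)" and w: "reduced w"
    for h k :: "'a \<Rightarrow> 'a word" and w
  proof -
    have "(\<lambda>w. endo h (endo k w)) \<in> hom free_group free_group"
      by (auto simp: hom_free_group_iff subst_fmul)
    moreover have "(\<lambda>w. w) \<in> hom free_group free_group"
      by (auto simp: hom_free_group_iff)
    moreover have "endo h (endo k [(i, True)]) = [(i, True)]" for i
      using hk k by (simp add: letter_image_def fmul_Nil)
    then have "\<exists>a. fst a = i \<and> endo h (endo k [a]) = [a]" for i
      by (intro exI[of _ "(i, True)"]) auto
    ultimately show ?thesis using hom_eqI[of "\<lambda>w. endo h (endo k w)" "\<lambda>w. w"] w by blast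
  qed
  have "bij_betw (endo g) (carrier free_group) (carrier free_group)"
    by (rule bij_betwI[where g = "endo g'"])
      (use inv[of g g'] inv[of g' g] assms in \<open>auto simp: carrier_free_group simp del: endo_apply\<close>,
        auto)
  then show ?thesis
    using endo_hom[of g] by (simp add: auto_def Bij_def endo_def)
qed

lemma abelianized_matrix_compose:
  fixes \<alpha> \<beta> :: "'n::finite word \<Rightarrow> 'n word"
  assumes "\<alpha> \<in> auto free_group" "\<beta> \<in> auto free_group"
  shows "abelianized_matrix (compose (carrier free_group) \<alpha> \<beta>) =
    abelianized_matrix \<alpha> ** abelianized_matrix \<beta>"
proof -
  have "abelianize (\<alpha> (\<beta> [(j, True)])) = abelianized_matrix \<alpha> *v abelianize (\<beta> [(j, True)])" for j
    using assms homD(1)[OF autoD(1)[OF assms(2)]]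
    by (intro abelianize_hom autoD(1)) (auto simp: carrier_free_group)
  then show ?thesis
    by (simp add: vec_eq_iff abelianized_matrix_def compose_def carrier_free_group
        matrix_vector_mult_def matrix_matrix_mult_def)
qed

lemma carrier_SAut:
  "\<alpha> \<in> carrier SAut \<longleftrightarrow> \<alpha> \<in> auto free_group \<and> det (abelianized_matrix \<alpha>) = 1"
  by (simp add: SAut_def AutoGroup_free_group)

abbreviation SAut_times (infixl "\<cdot>" 70) where
  "\<alpha> \<cdot> \<beta> \<equiv> \<alpha> \<otimes>\<^bsub>SAut\<^esub> \<beta>"

lemma SAut_mult:
  "\<alpha> \<in> carrier SAut \<Longrightarrow> \<beta> \<in> carrier SAut \<Longrightarrow> \<alpha> \<cdot> \<beta> = compose (carrier free_group) \<alpha> \<beta>"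
  by (auto simp: carrier_SAut SAut_def AutoGroup_def BijGroup_def dest: autoD(2))

lemma SAut_one: "\<one>\<^bsub>SAut\<^esub> = (\<lambda>w\<in>carrier free_group. w)"
  by (simp add: SAut_def AutoGroup_free_group)

lemma abelianized_matrix_one:
  "abelianized_matrix (\<lambda>w\<in>carrier free_group. w) = (mat 1 :: int^'n^'n::finite)"
  by (auto simp: vec_eq_iff abelianized_matrix_def carrier_free_group abelianize_Cons mat_def axis_def)

lemma group_SAut: "group (SAut :: ('n::finite word \<Rightarrow> 'n word) monoid)"
proof -
  let ?A = "AutoGroup free_group :: ('n word \<Rightarrow> 'n word) monoid"
  interpret A: group ?A by (rule group.AutoGroup[OF group_free_group])
  have mult: "\<alpha> \<otimes>\<^bsub>?A\<^esub> \<beta> = compose (carrier free_group) \<alpha> \<beta>"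
    if "\<alpha> \<in> carrier ?A" "\<beta> \<in> carrier ?A" for \<alpha> \<beta>
    using that autoD(2) by (auto simp: AutoGroup_def BijGroup_def)
  have dmult: "det (abelianized_matrix (\<alpha> \<otimes>\<^bsub>?A\<^esub> \<beta>)) =
      det (abelianized_matrix \<alpha>) * det (abelianized_matrix \<beta>)"
    if "\<alpha> \<in> carrier ?A" "\<beta> \<in> carrier ?A" for \<alpha> \<beta>
    using that by (simp add: mult abelianized_matrix_compose AutoGroup_free_group det_mul)
  have dunit: "det (abelianized_matrix \<one>\<^bsub>?A\<^esub>) = 1"
    by (simp add: AutoGroup_free_group abelianized_matrix_one)
  have "subgroup {\<alpha> \<in> carrier ?A. det (abelianized_matrix \<alpha>) = 1} ?A"
  proof (rule subgroup.intro)
    fix \<alpha> assume \<alpha>: "\<alpha> \<in> {\<alpha> \<in> carrier ?A. det (abelianized_matrix \<alpha>) = 1}"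
    then show "inv\<^bsub>?A\<^esub> \<alpha> \<in> {\<alpha> \<in> carrier ?A. det (abelianized_matrix \<alpha>) = 1}"
      using dmult[of "inv\<^bsub>?A\<^esub> \<alpha>" \<alpha>] dunit by auto
  qed (auto simp: dmult dunit)
  then show ?thesis unfolding SAut_def by (rule A.subgroup_imp_group)
qed

lemma SAut_apply:
  assumes "\<alpha> \<in> carrier SAut" "\<beta> \<in> carrier SAut" "reduced w"
  shows "(\<alpha> \<cdot> \<beta>) w = \<alpha> (\<beta> w)"
  using assms by (simp add: SAut_mult compose_def carrier_free_group)

lemma SAut_eqI:
  assumes "\<alpha> \<in> carrier SAut" "\<beta> \<in> carrier SAut"
    and "\<And>i. \<exists>a. fst a = i \<and> \<alpha> [a] = \<beta> [a]"
  shows "\<alpha> = \<beta>"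
  using assms auto_eqI by (auto simp: carrier_SAut)

lemma SAut_hom: "\<alpha> \<in> carrier SAut \<Longrightarrow> \<alpha> \<in> hom free_group free_group"
  by (simp add: carrier_SAut autoD)

section \<open>Transvections\<close>

definition transvection_gen :: "'n \<times> bool \<Rightarrow> 'n \<times> bool \<Rightarrow> 'n \<Rightarrow> 'n word" where
  "transvection_gen b d i =
     (if i = fst d then if snd d then [b, d] else [inv_letter d, inv_letter b] else [(i, True)])"

text \<open>The automorphism that sends the letter \<open>d\<close> to \<open>b d\<close>. Indexing by letters rather than generators
covers left and right multiplication by a generator and by its inverse at once, because sending
\<open>d\<close> to \<open>b d\<close> means sending the inverse of \<open>d\<close> to its product with the inverse of \<open>b\<close> on the right.\<close>

definition transvection :: "'n \<times> bool \<Rightarrow> 'n \<times> bool \<Rightarrow> 'n word \<Rightarrow> 'n word" where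
  "transvection b d = endo (transvection_gen b d)"

lemma letter_image_transvection:
  "letter_image (transvection_gen b d) a =
    (if a = d then [b, d] else if a = inv_letter d then [inv_letter d, inv_letter b] else [a])"
  by (cases a; cases d) (auto simp: letter_image_def transvection_gen_def inv_letter_def)

lemma reduced_pair: "fst a \<noteq> fst b \<Longrightarrow> reduced [a, b]"
  by (auto simp: reduced_Cons)

lemma transvection_apply:
  assumes "fst b \<noteq> fst d"
  shows "transvection b d [d] = [b, d]"
    "transvection b d [inv_letter d] = [inv_letter d, inv_letter b]"
    "fst a \<noteq> fst d \<Longrightarrow> transvection b d [a] = [a]"
  using assms unfolding transvection_def
  by (auto simp: letter_image_transvection fmul_Nil reduced_pair)

text \<open>The inverse is the transvection with \<open>b\<close> inverted, and the matrix arises from the identity by adding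
\<open>\<plusminus>\<close> one row to another.\<close>

lemma transvection_in_SAut:
  fixes b d :: "'n::finite \<times> bool"
  assumes "fst b \<noteq> fst d"
  shows "transvection b d \<in> carrier SAut"
proof -
  have inv: "subst (transvection_gen b d) (transvection_gen (inv_letter b) d i) = [(i, True)]"
    if bd: "fst b \<noteq> fst d" for b :: "'n \<times> bool" and i
  proof -
    have [simp]: "b \<noteq> d" "b \<noteq> inv_letter d" "inv_letter b \<noteq> d" "inv_letter b \<noteq> inv_letter d"
      "d \<noteq> b" "d \<noteq> inv_letter b" "inv_letter d \<noteq> b"
      using bd by auto
    have *: "(i, True) = d \<or> (i, True) = inv_letter d" if "i = fst d"
      using that by (cases d) (auto simp: inv_letter_def)
    show ?thesis
    proof (cases "i = fst d")
      case True
      from *[OF this] show ?thesis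
      proof
        assume "(i, True) = d"
        then have "snd d" by (metis snd_conv)
        then show ?thesis unfolding \<open>(i, True) = d\<close>
          by (simp add: transvection_gen_def[of "inv_letter b"] letter_image_transvection True)
      next
        assume "(i, True) = inv_letter d"
        then have "\<not> snd d" by (metis snd_conv snd_inv_letter)
        then show ?thesis unfolding \<open>(i, True) = inv_letter d\<close>
          by (simp add: transvection_gen_def[of "inv_letter b"] letter_image_transvection True)
      qed
    next
      case False
      then have "(i, True) \<noteq> d" "(i, True) \<noteq> inv_letter d" by (auto simp: inv_letter_def)
      then show ?thesis using False
        by (simp add: transvection_gen_def[of "inv_letter b"] letter_image_transvection)
    qed
  qed
  have red: "reduced (transvection_gen b d i)" if "fst b \<noteq> fst d" for b :: "'n \<times> bool" and i
    using that by (auto simp: transvection_gen_def intro!: reduced_pair)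
  have auto: "transvection b d \<in> auto free_group"
    unfolding transvection_def
    using inv[of b] inv[of "inv_letter b"] assms
    by (intro endo_auto[where g' = "transvection_gen (inv_letter b) d"] red) auto
  \<comment> \<open>The sign with which the generator of \<open>b\<close> occurs in the image of the generator of \<open>d\<close>.\<close>
  define s :: int where "s = (if snd b = snd d then 1 else - 1)"
  have "abelianized_matrix (transvection b d) =
      (\<chi> k. if k = fst b then row (fst b) (mat 1) + s *s row (fst d) (mat 1) else row k (mat 1))"
  proof -
    have "abelianize (transvection b d [(j, True)]) $ k =
        (if k = fst b \<and> j = fst d then s else 0) + (if k = j then 1 else 0)" for j k
    proof (cases "j = fst d")
      case True
      then have "(j, True) = (if snd d then d else inv_letter d)"
        by (cases d) (auto simp: inv_letter_def)
      then show ?thesis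
        using assms True by (auto simp: transvection_apply abelianize_Cons axis_def s_def)
    next
      case False
      then show ?thesis
        using assms by (auto simp: transvection_apply(3) abelianize_Cons axis_def)
    qed
    then show ?thesis
      using assms by (auto simp: vec_eq_iff abelianized_matrix_def row_def mat_def)
  qed
  then have "det (abelianized_matrix (transvection b d)) = 1"
    using det_row_operation[OF assms, of "mat 1" s] by simp
  with auto show ?thesis by (simp add: carrier_SAut)
qed

section \<open>Cancellation and common prefixes\<close>

fun lcp :: "'a list \<Rightarrow> 'a list \<Rightarrow> nat" where
  "lcp (x # u) (y # v) = (if x = y then Suc (lcp u v) else 0)"
| "lcp u v = 0"

lemma lcp_commute: "lcp u v = lcp v u"
  by (induction u v rule: lcp.induct) auto

lemma lcp_le: "lcp u v \<le> length u" "lcp u v \<le> length v"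
  by (induction u v rule: lcp.induct) auto

lemma take_lcp: "take (lcp u v) u = take (lcp u v) v"
  by (induction u v rule: lcp.induct) auto

text \<open>A common prefix that ends strictly inside \<open>take m v\<close> is not affected by what follows.\<close>

lemma lcp_eq_if_same_prefix:
  assumes "take m v = take m v'" "lcp u v < m"
  shows "lcp u v' = lcp u v"
  using assms
proof (induction u v arbitrary: m v' rule: lcp.induct)
  case (1 x u y v)
  obtain n where m: "m = Suc n" using 1(3) by (cases m) auto
  obtain v'' where v': "v' = y # v''" "take n v = take n v''"
    using 1(2) by (cases v') (auto simp: m)
  show ?case
  proof (cases "x = y")
    case True
    have "lcp u v < n" using 1(3) True by (simp add: m)
    from 1(1)[OF True v'(2) this] show ?thesis using True by (simp add: v'(1))
  qed (simp add: v'(1))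
next
  case ("2_2" x u)
  then show ?case by (cases m; cases v') auto
qed simp

lemma reduced_append_conv:
  "reduced (u @ v) \<longleftrightarrow> reduced u \<and> reduced v \<and> (u = [] \<or> v = [] \<or> hd v \<noteq> inv_letter (last u))"
  by (auto simp: reduced_def successively_append_iff)

lemma fmul_eq_append: "reduced (u @ v) \<Longrightarrow> fmul u v = u @ v"
  by (induction u) (auto simp: push_letter_reduced reduced_Cons)

text \<open>The part that cancels in a product is a common prefix of the inverse of the left factor and the
right factor. This is the form in which cancellation is used throughout.\<close>

lemma fmul_finv_lcp:
  "reduced u \<Longrightarrow> reduced v \<Longrightarrow>
    fmul (finv u) v = finv (drop (lcp u v) u) @ drop (lcp u v) v"
proof (induction u v rule: lcp.induct)
  case (1 x u y v)
  have f: "finv (z # u) = finv u @ [inv_letter z]" for z by (simp add: finv_def)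
  show ?case
  proof (cases "x = y")
    case True
    then show ?thesis using 1 by (simp add: f reduced_Cons)
  next
    case False
    have "reduced (finv (x # u))" using 1(2) by simp
    moreover have "last (finv (x # u)) = inv_letter x" by (simp add: f)
    ultimately have "reduced (finv (x # u) @ y # v)"
      using 1(3) False by (simp add: reduced_append_conv[of _ "y # v"])
    then show ?thesis using False fmul_eq_append[of "finv (x # u)" "y # v"] by simp
  qed
qed (auto simp: fmul_Nil finv_def[of "[]"])

lemma length_fmul_finv:
  assumes "reduced u" "reduced v"
  shows "length (fmul (finv u) v) + 2 * lcp u v = length u + length v"
  using lcp_le[of u v] by (simp add: fmul_finv_lcp[OF assms])

text \<open>If a reduced word and its inverse agreed on the first half, the word would be symmetric about
its middle up to inversion: at the middle there would be two cancelling letters or a letter equal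
to its own inverse.\<close>

lemma lcp_finv_self:
  assumes w: "reduced w" "w \<noteq> []"
  shows "2 * lcp w (finv w) < length w"
proof (rule ccontr)
  let ?k = "lcp w (finv w)"
  assume *: "\<not> ?thesis"
  have "w ! i = inv_letter (w ! (length w - Suc i))" if "i < ?k" for i
  proof -
    have "take ?k w ! i = take ?k (finv w) ! i" by (metis take_lcp)
    then show ?thesis using that lcp_le(1)[of w "finv w"] by (simp add: finv_def rev_nth)
  qed
  note mirror = this
  show False
  proof (cases "even (length w)")
    case True
    then obtain b where b: "length w = 2 * b" by (elim evenE)
    then have "b > 0" using w(2) by (cases b) auto
    define i where "i = b - 1"
    have i: "Suc i = length w div 2" "Suc i < length w" "i < ?k" "length w - Suc i = Suc i"
      using b \<open>b > 0\<close> * by (auto simp: i_def)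
    then have "w ! i = inv_letter (w ! Suc i)" using mirror[OF i(3)] by simp
    moreover have "w ! Suc i \<noteq> inv_letter (w ! i)"
      using w(1) i(2) by (simp add: reduced_def successively_conv_nth)
    ultimately show False by simp
  next
    case False
    define i where "i = length w div 2"
    have "i < ?k" "length w - Suc i = i" using False * by (auto simp: i_def elim!: oddE)
    then show False using mirror[of i] by simp
  qed
qed

section \<open>The Nielsen order\<close>

definition letter_rank :: "'n::finite \<times> bool \<Rightarrow> nat" where
  "letter_rank = to_nat_on UNIV"

lemma letter_rank:
  fixes a b :: "'n::finite \<times> bool"
  shows "letter_rank a < CARD('n \<times> bool)" "letter_rank a = letter_rank b \<longleftrightarrow> a = b"
proof -
  have "bij_betw letter_rank (UNIV :: ('n \<times> bool) set) {..<CARD('n \<times> bool)}"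
    unfolding letter_rank_def by (rule to_nat_on_finite) simp
  then have inj: "inj (letter_rank :: 'n \<times> bool \<Rightarrow> nat)"
    and rng: "range (letter_rank :: 'n \<times> bool \<Rightarrow> nat) = {..<CARD('n \<times> bool)}"
    unfolding bij_betw_def by blast+
  show "letter_rank a < CARD('n \<times> bool)" using rng by blast
  show "letter_rank a = letter_rank b \<longleftrightarrow> a = b" using inj by (rule inj_eq)
qed

text \<open>The value of a word in base \<open>2n\<close>: it realizes the lexicographic order on words of equal length
by natural numbers.\<close>

primrec word_rank :: "'n::finite word \<Rightarrow> nat" where
  "word_rank [] = 0"
| "word_rank (a # w) = letter_rank a * CARD('n \<times> bool) ^ length w + word_rank w"

lemma word_rank_less: "word_rank w < CARD('n \<times> bool) ^ length w" for w :: "'n::finite word"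
proof (induction w)
  case (Cons a w)
  let ?B = "CARD('n \<times> bool)"
  have "letter_rank a + 1 \<le> ?B" using letter_rank(1)[of a] by simp
  then have "(letter_rank a + 1) * ?B ^ length w \<le> ?B * ?B ^ length w" by (rule mult_le_mono1)
  then show ?case using Cons by simp
qed simp

lemma word_rank_append:
  "word_rank (u @ v) = word_rank u * CARD('n \<times> bool) ^ length v + word_rank v"
  for u v :: "'n::finite word"
  by (induction u) (auto simp: power_add algebra_simps)

lemma word_rank_inj:
  "length u = length v \<Longrightarrow> word_rank u = word_rank v \<Longrightarrow> u = v" for u v :: "'n::finite word"
proof (induction u v rule: list_induct2)
  case (Cons a u b v)
  let ?P = "CARD('n \<times> bool) ^ length u"
  have r: "word_rank u < ?P" "word_rank v < ?P"
    using word_rank_less[of u] word_rank_less[of v] Cons.hyps by simp_all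
  have e: "letter_rank a * ?P + word_rank u = letter_rank b * ?P + word_rank v"
    using Cons by simp
  have "letter_rank a = (letter_rank a * ?P + word_rank u) div ?P"
    "letter_rank b = (letter_rank b * ?P + word_rank v) div ?P" using r by auto
  then have "letter_rank a = letter_rank b" using e by metis
  then show ?case using e Cons.IH by (simp add: letter_rank(2))
qed simp

definition half_word :: "'n word \<Rightarrow> 'n word" where
  "half_word w = take (length w div 2) w"

definition total_length :: "('n::finite word \<Rightarrow> 'n word) \<Rightarrow> nat" where
  "total_length \<alpha> = (\<Sum>a\<in>UNIV. length (\<alpha> [a]))"

definition total_rank :: "('n::finite word \<Rightarrow> 'n word) \<Rightarrow> nat" where
  "total_rank \<alpha> = (\<Sum>a\<in>UNIV. word_rank (half_word (\<alpha> [a])))"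

text \<open>The second component breaks the ties in which a factor cancels exactly half against each
neighbour, where no transvection shortens the tuple. Only first halves are ranked: then changing
the beginning of \<open>\<alpha> [d]\<close> leaves the rank of \<open>\<alpha> [inv_letter d]\<close> alone.\<close>

definition nielsen_order :: "(('n::finite word \<Rightarrow> 'n word) \<times> ('n word \<Rightarrow> 'n word)) set" where
  "nielsen_order = measures [total_length, total_rank]"

lemma sum_UNIV_letters:
  "(\<Sum>a\<in>UNIV. f a) = f d + f (inv_letter d) + (\<Sum>a\<in>- {d, inv_letter d}. f a)"
  for f :: "'n::finite \<times> bool \<Rightarrow> nat"
proof -
  have "(\<Sum>a\<in>UNIV. f a) = (\<Sum>a\<in>insert d (insert (inv_letter d) (- {d, inv_letter d})). f a)"
    by (rule sum.cong) auto
  then show ?thesis by simp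
qed

lemma nielsen_order_step:
  fixes \<alpha> \<beta> :: "'n::finite word \<Rightarrow> 'n word"
  assumes same: "\<And>a. a \<noteq> d \<Longrightarrow> a \<noteq> inv_letter d \<Longrightarrow> \<beta> [a] = \<alpha> [a]"
    and len: "length (\<beta> [inv_letter d]) = length (\<beta> [d])" "length (\<alpha> [inv_letter d]) = length (\<alpha> [d])"
    and less: "length (\<beta> [d]) < length (\<alpha> [d]) \<or>
      length (\<beta> [d]) = length (\<alpha> [d]) \<and>
      half_word (\<beta> [inv_letter d]) = half_word (\<alpha> [inv_letter d]) \<and>
      word_rank (half_word (\<beta> [d])) < word_rank (half_word (\<alpha> [d]))"
  shows "(\<beta>, \<alpha>) \<in> nielsen_order"
proof -
  have s: "(\<Sum>a\<in>- {d, inv_letter d}. f (\<beta> [a])) = (\<Sum>a\<in>- {d, inv_letter d}. f (\<alpha> [a]))"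
    for f :: "'n word \<Rightarrow> nat"
    by (rule sum.cong) (auto simp: same)
  show ?thesis
    using less s[of length] s[of "\<lambda>w. word_rank (half_word w)"] len
    unfolding nielsen_order_def total_length_def total_rank_def
      sum_UNIV_letters[of "\<lambda>a. length (\<beta> [a])" d] sum_UNIV_letters[of "\<lambda>a. length (\<alpha> [a])" d]
      sum_UNIV_letters[of "\<lambda>a. word_rank (half_word (\<beta> [a]))" d]
      sum_UNIV_letters[of "\<lambda>a. word_rank (half_word (\<alpha> [a]))" d]
      in_measures by auto
qed

section \<open>Nielsen reduced automorphisms\<close>

text \<open>Here \<open>l a\<close> bounds what can cancel from the front of \<open>\<alpha> [a]\<close>. Since the two ends together leave at
least one letter, the part of \<open>\<alpha> [b]\<close> that survives on its right reaches beyond what cancels on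
its left; so the cancellation between consecutive factors is the same as in the whole product,
and every factor contributes at least one letter.\<close>

lemma nielsen_reduced_prefix:
  fixes \<alpha> :: "'n word \<Rightarrow> 'n word"
  assumes \<alpha>: "\<alpha> \<in> hom free_group free_group"
    and half: "\<And>a. 2 * l a \<le> length (\<alpha> [a])" and lcp: "\<And>a c. a \<noteq> c \<Longrightarrow> lcp (\<alpha> [a]) (\<alpha> [c]) \<le> l a"
    and small: "\<And>a. l a + l (inv_letter a) < length (\<alpha> [a])"
    and w: "reduced (a # w)"
  shows "take (length (\<alpha> [a]) - l (inv_letter a)) (\<alpha> (a # w)) =
      take (length (\<alpha> [a]) - l (inv_letter a)) (\<alpha> [a])"
    "length (\<alpha> [a]) - l (inv_letter a) + length w \<le> length (\<alpha> (a # w))"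
proof -
  let ?P = "\<lambda>a w. take (length (\<alpha> [a]) - l (inv_letter a)) (\<alpha> (a # w)) =
      take (length (\<alpha> [a]) - l (inv_letter a)) (\<alpha> [a]) \<and>
      length (\<alpha> [a]) - l (inv_letter a) + length w \<le> length (\<alpha> (a # w))"
  have "?P a w" using w
  proof (induction w arbitrary: a)
    case Nil
    show ?case by simp
  next
    case (Cons b w)
    then have IH: "take (length (\<alpha> [b]) - l (inv_letter b)) (\<alpha> (b # w)) =
        take (length (\<alpha> [b]) - l (inv_letter b)) (\<alpha> [b])"
      "length (\<alpha> [b]) - l (inv_letter b) + length w \<le> length (\<alpha> (b # w))"
      and red: "reduced (b # w)" "b \<noteq> inv_letter a"
      by (auto simp: reduced_Cons)
    define u v where "u = \<alpha> [inv_letter a]" and "v = \<alpha> (b # w)"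
    define k where "k = lcp u v"
    have a: "\<alpha> [a] = finv u" by (simp add: u_def hom_inv_letter[OF \<alpha>])
    have k': "lcp u (\<alpha> [b]) \<le> l (inv_letter a)" "lcp u (\<alpha> [b]) \<le> l b"
      using lcp[of "inv_letter a" b] lcp[of b "inv_letter a"] red(2)
      by (auto simp: u_def lcp_commute)
    have "lcp u v = lcp u (\<alpha> [b])"
      unfolding v_def using k' small[of b] by (intro lcp_eq_if_same_prefix[OF IH(1)[symmetric]]) simp
    then have k: "k \<le> l (inv_letter a)" "k \<le> l b" using k' by (simp_all add: k_def)
    have ru: "reduced u" "reduced v" using homD(1)[OF \<alpha>] red by (simp_all add: u_def v_def)
    have "\<alpha> (a # b # w) = fmul (finv u) v"
      using hom_Cons[OF \<alpha> Cons.prems] by (simp add: a v_def)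
    also have "\<dots> = finv (drop k u) @ drop k v"
      unfolding k_def by (rule fmul_finv_lcp[OF ru])
    finally have e: "\<alpha> (a # b # w) = take (length u - k) (\<alpha> [a]) @ drop k v"
      by (simp add: a finv_def drop_map rev_take take_map rev_map[symmetric] flip: rev_drop)
        (simp add: rev_drop take_map rev_map)
    have lu: "length (\<alpha> [a]) = length u" by (simp add: a)
    have k2: "k \<le> length u" "k \<le> length v" using lcp_le[of u v] by (simp_all add: k_def)
    have "take (length u - l (inv_letter a)) (\<alpha> (a # b # w)) =
        take (length u - l (inv_letter a)) (\<alpha> [a])"
    proof -
      have "length u - l (inv_letter a) \<le> length u - k" using k by simp
      then show ?thesis unfolding e using lu by (simp add: min_absorb1)
    qed
    moreover have "length u - l (inv_letter a) + length (b # w) \<le> length (\<alpha> (a # b # w))"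
      unfolding e using k k2 lu IH(2) small[of b] half[of "inv_letter a"]
      by (simp add: v_def[symmetric] u_def[symmetric])
    ultimately show ?case by (simp add: lu)
  qed
  then show "take (length (\<alpha> [a]) - l (inv_letter a)) (\<alpha> (a # w)) =
      take (length (\<alpha> [a]) - l (inv_letter a)) (\<alpha> [a])"
    "length (\<alpha> [a]) - l (inv_letter a) + length w \<le> length (\<alpha> (a # w))" by auto
qed

text \<open>A word whose image is a single letter must itself have length one, so every letter is the image
of a letter; a finite set of letters leaves no room for longer images.\<close>

lemma nielsen_reduced_imp_letters:
  fixes \<alpha> :: "'n::finite word \<Rightarrow> 'n word"
  assumes \<alpha>: "\<alpha> \<in> auto free_group"
    and half: "\<And>a. 2 * l a \<le> length (\<alpha> [a])" and lcp: "\<And>a c. a \<noteq> c \<Longrightarrow> lcp (\<alpha> [a]) (\<alpha> [c]) \<le> l a"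
    and small: "\<And>a. l a + l (inv_letter a) < length (\<alpha> [a])"
  shows "\<exists>s. \<forall>a. \<alpha> [a] = [s a]"
proof -
  have hom: "\<alpha> \<in> hom free_group free_group" using autoD[OF \<alpha>] by blast
  have "\<exists>a. \<alpha> [a] = [x]" for x
  proof -
    have "[x] \<in> \<alpha> ` carrier free_group"
      using autoD(4)[OF \<alpha>] by (simp add: bij_betw_def carrier_free_group)
    then obtain w where w: "reduced w" "\<alpha> w = [x]" by (auto simp: carrier_free_group)
    then obtain a w' where aw: "w = a # w'" using homD(3)[OF hom] by (cases w) auto
    have "length (\<alpha> [a]) - l (inv_letter a) + length w' \<le> 1"
      using nielsen_reduced_prefix(2)[OF hom half lcp small, of a w'] w aw by simp
    then have "length w' = 0" using small[of a] by linarith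
    then have "w' = []" by simp
    then show ?thesis using w aw by blast
  qed
  then obtain t where t: "\<And>x. \<alpha> [t x] = [x]" by metis
  have "inj t" by (rule injI) (metis t list.inject)
  then have "surj t" using finite_UNIV_inj_surj[of t] by simp
  then have "\<exists>s. \<alpha> [a] = [s]" for a by (metis t surjD)
  then show ?thesis by metis
qed

lemma lcp_ge:
  "take m u = take m v \<Longrightarrow> m \<le> length u \<Longrightarrow> m \<le> length v \<Longrightarrow> m \<le> lcp u v"
proof (induction u v arbitrary: m rule: lcp.induct)
  case (1 x u y v)
  show ?case
  proof (cases m)
    case (Suc n)
    then show ?thesis using 1(1)[of n] 1(2-4) by auto
  qed simp
qed auto

lemma finv_drop_finv: "finv (drop m (finv w)) = take (length w - m) w"
  by (simp add: finv_def rev_map rev_drop take_map o_def)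

text \<open>Minimality in length says that at most half of a factor cancels on each side (\<open>N1\<close>). If exactly
half cancels on both sides, then \<open>\<alpha> [b]\<close> is \<open>p\<close> times the inverse of \<open>q\<close>, where \<open>p\<close> and \<open>q\<close> are
prefixes of the images of other letters; a transvection can exchange one of these prefixes for
the other, and the lexicographically smaller one wins (\<open>N2\<close>).\<close>

lemma not_nielsen_reducible_imp_letters:
  fixes \<alpha> :: "'n::finite word \<Rightarrow> 'n word"
  assumes \<alpha>: "\<alpha> \<in> auto free_group"
    and min: "\<And>b d. fst b \<noteq> fst d \<Longrightarrow>
      (compose (carrier free_group) \<alpha> (transvection b d), \<alpha>) \<notin> nielsen_order"
  shows "\<exists>s. \<forall>a. \<alpha> [a] = [s a]"
proof -
  have hom: "\<alpha> \<in> hom free_group free_group" using autoD[OF \<alpha>] by blast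
  define W where "W = (\<lambda>a. \<alpha> [a])"
  have red: "reduced (W a)" for a unfolding W_def by (rule homD(1)[OF hom]) simp
  have Winv: "W (inv_letter a) = finv (W a)" for a unfolding W_def by (rule hom_inv_letter[OF hom])
  have Wne: "W a \<noteq> []" for a
  proof
    assume "W a = []"
    then have "\<alpha> [a] = \<alpha> []" using homD(3)[OF hom] by (simp add: W_def)
    moreover have "inj_on \<alpha> (carrier free_group)" using autoD(4)[OF \<alpha>] by (simp add: bij_betw_def)
    ultimately show False using inj_onD[of \<alpha> "carrier free_group" "[a]" "[]"]
      by (simp add: carrier_free_group)
  qed
  define \<beta> where "\<beta> = (\<lambda>b d. compose (carrier free_group) \<alpha> (transvection b d))"
  have \<beta>: "\<beta> b d [d] = fmul (W b) (W d)" "\<beta> b d [inv_letter d] = finv (\<beta> b d [d])"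
    "a \<noteq> d \<Longrightarrow> a \<noteq> inv_letter d \<Longrightarrow> \<beta> b d [a] = W a"
    if bd: "fst b \<noteq> fst d" for a b d
  proof -
    have 1: "\<alpha> [b, d] = fmul (W b) (W d)"
      unfolding W_def using hom_Cons[OF hom reduced_pair[OF bd]] .
    then show 2: "\<beta> b d [d] = fmul (W b) (W d)"
      using bd by (simp add: \<beta>_def compose_def carrier_free_group transvection_apply)
    have "\<alpha> (finv [b, d]) = finv (\<alpha> [b, d])" by (rule homD(4)[OF hom reduced_pair[OF bd]])
    then show "\<beta> b d [inv_letter d] = finv (\<beta> b d [d])"
      using bd by (simp add: \<beta>_def compose_def carrier_free_group transvection_apply)
    show "a \<noteq> d \<Longrightarrow> a \<noteq> inv_letter d \<Longrightarrow> \<beta> b d [a] = W a"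
      using bd transvection_apply(3)[OF bd, of a]
      by (auto simp: \<beta>_def compose_def carrier_free_group W_def fst_eq_iff_letter)
  qed
  have min': "\<not> (length (\<beta> b d [d]) < length (W d) \<or> length (\<beta> b d [d]) = length (W d) \<and>
      half_word (\<beta> b d [inv_letter d]) = half_word (W (inv_letter d)) \<and>
      word_rank (half_word (\<beta> b d [d])) < word_rank (half_word (W d)))"
    if bd: "fst b \<noteq> fst d" for b d
  proof
    assume *: "length (\<beta> b d [d]) < length (W d) \<or> length (\<beta> b d [d]) = length (W d) \<and>
      half_word (\<beta> b d [inv_letter d]) = half_word (W (inv_letter d)) \<and>
      word_rank (half_word (\<beta> b d [d])) < word_rank (half_word (W d))"
    have "(\<beta> b d, \<alpha>) \<in> nielsen_order"
    proof (rule nielsen_order_step)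
      show "a \<noteq> d \<Longrightarrow> a \<noteq> inv_letter d \<Longrightarrow> \<beta> b d [a] = \<alpha> [a]" for a
        using \<beta>(3)[OF bd] by (simp add: W_def)
      show "length (\<beta> b d [inv_letter d]) = length (\<beta> b d [d])" using \<beta>(2)[OF bd] by simp
      show "length (\<alpha> [inv_letter d]) = length (\<alpha> [d])" using Winv[of d] by (simp add: W_def)
    qed (use * in \<open>simp add: W_def\<close>)
    with min[OF bd] show False by (simp add: \<beta>_def)
  qed
  \<comment> \<open>Multiplying \<open>c\<close> by the inverse of \<open>a\<close> does not shorten its image.\<close>
  have N1: "2 * lcp (W a) (W c) \<le> length (W a)" if ac: "a \<noteq> c" for a c
  proof (cases "fst a = fst c")
    case True
    then have "c = inv_letter a" using ac by (auto simp: fst_eq_iff_letter)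
    then show ?thesis using lcp_finv_self[OF red[of a] Wne[of a]] by (simp add: Winv)
  next
    case False
    then have bd: "fst (inv_letter a) \<noteq> fst c" by simp
    have "\<beta> (inv_letter a) c [c] = fmul (finv (W a)) (W c)" using \<beta>(1)[OF bd] by (simp add: Winv)
    then show ?thesis
      using min'[OF bd] length_fmul_finv[OF red[of a] red[of c]] by auto
  qed
  have N2: False
    if c: "c \<noteq> b" "2 * lcp (W b) (W c) = length (W b)"
      and d: "d \<noteq> inv_letter b" "2 * lcp (W (inv_letter b)) (W d) = length (W b)"
      and less: "word_rank (take (length (W b) div 2) (W b)) <
        word_rank (take (length (W b) div 2) (W (inv_letter b)))" for b c d
  proof -
    define m where "m = length (W b) div 2"
    define p q s where "p = take m (W b)" and "q = take m (W (inv_letter b))" and "s = drop m (W d)"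
    have m: "length (W b) = 2 * m" "lcp (W (inv_letter b)) (W d) = m"
      unfolding m_def using c(2) d(2) by presburger+
    have pq: "length p = m" "length q = m" using m by (simp_all add: p_def q_def Winv)
    have "d \<noteq> b"
    proof
      assume "d = b"
      then have "2 * lcp (W b) (finv (W b)) = length (W b)"
        using d(2) by (simp add: Winv lcp_commute)
      then show False using lcp_finv_self[OF red[of b] Wne[of b]] by simp
    qed
    then have bd: "fst b \<noteq> fst d" using d(1) by (metis fst_eq_iff_letter)
    have K: "2 * m \<le> length (W d)" using N1[OF d(1)] m(2) by (simp add: lcp_commute)
    have Wd: "W d = q @ s"
      using take_lcp[of "W (inv_letter b)" "W d"] by (simp add: m(2) q_def s_def)
    have ls: "m \<le> length s" using K Wd pq by simp
    have "\<beta> b d [d] = fmul (finv (W (inv_letter b))) (W d)" using \<beta>(1)[OF bd] by (simp add: Winv)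
    also have "\<dots> = finv (drop m (W (inv_letter b))) @ s"
      using fmul_finv_lcp[OF red[of "inv_letter b"] red[of d]] m(2) by (simp add: s_def)
    also have "finv (drop m (W (inv_letter b))) = p"
      using m(1) by (simp add: Winv finv_drop_finv p_def)
    finally have \<beta>d: "\<beta> b d [d] = p @ s" .
    have "half_word (p @ s) = p @ take ((2 * m + (length s - m)) div 2 - m) s"
      "half_word (q @ s) = q @ take ((2 * m + (length s - m)) div 2 - m) s"
      using ls pq by (simp_all add: half_word_def)
    then have "word_rank (half_word (\<beta> b d [d])) < word_rank (half_word (W d))"
      using less ls by (simp add: \<beta>d Wd word_rank_append p_def[symmetric] q_def[symmetric] m_def[symmetric])
    moreover have "half_word (\<beta> b d [inv_letter d]) = half_word (W (inv_letter d))"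
      using ls pq by (simp add: \<beta>(2)[OF bd] \<beta>d Winv Wd half_word_def finv_append)
    moreover have "length (\<beta> b d [d]) = length (W d)" using pq by (simp add: \<beta>d Wd)
    ultimately show False using min'[OF bd] by blast
  qed
  define l where "l = (\<lambda>a. Max ((\<lambda>c. lcp (W a) (W c)) ` (- {a})))"
  have l_ge: "lcp (W a) (W c) \<le> l a" if "a \<noteq> c" for a c
    unfolding l_def using that by (intro Max_ge) auto
  have l_ex: "\<exists>c. c \<noteq> a \<and> l a = lcp (W a) (W c)" for a
  proof -
    have "inv_letter a \<in> - {a}" by simp
    then have "l a \<in> (\<lambda>c. lcp (W a) (W c)) ` (- {a})"
      unfolding l_def by (intro Max_in) (auto simp del: Compl_iff)
    then show ?thesis by auto
  qed
  have half: "2 * l a \<le> length (W a)" for a using l_ex[of a] N1 by metis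
  have small: "l b + l (inv_letter b) < length (W b)" for b
  proof (rule ccontr)
    assume "\<not> ?thesis"
    then have eq: "2 * l b = length (W b)" "2 * l (inv_letter b) = length (W b)"
      using half[of b] half[of "inv_letter b"] by (simp_all add: Winv)
    obtain c where c: "c \<noteq> b" "2 * lcp (W b) (W c) = length (W b)" using l_ex[of b] eq by metis
    obtain d where d: "d \<noteq> inv_letter b" "2 * lcp (W (inv_letter b)) (W d) = length (W b)"
      using l_ex[of "inv_letter b"] eq by metis
    define m where "m = length (W b) div 2"
    let ?p = "take m (W b)" and ?q = "take m (W (inv_letter b))"
    have "?p \<noteq> ?q"
    proof
      assume "?p = ?q"
      then have "m \<le> lcp (W b) (finv (W b))" by (intro lcp_ge) (auto simp: Winv m_def)
      then show False using lcp_finv_self[OF red[of b] Wne[of b]] eq(1) unfolding m_def by presburger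
    qed
    moreover have "length ?p = length ?q" by (simp add: Winv)
    ultimately consider "word_rank ?p < word_rank ?q" | "word_rank ?q < word_rank ?p"
      using word_rank_inj[of ?p ?q] by linarith
    then show False
    proof cases
      case 1
      then show False using N2[OF c d] by (simp add: m_def)
    next
      case 2
      then show False using N2[of d "inv_letter b" c] c d by (simp add: m_def Winv)
    qed
  qed
  show ?thesis
    by (rule nielsen_reduced_imp_letters[OF \<alpha>, of l])
      (use half l_ge small in \<open>auto simp: W_def\<close>)
qed

section \<open>Signed permutations\<close>

definition acts_on_letters ::
    "('n word \<Rightarrow> 'n word) \<Rightarrow> ('n \<times> bool \<Rightarrow> 'n \<times> bool) \<Rightarrow> bool" where
  "acts_on_letters \<alpha> s \<longleftrightarrow> (\<forall>a. \<alpha> [a] = [s a])"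

lemma acts_on_lettersD: "acts_on_letters \<alpha> s \<Longrightarrow> \<alpha> [a] = [s a]"
  unfolding acts_on_letters_def by blast

lemma acts_on_letters_inv:
  assumes "\<alpha> \<in> carrier SAut" "acts_on_letters \<alpha> s"
  shows "s (inv_letter a) = inv_letter (s a)"
  using hom_inv_letter[OF SAut_hom[OF assms(1)], of a] acts_on_lettersD[OF assms(2)] by simp

lemma acts_on_letters_inj:
  assumes "\<alpha> \<in> carrier SAut" "acts_on_letters \<alpha> s"
  shows "s a = s b \<longleftrightarrow> a = b" "fst (s a) = fst (s b) \<longleftrightarrow> fst a = fst b"
proof -
  have inj: "inj_on \<alpha> (carrier free_group)"
    using assms(1) autoD(4) by (auto simp: carrier_SAut bij_betw_def)
  have "\<alpha> [a] = \<alpha> [b] \<longleftrightarrow> [a] = [b]" for a b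
    using inj by (intro inj_on_eq_iff) (auto simp: carrier_free_group)
  then show 1: "s a = s b \<longleftrightarrow> a = b" for a b
    using acts_on_lettersD[OF assms(2)] by simp
  show "fst (s a) = fst (s b) \<longleftrightarrow> fst a = fst b"
    using 1[of a b] 1[of a "inv_letter b"] acts_on_letters_inv[OF assms, of b]
    by (simp add: fst_eq_iff_letter)
qed

lemma acts_on_letters_mult:
  assumes "\<alpha> \<in> carrier SAut" "acts_on_letters \<alpha> s" "\<beta> \<in> carrier SAut" "acts_on_letters \<beta> t"
  shows "acts_on_letters (\<alpha> \<cdot> \<beta>) (\<lambda>a. s (t a))"
  unfolding acts_on_letters_def
  using acts_on_lettersD[OF assms(2)] acts_on_lettersD[OF assms(4)] assms(1,3) by (simp add: SAut_apply)

lemma acts_on_letters_one: "acts_on_letters \<one>\<^bsub>SAut\<^esub> (\<lambda>a. a)"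
  by (simp add: acts_on_letters_def SAut_one carrier_free_group)

lemma acts_on_letters_eqI:
  assumes "\<alpha> \<in> carrier SAut" "acts_on_letters \<alpha> s" "\<beta> \<in> carrier SAut" "acts_on_letters \<beta> t"
    and "\<And>i. s (i, True) = t (i, True)"
  shows "\<alpha> = \<beta>"
proof (rule SAut_eqI[OF assms(1,3)])
  show "\<exists>a. fst a = i \<and> \<alpha> [a] = \<beta> [a]" for i
    using acts_on_lettersD[OF assms(2)] acts_on_lettersD[OF assms(4)] assms(5)
    by (intro exI[of _ "(i, True)"]) simp
qed

text \<open>Conjugating by a signed permutation relabels the letters of a transvection.\<close>

lemma acts_on_letters_conj:
  assumes \<sigma>: "\<sigma> \<in> carrier SAut" "acts_on_letters \<sigma> s" and bd: "fst b \<noteq> fst d"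
  shows "\<sigma> \<cdot> transvection b d = transvection (s b) (s d) \<cdot> \<sigma>"
proof (rule SAut_eqI)
  interpret group SAut by (rule group_SAut)
  have bd': "fst (s b) \<noteq> fst (s d)" using acts_on_letters_inj(2)[OF \<sigma>] bd by simp
  note T = transvection_in_SAut[OF bd] transvection_in_SAut[OF bd']
  show "\<sigma> \<cdot> transvection b d \<in> carrier SAut"
    "transvection (s b) (s d) \<cdot> \<sigma> \<in> carrier SAut" using T \<sigma> by auto
  fix i
  show "\<exists>a. fst a = i \<and> (\<sigma> \<cdot> transvection b d) [a] = (transvection (s b) (s d) \<cdot> \<sigma>) [a]"
  proof (cases "i = fst d")
    case True
    have "s d \<noteq> inv_letter (s b)" using bd' by auto
    then have "\<sigma> [b, d] = [s b, s d]"
      using hom_Cons[OF SAut_hom[OF \<sigma>(1)] reduced_pair[OF bd]]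
      by (simp add: acts_on_lettersD[OF \<sigma>(2)])
    then show ?thesis
      using True \<sigma> T transvection_apply(1)[OF bd] transvection_apply(1)[OF bd']
      by (intro exI[of _ d]) (simp add: SAut_apply acts_on_lettersD[OF \<sigma>(2)])
  next
    case False
    then have "fst (s (i, True)) \<noteq> fst (s d)" using acts_on_letters_inj(2)[OF \<sigma>] by simp
    then show ?thesis
      using False \<sigma> T transvection_apply(3)[OF bd] transvection_apply(3)[OF bd']
      by (intro exI[of _ "(i, True)"]) (simp add: SAut_apply acts_on_lettersD[OF \<sigma>(2)])
  qed
qed

text \<open>The signed transposition \<open>x\<^sub>i \<mapsto> x\<^sub>j\<close>, \<open>x\<^sub>j \<mapsto> x\<^sub>i\<^sup>-\<^sup>1\<close>. Defining it as a product of transvections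
makes it an element of every subgroup that contains the transvections.\<close>

definition tau :: "'n::finite \<Rightarrow> 'n \<Rightarrow> 'n word \<Rightarrow> 'n word" where
  "tau i j = transvection (j, True) (i, True) \<cdot>
     (transvection (i, False) (j, True) \<cdot> transvection (j, False) (i, False))"

definition tau_letter :: "'n \<Rightarrow> 'n \<Rightarrow> 'n \<times> bool \<Rightarrow> 'n \<times> bool" where
  "tau_letter i j a =
    (if fst a = i then (j, snd a) else if fst a = j then (i, \<not> snd a) else a)"

definition eps :: "'n::finite \<Rightarrow> 'n \<Rightarrow> 'n word \<Rightarrow> 'n word" where
  "eps i j = tau i j \<cdot> tau i j"

definition eps_letter :: "'n \<Rightarrow> 'n \<Rightarrow> 'n \<times> bool \<Rightarrow> 'n \<times> bool" where
  "eps_letter i j a = (if fst a = i \<or> fst a = j then inv_letter a else a)"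

lemma tau:
  assumes ij: "i \<noteq> j"
  shows "tau i j \<in> carrier SAut" "acts_on_letters (tau i j) (tau_letter i j)"
proof -
  interpret group SAut by (rule group_SAut)
  have T: "transvection (j, x) (i, y) \<in> carrier SAut" "transvection (i, x) (j, y) \<in> carrier SAut" for x y
    using ij by (auto intro!: transvection_in_SAut)
  show S: "tau i j \<in> carrier SAut" unfolding tau_def using T by auto
  have "tau i j [(k, True)] = [tau_letter i j (k, True)]" for k
    using ij T
    by (auto simp: tau_def SAut_apply transvection_def letter_image_transvection inv_letter_def
        tau_letter_def reduced_Cons)
  moreover have "tau i j [(k, False)] = [tau_letter i j (k, False)]" for k
    using hom_inv_letter[OF SAut_hom[OF S], of "(k, True)"] calculation[of k] ij
    by (auto simp: inv_letter_def tau_letter_def)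
  ultimately show "acts_on_letters (tau i j) (tau_letter i j)"
    unfolding acts_on_letters_def by (metis (full_types) surj_pair)
qed

lemma eps:
  assumes ij: "i \<noteq> j"
  shows "eps i j \<in> carrier SAut" "acts_on_letters (eps i j) (eps_letter i j)"
proof -
  interpret group SAut by (rule group_SAut)
  show "eps i j \<in> carrier SAut" unfolding eps_def using tau[OF ij] by auto
  have "(\<lambda>a. tau_letter i j (tau_letter i j a)) = eps_letter i j"
    using ij by (auto simp: fun_eq_iff tau_letter_def eps_letter_def inv_letter_def)
  then show "acts_on_letters (eps i j) (eps_letter i j)"
    using acts_on_letters_mult[OF tau[OF ij] tau[OF ij]] by (simp add: eps_def)
qed

text \<open>Multiplying by \<open>tau i j\<close> increases the number of generators that are mapped to themselves up to
inversion, and then sign changes can be removed in pairs. A single remaining sign would give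
determinant \<open>-1\<close>.\<close>

lemma signed_permutation_generated:
  fixes H :: "('n::finite word \<Rightarrow> 'n word) set"
  assumes H: "subgroup H SAut" and tauH: "\<And>i j. i \<noteq> j \<Longrightarrow> tau i j \<in> H"
    and \<alpha>: "\<alpha> \<in> carrier SAut" "acts_on_letters \<alpha> s"
  shows "\<alpha> \<in> H"
proof -
  interpret group SAut by (rule group_SAut)
  have epsH: "eps i j \<in> H" if "i \<noteq> j" for i j
    unfolding eps_def using subgroup.m_closed[OF H] tauH[OF that] by blast
  have cancel: "\<alpha> \<in> H" if "\<sigma> \<in> H" "\<sigma> \<cdot> \<alpha> \<in> H" "\<alpha> \<in> carrier SAut" for \<sigma> \<alpha>
  proof -
    have "inv\<^bsub>SAut\<^esub> \<sigma> \<cdot> (\<sigma> \<cdot> \<alpha>) \<in> H"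
      using H that subgroup.m_closed subgroup.m_inv_closed by metis
    then show ?thesis using that subgroup.mem_carrier[OF H] by (simp add: inv_solve_left' m_assoc[symmetric])
  qed
  have signs: "\<alpha> \<in> H"
    if "\<alpha> \<in> carrier SAut" "acts_on_letters \<alpha> s" "\<And>i. fst (s (i, True)) = i" for \<alpha> s
    using that
  proof (induction "card {i. s (i, True) = (i, False)}" arbitrary: \<alpha> s rule: less_induct)
    case less
    define S where "S = {i. s (i, True) = (i, False)}"
    have s: "s (i, True) = (i, i \<notin> S)" for i
      using less.prems(3)[of i] by (cases "s (i, True)") (auto simp: S_def)
    show ?case
    proof (cases "S = {}")
      case True
      then have "\<alpha> = \<one>\<^bsub>SAut\<^esub>"
        using s by (intro acts_on_letters_eqI[OF less.prems(1,2) one_closed acts_on_letters_one]) auto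
      then show ?thesis using subgroup.one_closed[OF H] by simp
    next
      case False
      then obtain i where i: "i \<in> S" by blast
      show ?thesis
      proof (cases "S = {i}")
        case True
        have "abelianized_matrix \<alpha> $ k $ l = (if k = l then if k = i then - 1 else 1 else 0)" for k l
          using s[of l] True acts_on_lettersD[OF less.prems(2)]
          by (auto simp: abelianized_matrix_def abelianize_Cons axis_def)
        then have "det (abelianized_matrix \<alpha>) = (\<Prod>k\<in>UNIV. if k = i then - 1 else 1)"
          by (subst det_diagonal) auto
        also have "\<dots> = - 1" by (subst prod.delta) auto
        finally show ?thesis using less.prems(1) by (simp add: carrier_SAut)
      next
        case False
        with i obtain j where "j \<in> S" "i \<noteq> j" by blast
        with i have 3: "i \<in> S" "j \<in> S" "i \<noteq> j" by blast+
        let ?t = "\<lambda>a. eps_letter i j (s a)"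
        have "eps i j \<cdot> \<alpha> \<in> H"
        proof (rule less.hyps)
          show "acts_on_letters (eps i j \<cdot> \<alpha>) ?t"
            using eps[OF 3(3)] less.prems by (intro acts_on_letters_mult) auto
          show "eps i j \<cdot> \<alpha> \<in> carrier SAut" using eps[OF 3(3)] less.prems by auto
          show "fst (?t (k, True)) = k" for k using less.prems(3)[of k] by (simp add: eps_letter_def)
          have "{k. ?t (k, True) = (k, False)} \<subset> S"
            using 3 by (auto simp: s eps_letter_def inv_letter_def split: if_splits)
          then show "card {k. ?t (k, True) = (k, False)} < card {k. s (k, True) = (k, False)}"
            unfolding S_def[symmetric] by (intro psubset_card_mono) auto
        qed
        then show ?thesis using cancel epsH[OF 3(3)] less.prems(1) by blast
      qed
    qed
  qed
  show ?thesis using \<alpha>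
  proof (induction "card {i. fst (s (i, True)) \<noteq> i}" arbitrary: \<alpha> s rule: less_induct)
    case less
    show ?case
    proof (cases "\<forall>i. fst (s (i, True)) = i")
      case True
      then show ?thesis using signs less.prems by blast
    next
      case False
      then obtain i where "fst (s (i, True)) \<noteq> i" by blast
      then obtain j where ij: "fst (s (i, True)) = j" "i \<noteq> j" by metis
      let ?t = "\<lambda>a. tau_letter i j (s a)"
      have "tau i j \<cdot> \<alpha> \<in> H"
      proof (rule less.hyps)
        show "acts_on_letters (tau i j \<cdot> \<alpha>) ?t"
          using tau[OF ij(2)] less.prems by (intro acts_on_letters_mult) auto
        show "tau i j \<cdot> \<alpha> \<in> carrier SAut" using tau[OF ij(2)] less.prems by auto
        define A B where "A = {k. fst (?t (k, True)) \<noteq> k}" and "B = {k. fst (s (k, True)) \<noteq> k}"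
        have "k \<in> B" if "k \<in> A" for k
          using that ij acts_on_letters_inj(2)[OF less.prems, of "(k, True)" "(i, True)"]
          by (auto simp: tau_letter_def A_def B_def split: if_splits)
        moreover have "i \<notin> A" "i \<in> B" using ij by (simp_all add: tau_letter_def A_def B_def)
        ultimately have "A \<subset> B" by blast
        then show "card {k. fst (?t (k, True)) \<noteq> k} < card {k. fst (s (k, True)) \<noteq> k}"
          unfolding A_def[symmetric] B_def[symmetric]
          by (intro psubset_card_mono) auto
      qed
      then show ?thesis using cancel tauH[OF ij(2)] less.prems(1) by blast
    qed
  qed
qed

section \<open>Nielsen's theorem\<close>

text \<open>The order \<open>nielsen_order\<close> is well founded, and an automorphism that no transvection decreases is
a signed permutation.\<close>

theorem SAut_generated_by_transvections:
  fixes H :: "('n::finite word \<Rightarrow> 'n word) set"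
  assumes H: "subgroup H SAut" and T: "\<And>b d. fst b \<noteq> fst d \<Longrightarrow> transvection b d \<in> H"
  shows "carrier SAut \<subseteq> H"
proof
  interpret group SAut by (rule group_SAut)
  have tauH: "tau i j \<in> H" if "i \<noteq> j" for i j
    unfolding tau_def using subgroup.m_closed[OF H] T that by auto
  have wf: "wf (nielsen_order :: (('n word \<Rightarrow> 'n word) \<times> _) set)" by (simp add: nielsen_order_def)
  fix \<alpha> :: "'n word \<Rightarrow> 'n word" assume "\<alpha> \<in> carrier SAut"
  then show "\<alpha> \<in> H"
  proof (induction \<alpha> rule: wf_induct_rule[OF wf])
    case (1 \<alpha>)
    show ?case
    proof (cases "\<exists>b d. fst b \<noteq> fst d \<and>
        (compose (carrier free_group) \<alpha> (transvection b d), \<alpha>) \<in> nielsen_order")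
      case True
      then obtain b d where bd: "fst b \<noteq> fst d"
        "(compose (carrier free_group) \<alpha> (transvection b d), \<alpha>) \<in> nielsen_order" by blast
      let ?T = "transvection b d"
      have TS: "?T \<in> carrier SAut" using transvection_in_SAut[OF bd(1)] .
      then have "\<alpha> \<cdot> ?T \<in> H" using 1 bd by (metis SAut_mult m_closed)
      then have "(\<alpha> \<cdot> ?T) \<cdot> inv\<^bsub>SAut\<^esub> ?T \<in> H"
        using H T[OF bd(1)] subgroup.m_closed subgroup.m_inv_closed by metis
      then show ?thesis using TS 1(2) by (simp add: m_assoc)
    next
      case False
      have "\<alpha> \<in> auto free_group" using 1(2) by (simp add: carrier_SAut)
      from not_nielsen_reducible_imp_letters[OF this] False obtain s where "\<forall>a. \<alpha> [a] = [s a]" by blast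
      then show ?thesis
        using signed_permutation_generated[OF H tauH 1(2)] unfolding acts_on_letters_def by blast
    qed
  qed
qed

section \<open>Relations between transvections and sign changes\<close>

lemma letters_neq:
  assumes "fst x \<noteq> fst y"
  shows "x \<noteq> y" "x \<noteq> inv_letter y" "inv_letter x \<noteq> y" "y \<noteq> x" "y \<noteq> inv_letter x" "inv_letter y \<noteq> x"
  using assms by auto

lemma transvection_inverse:
  fixes b d :: "'n::finite \<times> bool"
  assumes bd: "fst b \<noteq> fst d"
  shows "transvection b d \<cdot> transvection (inv_letter b) d = \<one>\<^bsub>SAut\<^esub>"
proof (rule SAut_eqI)
  interpret group "SAut :: ('n word \<Rightarrow> 'n word) monoid" by (rule group_SAut)
  have T: "transvection b d \<in> carrier SAut" "transvection (inv_letter b) d \<in> carrier SAut"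
    using bd by (auto intro!: transvection_in_SAut)
  then show "transvection b d \<cdot> transvection (inv_letter b) d \<in> carrier SAut"
    "\<one>\<^bsub>SAut\<^esub> \<in> carrier (SAut :: ('n word \<Rightarrow> 'n word) monoid)" by auto
  note [simp] = letters_neq[OF bd]
  fix i
  show "\<exists>a. fst a = i \<and> (transvection b d \<cdot> transvection (inv_letter b) d) [a] = \<one>\<^bsub>SAut\<^esub> [a]"
  proof (cases "i = fst d")
    case True
    then show ?thesis using T
      by (intro exI[of _ d]) (simp add: SAut_apply SAut_one carrier_free_group transvection_def
          letter_image_transvection reduced_Cons)
  next
    case False
    then have "(i, True) \<noteq> d" "(i, True) \<noteq> inv_letter d" by (metis fst_conv fst_inv_letter)+
    then show ?thesis using T
      by (intro exI[of _ "(i, True)"]) (simp add: SAut_apply SAut_one carrier_free_group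
          transvection_def letter_image_transvection)
  qed
qed

lemma transvection_commute:
  fixes b c d e :: "'n::finite \<times> bool"
  assumes ne: "fst c \<noteq> fst b" "fst e \<noteq> fst d" "fst b \<noteq> fst d" "fst c \<noteq> fst d" "fst e \<noteq> fst b"
  shows "transvection c b \<cdot> transvection e d = transvection e d \<cdot> transvection c b"
proof (rule SAut_eqI)
  interpret group "SAut :: ('n word \<Rightarrow> 'n word) monoid" by (rule group_SAut)
  have T: "transvection c b \<in> carrier SAut" "transvection e d \<in> carrier SAut"
    using ne by (auto intro!: transvection_in_SAut)
  then show "transvection c b \<cdot> transvection e d \<in> carrier SAut"
    "transvection e d \<cdot> transvection c b \<in> carrier SAut" by auto
  note [simp] = letters_neq[OF ne(1)] letters_neq[OF ne(2)] letters_neq[OF ne(3)]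
    letters_neq[OF ne(4)] letters_neq[OF ne(5)]
  fix i
  let ?goal = "\<lambda>a. (transvection c b \<cdot> transvection e d) [a] =
    (transvection e d \<cdot> transvection c b) [a]"
  have "?goal b" "?goal d"
    using T by (simp_all add: SAut_apply transvection_def letter_image_transvection reduced_Cons)
  moreover have "?goal (i, True)" if "i \<noteq> fst b" "i \<noteq> fst d"
  proof -
    have "(i, True) \<noteq> b" "(i, True) \<noteq> d" "(i, True) \<noteq> inv_letter b" "(i, True) \<noteq> inv_letter d"
      using that by (metis fst_conv fst_inv_letter)+
    then show ?thesis using T by (simp add: SAut_apply transvection_def letter_image_transvection)
  qed
  ultimately show "\<exists>a. fst a = i \<and> ?goal a" by (metis fst_conv)
qed

lemma transvection_commute_opposite:
  fixes b c d :: "'n::finite \<times> bool"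
  assumes ne: "fst b \<noteq> fst d" "fst c \<noteq> fst d"
  shows "transvection b d \<cdot> transvection c (inv_letter d) =
    transvection c (inv_letter d) \<cdot> transvection b d"
proof (rule SAut_eqI)
  interpret group "SAut :: ('n word \<Rightarrow> 'n word) monoid" by (rule group_SAut)
  have T: "transvection b d \<in> carrier SAut" "transvection c (inv_letter d) \<in> carrier SAut"
    using ne by (auto intro!: transvection_in_SAut)
  then show "transvection b d \<cdot> transvection c (inv_letter d) \<in> carrier SAut"
    "transvection c (inv_letter d) \<cdot> transvection b d \<in> carrier SAut" by auto
  note [simp] = letters_neq[OF ne(1)] letters_neq[OF ne(2)]
  fix i
  let ?goal = "\<lambda>a. (transvection b d \<cdot> transvection c (inv_letter d)) [a] =
    (transvection c (inv_letter d) \<cdot> transvection b d) [a]"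
  have "?goal d"
    using T by (simp add: SAut_apply transvection_def letter_image_transvection reduced_Cons)
  moreover have "?goal (i, True)" if "i \<noteq> fst d"
  proof -
    have "(i, True) \<noteq> d" "(i, True) \<noteq> inv_letter d"
      using that by (metis fst_conv fst_inv_letter)+
    then show ?thesis using T by (simp add: SAut_apply transvection_def letter_image_transvection)
  qed
  ultimately show "\<exists>a. fst a = i \<and> ?goal a" by (metis fst_conv)
qed

text \<open>This is the relation that makes \<open>SAut\<close> perfect; it lets one transvection in a kernel pull all
others into it.\<close>

lemma transvection_commutator:
  fixes b c d :: "'n::finite \<times> bool"
  assumes ne: "fst c \<noteq> fst b" "fst b \<noteq> fst d" "fst c \<noteq> fst d"
  shows "transvection c b \<cdot> transvection b d =
    transvection b d \<cdot> transvection c d \<cdot> transvection c b"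
proof (rule SAut_eqI)
  interpret group "SAut :: ('n word \<Rightarrow> 'n word) monoid" by (rule group_SAut)
  have T: "transvection c b \<in> carrier SAut" "transvection b d \<in> carrier SAut"
    "transvection c d \<in> carrier SAut"
    using ne by (auto intro!: transvection_in_SAut)
  then show "transvection c b \<cdot> transvection b d \<in> carrier SAut"
    "transvection b d \<cdot> transvection c d \<cdot> transvection c b \<in> carrier SAut"
    by auto
  note [simp] = letters_neq[OF ne(1)] letters_neq[OF ne(2)] letters_neq[OF ne(3)]
  fix i
  let ?goal = "\<lambda>a. (transvection c b \<cdot> transvection b d) [a] =
    (transvection b d \<cdot> transvection c d \<cdot> transvection c b) [a]"
  have "?goal b" "?goal d"
    using T by (simp_all add: SAut_apply transvection_def letter_image_transvection reduced_Cons)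
  moreover have "?goal (i, True)" if "i \<noteq> fst b" "i \<noteq> fst d"
  proof -
    have "(i, True) \<noteq> b" "(i, True) \<noteq> d" "(i, True) \<noteq> inv_letter b" "(i, True) \<noteq> inv_letter d"
      using that by (metis fst_conv fst_inv_letter)+
    then show ?thesis using T by (simp add: SAut_apply transvection_def letter_image_transvection)
  qed
  ultimately show "\<exists>a. fst a = i \<and> ?goal a" by (metis fst_conv)
qed

lemma mult_eqI_letters:
  fixes \<alpha> \<beta> :: "'n::finite word \<Rightarrow> 'n word"
  assumes "\<alpha> \<in> carrier SAut" "acts_on_letters \<alpha> s" "\<beta> \<in> carrier SAut" "acts_on_letters \<beta> t"
    and "\<gamma> \<in> carrier SAut" "acts_on_letters \<gamma> r" "\<And>a. s (t a) = r a"
  shows "\<alpha> \<cdot> \<beta> = \<gamma>"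
proof -
  interpret group "SAut :: ('n word \<Rightarrow> 'n word) monoid" by (rule group_SAut)
  show ?thesis
    by (rule acts_on_letters_eqI[OF _ acts_on_letters_mult[OF assms(1-4)] assms(5,6)])
      (use assms in auto)
qed

lemma eps_sym: "i \<noteq> j \<Longrightarrow> eps i j = eps j i"
  by (rule acts_on_letters_eqI[OF eps eps]) (auto simp: eps_letter_def)

lemma eps_square:
  fixes i j :: "'n::finite"
  assumes "i \<noteq> j"
  shows "eps i j \<cdot> eps i j = \<one>\<^bsub>SAut\<^esub>"
proof -
  interpret group "SAut :: ('n word \<Rightarrow> 'n word) monoid" by (rule group_SAut)
  show ?thesis
    by (rule mult_eqI_letters[OF eps[OF assms] eps[OF assms] one_closed acts_on_letters_one])
      (auto simp: eps_letter_def)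
qed

lemma eps_mult: "k \<noteq> i \<Longrightarrow> k \<noteq> j \<Longrightarrow> i \<noteq> j \<Longrightarrow> eps k i \<cdot> eps k j = eps i j"
  by (rule mult_eqI_letters[OF eps eps eps]) (auto simp: eps_letter_def)

lemma eps_commute:
  fixes i j k l :: "'n::finite"
  assumes "i \<noteq> j" "k \<noteq> l"
  shows "eps i j \<cdot> eps k l = eps k l \<cdot> eps i j"
proof -
  interpret group "SAut :: ('n word \<Rightarrow> 'n word) monoid" by (rule group_SAut)
  show ?thesis
    by (rule mult_eqI_letters[OF eps[OF assms(1)] eps[OF assms(2)] m_closed
          acts_on_letters_mult[OF eps[OF assms(2)] eps[OF assms(1)]]])
      (use eps assms in \<open>auto simp: eps_letter_def\<close>)
qed

definition swap :: "'n \<Rightarrow> 'n \<Rightarrow> 'n \<Rightarrow> 'n" where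
  "swap i j k = (if k = i then j else if k = j then i else k)"

lemma swap_swap [simp]: "swap i j (swap i j k) = k"
  by (auto simp: swap_def)

lemma swap_eq_iff: "swap i j k = swap i j l \<longleftrightarrow> k = l"
  by (metis swap_swap)

lemma eps_tau:
  fixes i j k l :: "'n::finite"
  assumes "i \<noteq> j" "k \<noteq> l"
  shows "eps k l \<cdot> tau i j = tau i j \<cdot> eps (swap i j k) (swap i j l)"
proof -
  interpret group "SAut :: ('n word \<Rightarrow> 'n word) monoid" by (rule group_SAut)
  have ne: "swap i j k \<noteq> swap i j l" using assms(2) by (simp add: swap_eq_iff)
  show ?thesis
    by (rule mult_eqI_letters[OF eps[OF assms(2)] tau[OF assms(1)] m_closed
          acts_on_letters_mult[OF tau[OF assms(1)] eps[OF ne]]])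
      (use eps[OF ne] tau[OF assms(1)] assms in
        \<open>auto simp: eps_letter_def tau_letter_def swap_def inv_letter_def\<close>)
qed

section \<open>Multiplicative maps on SAut\<close>

lemma exists_third:
  fixes i j :: "'n::finite"
  assumes "CARD('n) \<ge> 3"
  obtains k where "k \<noteq> i" "k \<noteq> j"
proof -
  have "card {i, j} < CARD('n)" using assms by (cases "i = j") auto
  then have "{i, j} \<noteq> UNIV" by auto
  then show ?thesis using that by auto
qed

text \<open>Both linear representations, with values in the matrices, and actions, with values in the maps of
the torus, are treated as multiplicative maps into a set with a binary operation. Whatever that
operation is, it has the needed group laws on the image, as they are inherited from \<open>SAut\<close>.\<close>

locale SAut_hom =
  fixes \<phi> :: "('n::finite word \<Rightarrow> 'n word) \<Rightarrow> 'h" and m :: "'h \<Rightarrow> 'h \<Rightarrow> 'h"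
  assumes mult: "\<alpha> \<in> carrier SAut \<Longrightarrow> \<beta> \<in> carrier SAut \<Longrightarrow> \<phi> (\<alpha> \<cdot> \<beta>) = m (\<phi> \<alpha>) (\<phi> \<beta>)"
    and three: "CARD('n) \<ge> 3"
begin

sublocale G: group "SAut :: ('n word \<Rightarrow> 'n word) monoid" by (rule group_SAut)

abbreviation unit :: 'h where "unit \<equiv> \<phi> \<one>\<^bsub>SAut\<^esub>"

lemma unit_mult [simp]:
  "\<alpha> \<in> carrier SAut \<Longrightarrow> m unit (\<phi> \<alpha>) = \<phi> \<alpha>" "\<alpha> \<in> carrier SAut \<Longrightarrow> m (\<phi> \<alpha>) unit = \<phi> \<alpha>"
  by (simp_all flip: mult)

lemma kernel_mult:
  assumes "\<alpha> \<in> carrier SAut" "\<beta> \<in> carrier SAut" "\<phi> \<beta> = unit"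
  shows "\<phi> (\<alpha> \<cdot> \<beta>) = \<phi> \<alpha>" "\<phi> (\<beta> \<cdot> \<alpha>) = \<phi> \<alpha>"
  using assms by (simp_all add: mult)

lemma kernel_inv:
  assumes "\<beta> \<in> carrier SAut" "\<phi> \<beta> = unit"
  shows "\<phi> (inv\<^bsub>SAut\<^esub> \<beta>) = unit"
  using kernel_mult(2)[of "inv\<^bsub>SAut\<^esub> \<beta>" \<beta>] assms by simp

lemma cancel_left:
  assumes "\<alpha> \<in> carrier SAut" "\<beta> \<in> carrier SAut" "\<gamma> \<in> carrier SAut"
    and "\<phi> (\<gamma> \<cdot> \<alpha>) = \<phi> (\<gamma> \<cdot> \<beta>)"
  shows "\<phi> \<alpha> = \<phi> \<beta>"
proof -
  have "\<phi> (inv\<^bsub>SAut\<^esub> \<gamma> \<cdot> (\<gamma> \<cdot> \<alpha>)) = \<phi> (inv\<^bsub>SAut\<^esub> \<gamma> \<cdot> (\<gamma> \<cdot> \<beta>))"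
    using assms by (simp add: mult)
  then show ?thesis using assms by (simp flip: G.m_assoc)
qed

lemma cancel_right:
  assumes "\<alpha> \<in> carrier SAut" "\<beta> \<in> carrier SAut" "\<gamma> \<in> carrier SAut"
    and "\<phi> (\<alpha> \<cdot> \<gamma>) = \<phi> (\<beta> \<cdot> \<gamma>)"
  shows "\<phi> \<alpha> = \<phi> \<beta>"
proof -
  have "\<phi> (\<alpha> \<cdot> \<gamma> \<cdot> inv\<^bsub>SAut\<^esub> \<gamma>) = \<phi> (\<beta> \<cdot> \<gamma> \<cdot> inv\<^bsub>SAut\<^esub> \<gamma>)"
    using assms by (simp add: mult)
  then show ?thesis using assms by (simp add: G.m_assoc)
qed

lemma kernel_all:
  assumes T: "\<And>b d. fst b \<noteq> fst d \<Longrightarrow> \<phi> (transvection b d) = unit" and \<alpha>: "\<alpha> \<in> carrier SAut"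
  shows "\<phi> \<alpha> = unit"
proof -
  let ?N = "{\<alpha> \<in> carrier SAut. \<phi> \<alpha> = unit}"
  have "subgroup ?N SAut"
    by (rule subgroup.intro) (auto simp: kernel_mult kernel_inv)
  then have "carrier SAut \<subseteq> ?N"
    by (rule SAut_generated_by_transvections) (auto simp: T transvection_in_SAut)
  then show ?thesis using \<alpha> by blast
qed

lemma kernel_transvection_step:
  assumes ne: "fst c \<noteq> fst b" "fst b \<noteq> fst d" "fst c \<noteq> fst d"
    and ker: "\<phi> (transvection b d) = unit \<or> \<phi> (transvection c b) = unit"
  shows "\<phi> (transvection c d) = unit"
proof -
  have T: "transvection c b \<in> carrier SAut" "transvection b d \<in> carrier SAut"
    "transvection c d \<in> carrier SAut"
    using ne by (auto intro!: transvection_in_SAut)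
  note R = arg_cong[OF transvection_commutator[OF ne], of \<phi>]
  from ker show ?thesis
  proof
    assume k: "\<phi> (transvection b d) = unit"
    then have "\<phi> (transvection c d \<cdot> transvection c b) =
        \<phi> (\<one>\<^bsub>SAut\<^esub> \<cdot> transvection c b)"
      using R T by (simp add: kernel_mult G.m_assoc)
    then show ?thesis by (rule cancel_right[rotated 3]) (use T in auto)
  next
    assume k: "\<phi> (transvection c b) = unit"
    then have "\<phi> (transvection b d \<cdot> transvection c d) =
        \<phi> (transvection b d \<cdot> \<one>\<^bsub>SAut\<^esub>)"
      using R T by (simp add: kernel_mult)
    then show ?thesis by (rule cancel_left[rotated 3]) (use T in auto)
  qed
qed

text \<open>By the commutator relation a transvection in the kernel may have either of its letters replaced,
as long as the letters involved belong to three different generators.\<close>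

lemma kernel_transvections:
  assumes bd: "fst b \<noteq> fst d" and ker: "\<phi> (transvection b d) = unit" and xy: "fst x \<noteq> fst y"
  shows "\<phi> (transvection x y) = unit"
proof -
  have first: "\<phi> (transvection c d) = unit"
    if bd: "fst b \<noteq> fst d" and ker: "\<phi> (transvection b d) = unit" and cd: "fst c \<noteq> fst d" for b c d
  proof (cases "fst c = fst b")
    case True
    obtain k where k: "k \<noteq> fst b" "k \<noteq> fst d" using exists_third[OF three] by metis
    have "\<phi> (transvection (k, True) d) = unit"
      using kernel_transvection_step[of "(k, True)" b d] k bd ker by simp
    then show ?thesis
      using kernel_transvection_step[of c "(k, True)" d] k cd True by simp
  next
    case False
    then show ?thesis using kernel_transvection_step[of c b d] bd cd ker by simp
  qed
  have second: "\<phi> (transvection b c) = unit"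
    if bd: "fst b \<noteq> fst d" and ker: "\<phi> (transvection b d) = unit" and cd: "fst c \<noteq> fst b" for b c d
  proof (cases "fst c = fst d")
    case True
    obtain k where k: "k \<noteq> fst b" "k \<noteq> fst d" using exists_third[OF three] by metis
    have "\<phi> (transvection b (k, True)) = unit"
      using kernel_transvection_step[of b d "(k, True)"] k bd ker by simp
    then show ?thesis
      using kernel_transvection_step[of b "(k, True)" c] k cd True by simp
  next
    case False
    then show ?thesis using kernel_transvection_step[of b d c] bd cd ker by simp
  qed
  show ?thesis
  proof (cases "fst x = fst d")
    case False
    show ?thesis using second[of x d y] first[OF bd ker, of x] False xy by simp
  next
    case True
    obtain k where k: "k \<noteq> fst x" "k \<noteq> fst y" using exists_third[OF three] by metis
    have "\<phi> (transvection (k, True) d) = unit" using first[OF bd ker, of "(k, True)"] k True by simp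
    then have "\<phi> (transvection (k, True) y) = unit"
      using second[of "(k, True)" d y] k True by simp
    then show ?thesis using first[of "(k, True)" y x] k xy by simp
  qed
qed

lemma conj_by_kernel:
  assumes \<sigma>: "\<sigma> \<in> carrier SAut" "acts_on_letters \<sigma> s" and bd: "fst b \<noteq> fst d" and "\<phi> \<sigma> = unit"
  shows "\<phi> (transvection (s b) (s d)) = \<phi> (transvection b d)"
proof -
  have "transvection b d \<in> carrier SAut" "transvection (s b) (s d) \<in> carrier SAut"
    using bd acts_on_letters_inj(2)[OF \<sigma>, of b d] by (auto intro!: transvection_in_SAut)
  then show ?thesis
    using arg_cong[OF acts_on_letters_conj[OF \<sigma> bd], of \<phi>] assms by (simp add: kernel_mult)
qed

text \<open>Conjugation by a sign change that involves only one of the two letters inverts that letter; the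
third generator provides the second index of the sign change.\<close>

lemma transvection_sign_independent:
  assumes ker: "\<And>i j. i \<noteq> j \<Longrightarrow> \<phi> (eps i j) = unit" and bd: "fst b \<noteq> fst d"
  shows "\<phi> (transvection (inv_letter b) d) = \<phi> (transvection b d)"
    "\<phi> (transvection b (inv_letter d)) = \<phi> (transvection b d)"
    "\<phi> (transvection b d \<cdot> transvection b d) = unit"
proof -
  obtain k where k: "k \<noteq> fst b" "k \<noteq> fst d" using exists_third[OF three] by metis
  have s: "eps_letter (fst b) k b = inv_letter b" "eps_letter (fst b) k d = d"
    "eps_letter (fst d) k b = b" "eps_letter (fst d) k d = inv_letter d"
    using bd k by (auto simp: eps_letter_def)
  show 1: "\<phi> (transvection (inv_letter b) d) = \<phi> (transvection b d)"
    using conj_by_kernel[OF eps[of "fst b" k] bd] ker[of "fst b" k] k s by simp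
  show "\<phi> (transvection b (inv_letter d)) = \<phi> (transvection b d)"
    using conj_by_kernel[OF eps[of "fst d" k] bd] ker[of "fst d" k] k s by simp
  have T: "transvection b d \<in> carrier SAut" "transvection (inv_letter b) d \<in> carrier SAut"
    using bd by (auto intro!: transvection_in_SAut)
  have "\<phi> (transvection b d \<cdot> transvection b d) =
      \<phi> (transvection b d \<cdot> transvection (inv_letter b) d)"
    using T 1 by (simp add: mult)
  then show "\<phi> (transvection b d \<cdot> transvection b d) = unit"
    using transvection_inverse[OF bd] by simp
qed

text \<open>In \<open>SAut\<close>, multiplying \<open>d\<close> from the left commutes with multiplying it from the right; here both
have the same image.\<close>

lemma transvection_images_commute:
  assumes ker: "\<And>i j. i \<noteq> j \<Longrightarrow> \<phi> (eps i j) = unit" and ne: "fst b \<noteq> fst d" "fst c \<noteq> fst d"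
  shows "\<phi> (transvection b d \<cdot> transvection c d) =
    \<phi> (transvection c d \<cdot> transvection b d)"
proof -
  have T: "transvection b d \<in> carrier SAut" "transvection c d \<in> carrier SAut"
    "transvection c (inv_letter d) \<in> carrier SAut"
    using ne by (auto intro!: transvection_in_SAut)
  show ?thesis
    using arg_cong[OF transvection_commute_opposite[OF ne], of \<phi>] T
    by (simp add: mult transvection_sign_independent(2)[OF ker ne(2)])
qed

end

section \<open>Common eigenvectors\<close>

text \<open>If \<open>u\<close> is a common eigenvector and \<open>M\<close> a further commuting involution, then \<open>u + M u\<close> is one for
\<open>M\<close> as well, unless it vanishes and \<open>u\<close> is already one. The last clause records that eigenvalues
of the initial vector survive, which is how a prescribed eigenvalue \<open>-1\<close> is carried along.\<close>

lemma joint_eigenvector: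
  fixes M :: "'i \<Rightarrow> real^'d^'d"
  assumes "finite I" and "\<And>k. k \<in> I \<Longrightarrow> M k ** M k = mat 1"
    and "\<And>j k. j \<in> I \<Longrightarrow> k \<in> I \<Longrightarrow> M j ** M k = M k ** M j" and "v \<noteq> 0"
  shows "\<exists>u. u \<noteq> 0 \<and> (\<forall>k\<in>I. M k *v u = u \<or> M k *v u = - u) \<and>
    (\<forall>P c. (\<forall>k\<in>I. P ** M k = M k ** P) \<longrightarrow> P *v v = c *\<^sub>R v \<longrightarrow> P *v u = c *\<^sub>R u)"
  using assms
proof (induction I)
  case empty
  then show ?case by auto
next
  case (insert k I)
  obtain u where u: "u \<noteq> 0" "\<And>j. j \<in> I \<Longrightarrow> M j *v u = u \<or> M j *v u = - u"
    and inh: "\<And>P c. (\<And>j. j \<in> I \<Longrightarrow> P ** M j = M j ** P) \<Longrightarrow> P *v v = c *\<^sub>R v \<Longrightarrow> P *v u = c *\<^sub>R u"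
    using insert.IH insert.prems by (metis (no_types, lifting) insertCI)
  define u' where "u' = (if u + M k *v u = 0 then u else u + M k *v u)"
  have transfer: "P *v u' = c *\<^sub>R u'" if "P ** M k = M k ** P" "P *v u = c *\<^sub>R u" for P c
  proof -
    have "P *v (M k *v u) = M k *v (P *v u)" using that(1) by (simp add: matrix_vector_mul_assoc)
    also have "\<dots> = c *\<^sub>R (M k *v u)" using that(2) by (simp add: matrix_vector_mult_scaleR)
    finally show ?thesis using that(2)
      by (simp add: u'_def matrix_vector_right_distrib scaleR_add_right)
  qed
  have Mk: "M k *v u' = u' \<or> M k *v u' = - u'"
  proof (cases "u + M k *v u = 0")
    case True
    then show ?thesis by (simp add: u'_def add_eq_0_iff)
  next
    case False
    have "M k *v (M k *v u) = u" using insert.prems(1)[of k] by (simp add: matrix_vector_mul_assoc)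
    then show ?thesis using False by (simp add: u'_def matrix_vector_right_distrib add.commute)
  qed
  have Mj: "M j *v u' = u' \<or> M j *v u' = - u'" if "j \<in> I" for j
    using transfer[of "M j" 1] transfer[of "M j" "- 1"] insert.prems(2)[of j k] u(2)[OF that] that
    by auto
  show ?case
  proof (intro exI[of _ u'] conjI ballI allI impI)
    show "u' \<noteq> 0" using u(1) by (simp add: u'_def)
    show "M j *v u' = u' \<or> M j *v u' = - u'" if "j \<in> insert k I" for j using that Mk Mj by auto
    show "P *v u' = c *\<^sub>R u'" if "\<forall>j\<in>insert k I. P ** M j = M j ** P" "P *v v = c *\<^sub>R v" for P c
      using that by (intro transfer inh) auto
  qed
qed

text \<open>The classical argument for a single operator, with an operator that may depend on the pair of
vectors to be separated: \<open>M - c a\<close> kills the vector at \<open>a\<close> and keeps the one at \<open>m\<close>.\<close>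

lemma separated_eigenvectors_coefficients_zero:
  fixes v :: "'i \<Rightarrow> real^'d"
  assumes "finite I" and "\<And>m. m \<in> I \<Longrightarrow> v m \<noteq> 0"
    and "\<And>m m'. m \<in> I \<Longrightarrow> m' \<in> I \<Longrightarrow> m \<noteq> m' \<Longrightarrow>
      \<exists>M c. (\<forall>k\<in>I. (M :: real^'d^'d) *v v k = c k *\<^sub>R v k) \<and> c m \<noteq> c m'"
    and "(\<Sum>k\<in>I. x k *\<^sub>R v k) = 0"
  shows "\<forall>k\<in>I. x k = 0"
  using assms
proof (induction I arbitrary: x)
  case (insert a I)
  have zero: "x m = 0" if m: "m \<in> I" for m
  proof -
    have "m \<noteq> a" using insert.hyps m by auto
    then obtain M :: "real^'d^'d" and c where M: "\<And>k. k \<in> insert a I \<Longrightarrow> M *v v k = c k *\<^sub>R v k"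
        "c m \<noteq> c a"
      using insert.prems(2)[of m a] m by blast
    have "0 = M *v (\<Sum>k\<in>insert a I. x k *\<^sub>R v k) - c a *\<^sub>R (\<Sum>k\<in>insert a I. x k *\<^sub>R v k)"
      using insert.prems(3) by simp
    also have "\<dots> = (\<Sum>k\<in>insert a I. (x k * (c k - c a)) *\<^sub>R v k)"
      by (simp only: linear_sum[OF matrix_vector_mul_linear] matrix_vector_mult_scaleR
          scaleR_sum_right sum_subtractf[symmetric])
        (rule sum.cong, auto simp: M(1) algebra_simps)
    also have "\<dots> = (\<Sum>k\<in>I. (x k * (c k - c a)) *\<^sub>R v k)" using insert.hyps by simp
    finally have "(\<Sum>k\<in>I. (x k * (c k - c a)) *\<^sub>R v k) = 0" by simp
    then have "\<forall>k\<in>I. x k * (c k - c a) = 0"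
    proof (rule insert.IH[rotated 2])
      show "v m \<noteq> 0" if "m \<in> I" for m using insert.prems(1) that by blast
      show "\<exists>M c. (\<forall>k\<in>I. (M :: real^'d^'d) *v v k = c k *\<^sub>R v k) \<and> c m \<noteq> c m'"
        if "m \<in> I" "m' \<in> I" "m \<noteq> m'" for m m'
        using insert.prems(2)[of m m'] that by blast
    qed
    then show ?thesis using m M(2) by auto
  qed
  then have "x a *\<^sub>R v a = 0" using insert.prems(3) insert.hyps by simp
  then have "x a = 0" using insert.prems(1)[of a] by simp
  with zero show ?case by blast
qed simp

lemma separated_eigenvectors_independent:
  fixes v :: "'i \<Rightarrow> real^'d"
  assumes "finite I" and ne: "\<And>m. m \<in> I \<Longrightarrow> v m \<noteq> 0"
    and sep: "\<And>m m'. m \<in> I \<Longrightarrow> m' \<in> I \<Longrightarrow> m \<noteq> m' \<Longrightarrow>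
      \<exists>M c. (\<forall>k\<in>I. (M :: real^'d^'d) *v v k = c k *\<^sub>R v k) \<and> c m \<noteq> c m'"
  shows "inj_on v I" "independent (v ` I)" "card I \<le> CARD('d)"
proof -
  note zero = separated_eigenvectors_coefficients_zero[OF \<open>finite I\<close> ne sep]
  show inj: "inj_on v I"
  proof (rule inj_onI, rule ccontr)
    fix a b assume ab: "a \<in> I" "b \<in> I" "v a = v b" "a \<noteq> b"
    then obtain M :: "real^'d^'d" and c where "\<forall>k\<in>I. M *v v k = c k *\<^sub>R v k" "c a \<noteq> c b"
      using sep by blast
    then have "c a *\<^sub>R v a = c b *\<^sub>R v a" using ab by metis
    then show False using ne ab(1) \<open>c a \<noteq> c b\<close> by simp
  qed
  show ind: "independent (v ` I)"
  proof
    assume "dependent (v ` I)"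
    then obtain u where u: "\<exists>w\<in>v ` I. u w \<noteq> 0" "(\<Sum>w\<in>v ` I. u w *\<^sub>R w) = 0"
      using dependent_finite[of "v ` I"] \<open>finite I\<close> by auto
    have "(\<Sum>k\<in>I. u (v k) *\<^sub>R v k) = 0" using u(2) inj by (simp add: sum.reindex)
    then show False using zero[of "\<lambda>k. u (v k)"] u(1) by auto
  qed
  show "card I \<le> CARD('d)"
    using independent_bound[OF ind] card_image[OF inj] by simp
qed

lemma matrix_eq_on_spanning:
  fixes M N :: "real^'d^'d"
  assumes "\<And>x. x \<in> S \<Longrightarrow> M *v x = N *v x" "span S = UNIV"
  shows "M = N"
proof -
  have "M *v x = N *v x" for x
    using linear_eq_on_span[of "(*v) M" "(*v) N" S x] assms by auto
  then show ?thesis by (simp add: matrix_eq)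
qed

section \<open>Real representations of dimension less than n\<close>

locale SAut_rep = SAut_hom \<phi> "(**)"
  for \<phi> :: "('n::finite word \<Rightarrow> 'n word) \<Rightarrow> real^'d^'d" +
  assumes one: "\<phi> \<one>\<^bsub>SAut\<^esub> = mat 1" and dim: "CARD('d) < CARD('n)"
begin

lemma apply_mult:
  assumes "\<alpha> \<in> carrier SAut" "\<beta> \<in> carrier SAut"
  shows "\<phi> (\<alpha> \<cdot> \<beta>) *v x = \<phi> \<alpha> *v (\<phi> \<beta> *v x)"
  using assms by (simp add: mult matrix_vector_mul_assoc)

lemma apply_neq_0:
  assumes "\<alpha> \<in> carrier SAut" "x \<noteq> 0"
  shows "\<phi> \<alpha> *v x \<noteq> 0"
proof
  assume "\<phi> \<alpha> *v x = 0"
  then have "\<phi> (inv\<^bsub>SAut\<^esub> \<alpha> \<cdot> \<alpha>) *v x = 0"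
    using apply_mult[of "inv\<^bsub>SAut\<^esub> \<alpha>" \<alpha> x] assms(1) by simp
  then show False using assms one G.l_inv[OF assms(1)] by simp
qed

text \<open>Common eigenvectors that are told apart by the operators are independent, so there are at most
\<open>d < n\<close> of them. Every nontrivial pattern of eigenvalues below is refuted by exhibiting \<open>n\<close> translates
of it.\<close>

lemma no_separated_family:
  fixes w :: "'n \<Rightarrow> real^'d"
  assumes "\<And>m. w m \<noteq> 0"
    and "\<And>m m'. m \<noteq> m' \<Longrightarrow> \<exists>M c. (\<forall>k. (M :: real^'d^'d) *v w k = c k *\<^sub>R w k) \<and> c m \<noteq> c m'"
  shows False
  using separated_eigenvectors_independent(3)[of UNIV w] assms dim by auto

text \<open>Common eigenvalues of the \<open>eps i j\<close> come from a sign for each index, well defined up to a global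
change of sign; it is normalized to \<open>1\<close> at \<open>k\<close>.\<close>

lemma signed_eigenvector:
  assumes kl: "k \<noteq> l" "\<phi> (eps k l) \<noteq> mat 1"
  obtains u s where "u \<noteq> 0" "\<And>i. s i = 1 \<or> s i = (- 1 :: real)"
    "\<And>i j. i \<noteq> j \<Longrightarrow> \<phi> (eps i j) *v u = (s i * s j) *\<^sub>R u" "s k \<noteq> s l"
proof -
  obtain v0 where v0: "\<phi> (eps k l) *v v0 \<noteq> v0"
    using kl(2) matrix_eq[of "\<phi> (eps k l)" "mat 1"] by auto
  have sq: "\<phi> (eps i j) ** \<phi> (eps i j) = mat 1" if "i \<noteq> j" for i j
    using eps_square[OF that] eps(1)[OF that] by (simp add: one flip: mult)
  have comm: "\<phi> (eps i j) ** \<phi> (eps a b) = \<phi> (eps a b) ** \<phi> (eps i j)" if "i \<noteq> j" "a \<noteq> b" for i j a b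
    using eps_commute[OF that] eps(1)[OF that(1)] eps(1)[OF that(2)] by (simp flip: mult)
  define v where "v = v0 - \<phi> (eps k l) *v v0"
  have v: "v \<noteq> 0" "\<phi> (eps k l) *v v = (- 1) *\<^sub>R v"
    using v0 sq[OF kl(1)] by (auto simp: v_def matrix_vector_mult_diff_distrib matrix_vector_mul_assoc)
  let ?M = "\<lambda>p. \<phi> (eps (fst p) (snd p))"
  let ?I = "{p :: 'n \<times> 'n. fst p \<noteq> snd p}"
  obtain u where u: "u \<noteq> 0" "\<And>p. p \<in> ?I \<Longrightarrow> ?M p *v u = u \<or> ?M p *v u = - u"
    "\<And>P c. (\<And>p. p \<in> ?I \<Longrightarrow> P ** ?M p = ?M p ** P) \<Longrightarrow> P *v v = c *\<^sub>R v \<Longrightarrow> P *v u = c *\<^sub>R u"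
  proof -
    have "\<exists>u. u \<noteq> 0 \<and> (\<forall>p\<in>?I. ?M p *v u = u \<or> ?M p *v u = - u) \<and>
      (\<forall>P c. (\<forall>p\<in>?I. P ** ?M p = ?M p ** P) \<longrightarrow> P *v v = c *\<^sub>R v \<longrightarrow> P *v u = c *\<^sub>R u)"
      by (rule joint_eigenvector) (use sq comm v(1) in auto)
    then show ?thesis using that by auto
  qed
  have eig: "\<phi> (eps i j) *v u = u \<or> \<phi> (eps i j) *v u = - u" if "i \<noteq> j" for i j
    using u(2)[of "(i, j)"] that by simp
  define s where "s = (\<lambda>i. if i = k \<or> \<phi> (eps k i) *v u = u then 1 else - 1 :: real)"
  have s: "s i = 1 \<or> s i = - 1" for i by (simp add: s_def)
  have sk: "\<phi> (eps k i) *v u = s i *\<^sub>R u" if "i \<noteq> k" for i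
    using eig[of k i] that by (auto simp: s_def)
  have "\<phi> (eps i j) *v u = (s i * s j) *\<^sub>R u" if ij: "i \<noteq> j" for i j
  proof (cases "i = k \<or> j = k")
    case True
    then show ?thesis using sk[of i] sk[of j] ij eps_sym[of i k] by (auto simp: s_def)
  next
    case False
    then have "\<phi> (eps i j) *v u = \<phi> (eps k i) *v (\<phi> (eps k j) *v u)"
      using eps_mult[of k i j] ij eps(1)[of k i] eps(1)[of k j] apply_mult by metis
    then show ?thesis using sk[of i] sk[of j] False by (simp add: matrix_vector_mult_scaleR)
  qed
  note eigs = this
  have "\<phi> (eps k l) *v u = (- 1) *\<^sub>R u"
    using v(2) by (rule u(3)[rotated]) (use comm kl in auto)
  then have "s l *\<^sub>R u = (- 1) *\<^sub>R u" using sk[of l] kl(1) by metis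
  then have "s l = - 1" using u(1) by (simp only: scaleR_cancel_right) simp
  moreover have "s k = 1" by (simp add: s_def)
  ultimately have "s k \<noteq> s l" by simp
  with that[OF u(1) s eigs] show ?thesis by blast
qed

lemma eigenvector_tau:
  assumes ij: "i \<noteq> j" and u: "\<And>k l. k \<noteq> l \<Longrightarrow> \<phi> (eps k l) *v u = (s k * s l) *\<^sub>R u" and kl: "k \<noteq> l"
  shows "\<phi> (eps k l) *v (\<phi> (tau i j) *v u) = (s (swap i j k) * s (swap i j l)) *\<^sub>R (\<phi> (tau i j) *v u)"
proof -
  have ne: "swap i j k \<noteq> swap i j l" using kl by (simp add: swap_eq_iff)
  have "\<phi> (eps k l) *v (\<phi> (tau i j) *v u) = \<phi> (tau i j) *v (\<phi> (eps (swap i j k) (swap i j l)) *v u)"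
    using eps_tau[OF ij kl] tau(1)[OF ij] eps(1)[OF kl] eps(1)[OF ne] apply_mult by metis
  then show ?thesis using u[OF ne] by (simp add: matrix_vector_mult_scaleR)
qed

text \<open>The transvections onto the fixed generator \<open>e\<close> become commuting involutions, and conjugation by
\<open>X c b\<close> multiplies the eigenvalue of \<open>X b e\<close> by that of \<open>X c e\<close>. Starting from one nontrivial
pattern \<open>\<eta>\<close> this produces \<open>\<eta>\<close> and the patterns that differ from \<open>\<eta>\<close> in exactly one of the
\<open>n - 1\<close> places, which are \<open>n\<close> in all.\<close>

lemma transvections_trivial_if_eps_trivial:
  assumes ker: "\<And>i j. i \<noteq> j \<Longrightarrow> \<phi> (eps i j) = mat 1" and bd: "fst b \<noteq> fst d"
  shows "\<phi> (transvection b d) = mat 1"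
proof (rule ccontr)
  assume nontriv: "\<phi> (transvection b d) \<noteq> mat 1"
  define e where "e = fst d"
  define X where "X = (\<lambda>i j. \<phi> (transvection (i, True) (j, True)))"
  note ker' = ker[folded one]
  have TX: "\<phi> (transvection x y) = X (fst x) (fst y)" if "fst x \<noteq> fst y" for x y
  proof -
    have "\<phi> (transvection x y) = \<phi> (transvection (fst x, True) y)"
      using transvection_sign_independent(1)[OF ker' that] that
      by (cases x; cases "snd x") (auto simp: inv_letter_def)
    also have "\<dots> = X (fst x) (fst y)"
      using transvection_sign_independent(2)[OF ker', of "(fst x, True)" y] that
      by (cases y; cases "snd y") (auto simp: inv_letter_def X_def)
    finally show ?thesis .
  qed
  have T: "transvection (i, True) (j, True) \<in> carrier SAut" if "i \<noteq> j" for i j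
    using that by (auto intro!: transvection_in_SAut)
  have sq: "X i j ** X i j = mat 1" if "i \<noteq> j" for i j
    using transvection_sign_independent(3)[OF ker', of "(i, True)" "(j, True)"] that
      mult[OF T[OF that] T[OF that]] by (simp add: X_def one)
  have comm: "X i j ** X k j = X k j ** X i j" if "i \<noteq> j" "k \<noteq> j" for i j k
    using transvection_images_commute[OF ker', of "(i, True)" "(j, True)" "(k, True)"]
      that mult[OF T[OF that(1)] T[OF that(2)]] mult[OF T[OF that(2)] T[OF that(1)]]
    by (simp add: X_def)
  have comm': "X c b ** X f a = X f a ** X c b"
    if "c \<noteq> b" "f \<noteq> a" "b \<noteq> a" "c \<noteq> a" "f \<noteq> b" for a b c f
    using arg_cong[OF transvection_commute[of "(c, True)" "(b, True)" "(f, True)" "(a, True)"], of \<phi>]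
      that mult[OF T[OF that(1)] T[OF that(2)]] mult[OF T[OF that(2)] T[OF that(1)]]
    by (simp add: X_def)
  have R: "X c b ** X b a = X b a ** X c a ** X c b" if "c \<noteq> b" "b \<noteq> a" "c \<noteq> a" for a b c
    using arg_cong[OF transvection_commutator[of "(c, True)" "(b, True)" "(a, True)"], of \<phi>]
      that mult[OF T[OF that(1)] T[OF that(2)]] mult[OF T[OF that(2)] T[OF that(3)]]
      mult[OF G.m_closed[OF T[OF that(2)] T[OF that(3)]] T[OF that(1)]]
    by (simp add: X_def)
  \<comment> \<open>If the value at \<open>c\<close> is \<open>-1\<close>, then \<open>X c b\<close> flips the value at \<open>b\<close> and keeps all others.\<close>
  have flip: "X f e *v (X c b *v u) = (\<eta> f * (if f = b then - 1 else 1)) *\<^sub>R (X c b *v u)"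
    if u: "\<And>f. f \<noteq> e \<Longrightarrow> X f e *v u = \<eta> f *\<^sub>R u" and c: "\<eta> c = - 1"
      and ne: "c \<noteq> b" "c \<noteq> e" "b \<noteq> e" "f \<noteq> e" for \<eta> :: "'n \<Rightarrow> real" and u b c f
  proof (cases "f = b")
    case True
    have "X b e ** X c b = X c b ** (X c b ** X b e) ** X c b"
      using sq[OF ne(1)] by (simp add: matrix_mul_assoc)
    also have "\<dots> = X c b ** X b e ** X c e ** (X c b ** X c b)"
      using R[OF ne(1,3,2)] by (simp add: matrix_mul_assoc)
    finally have "X b e ** X c b = X c b ** X b e ** X c e" using sq[OF ne(1)] by simp
    then have "X b e *v (X c b *v u) = X c b *v (X b e *v (X c e *v u))"
      by (simp add: matrix_vector_mul_assoc matrix_mul_assoc)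
    also have "\<dots> = (\<eta> b * - 1) *\<^sub>R (X c b *v u)"
      unfolding u[OF ne(2)] c matrix_vector_mult_scaleR u[OF ne(3)] by simp
    finally show ?thesis using True by simp
  next
    case False
    then have "X f e *v (X c b *v u) = X c b *v (X f e *v u)"
      using comm'[of c b f e] ne by (simp add: matrix_vector_mul_assoc)
    then show ?thesis using False u ne by (simp add: matrix_vector_mult_scaleR)
  qed
  have Xne: "X c b *v u \<noteq> 0" if "c \<noteq> b" "u \<noteq> 0" for c b u
    using apply_neq_0[OF T[OF that(1)] that(2)] by (simp add: X_def)
  define b0 where "b0 = fst b"
  have b0: "b0 \<noteq> e" using bd by (simp add: b0_def e_def)
  have "X b0 e \<noteq> mat 1" using TX[OF bd] nontriv by (simp add: b0_def e_def)
  then obtain v0 where v0: "X b0 e *v v0 \<noteq> v0" using matrix_eq[of "X b0 e" "mat 1"] by auto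
  define v where "v = v0 - X b0 e *v v0"
  have v: "v \<noteq> 0" "X b0 e *v v = (- 1) *\<^sub>R v"
    using v0 sq[OF b0] by (auto simp: v_def matrix_vector_mult_diff_distrib matrix_vector_mul_assoc)
  have "\<exists>u. u \<noteq> 0 \<and> (\<forall>f\<in>- {e}. X f e *v u = u \<or> X f e *v u = - u) \<and>
      (\<forall>P c. (\<forall>f\<in>- {e}. P ** X f e = X f e ** P) \<longrightarrow> P *v v = c *\<^sub>R v \<longrightarrow> P *v u = c *\<^sub>R u)"
    by (rule joint_eigenvector) (use sq comm v(1) in auto)
  then obtain u0 where u0: "u0 \<noteq> 0" "\<And>f. f \<noteq> e \<Longrightarrow> X f e *v u0 = u0 \<or> X f e *v u0 = - u0"
    "X b0 e *v u0 = (- 1) *\<^sub>R u0"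
    using v(2) comm b0 by (metis ComplI singletonD ComplD singletonI)
  define \<eta>0 where "\<eta>0 = (\<lambda>f. if X f e *v u0 = u0 then 1 else - 1 :: real)"
  have e0: "X f e *v u0 = \<eta>0 f *\<^sub>R u0" if "f \<noteq> e" for f using u0(2)[OF that] by (auto simp: \<eta>0_def)
  have "\<eta>0 b0 *\<^sub>R u0 = (- 1) *\<^sub>R u0" using e0[OF b0] u0(3) by metis
  then have c0: "\<eta>0 b0 = - 1" using u0(1) by (simp only: scaleR_cancel_right) simp
  \<comment> \<open>The value at \<open>b0\<close> itself is flipped with the help of a second place \<open>b1\<close> of value \<open>-1\<close>.\<close>
  obtain b1 where b1: "b1 \<noteq> b0" "b1 \<noteq> e" using exists_third[OF three] by metis
  obtain u \<eta> where u: "u \<noteq> 0" "\<And>f. f \<noteq> e \<Longrightarrow> X f e *v u = \<eta> f *\<^sub>R u"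
    and c: "\<eta> b0 = - 1" "\<eta> b1 = - 1" and cn: "\<And>f. \<eta> f \<noteq> (0::real)"
  proof (cases "\<eta>0 b1 = - 1")
    case True
    show ?thesis by (rule that[OF u0(1) e0 c0 True]) (auto simp: \<eta>0_def)
  next
    case False
    then have "\<eta>0 b1 = 1" by (simp add: \<eta>0_def split: if_splits)
    show ?thesis
    proof (rule that[of "X b0 b1 *v u0" "\<lambda>f. \<eta>0 f * (if f = b1 then - 1 else 1)"])
      show "X b0 b1 *v u0 \<noteq> 0" using Xne b1 u0(1) by simp
      show "X f e *v (X b0 b1 *v u0) = (\<eta>0 f * (if f = b1 then - 1 else 1)) *\<^sub>R (X b0 b1 *v u0)"
        if "f \<noteq> e" for f
        using flip[OF e0 c0, of b1 f] b1 b0 that by auto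
    qed (use c0 b1 \<open>\<eta>0 b1 = 1\<close> in \<open>auto simp: \<eta>0_def\<close>)
  qed
  define w where "w = (\<lambda>m. if m = e then u else X (if m = b0 then b1 else b0) m *v u)"
  define \<kappa> where "\<kappa> = (\<lambda>m f. \<eta> f * (if f = m then - 1 else 1))"
  have w: "X f e *v w m = \<kappa> m f *\<^sub>R w m" if "f \<noteq> e" for f m
  proof (cases "m = e")
    case True
    then show ?thesis using u(2) that by (simp add: w_def \<kappa>_def)
  next
    case False
    then show ?thesis using flip[OF u(2), of "if m = b0 then b1 else b0" m f] c b1 b0 that
      by (auto simp: w_def \<kappa>_def)
  qed
  show False
  proof (rule no_separated_family)
    show "w m \<noteq> 0" for m using u(1) Xne b1 b0 by (simp add: w_def)
    fix m m' :: 'n assume "m \<noteq> m'"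
    then obtain f where f: "f \<noteq> e" "(f = m) \<noteq> (f = m')" by metis
    then have "\<kappa> m f \<noteq> \<kappa> m' f" using cn[of f] by (auto simp: \<kappa>_def)
    then show "\<exists>M c. (\<forall>k. M *v w k = c k *\<^sub>R w k) \<and> c m \<noteq> c m'"
      using w[OF f(1)] by (intro exI[of _ "X f e"] exI[of _ "\<lambda>k. \<kappa> k f"]) auto
  qed
qed

text \<open>The exceptional case: four generators and a sign pattern that splits them into two pairs. The
orbit of the pattern consists of the three splittings only, so the eigenvectors span a
three-dimensional space. Modulo the inversion of all generators, which acts trivially, the double
signed transposition \<open>w\<close> commutes with all sign changes, so it is diagonal in this basis with
entries \<open>\<plusminus>1\<close>, and every such diagonal matrix is a sign change up to a scalar. Conjugation by \<open>w\<close>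
carries the transvection with letters \<open>a\<close>, \<open>c\<close> to the one with letters \<open>b\<close>, \<open>e\<close>; conjugation by a sign
change only alters signs. So the latter transvection has the same image as one with letters \<open>a\<close>, \<open>c\<close>
up to sign. But that one commutes with the transvection with letters \<open>a\<close>, \<open>b\<close>, and the former does
not: their commutator has letters \<open>a\<close>, \<open>e\<close> and lies in the kernel.\<close>

lemma balanced_signs_trivial:
  assumes abce: "distinct [a, b, c, e]" "UNIV = {a, b, c, e}"
    and u: "u \<noteq> 0" "\<And>i. s i = 1 \<or> s i = (- 1 :: real)"
      "\<And>i j. i \<noteq> j \<Longrightarrow> \<phi> (eps i j) *v u = (s i * s j) *\<^sub>R u"
    and s: "s a = s b" "s c = s e" "s a \<noteq> s c"
  shows "\<alpha> \<in> carrier SAut \<Longrightarrow> \<phi> \<alpha> = mat 1"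
proof -
  have ne [simp]: "a \<noteq> b" "a \<noteq> c" "a \<noteq> e" "b \<noteq> c" "b \<noteq> e" "c \<noteq> e"
    "b \<noteq> a" "c \<noteq> a" "e \<noteq> a" "c \<noteq> b" "e \<noteq> b" "e \<noteq> c"
    using abce(1) by auto
  have ss: "s i * s j = (if s i = s j then 1 else - 1)" for i j using u(2)[of i] u(2)[of j] by auto
  \<comment> \<open>The vector \<open>v p\<close> has the sign pattern that splits the indices into \<open>{a, p}\<close> and the rest.\<close>
  define v where "v = (\<lambda>p. if p = b then u else \<phi> (tau b p) *v u)"
  let ?I = "{b, c, e}"
  have vs: "\<phi> (eps i j) *v v p = (s (swap b p i) * s (swap b p j)) *\<^sub>R v p" if "i \<noteq> j" for i j p
  proof (cases "p = b")
    case True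
    then show ?thesis using u(3)[OF that] by (simp add: v_def swap_def)
  next
    case False
    then show ?thesis using eigenvector_tau[OF _ u(3) that, of b p] by (simp add: v_def)
  qed
  have vne: "v p \<noteq> 0" for p using u(1) apply_neq_0 tau(1)[of b p] by (auto simp: v_def)
  have s': "s e = s c" "s b = s a" "s c \<noteq> s a" using s by auto
  have pairs: "s (swap b p i) = s (swap b p j) \<longleftrightarrow> (i \<in> {a, p} \<longleftrightarrow> j \<in> {a, p})" if "p \<in> ?I" for p i j
  proof -
    have "s (swap b p i) = (if i \<in> {a, p} then s a else s c)" for i
    proof -
      have "i \<in> {a, b, c, e}" using abce(2) by blast
      then show ?thesis using that s' by (auto simp: swap_def)
    qed
    then show ?thesis using s' by simp
  qed
  have vE: "\<phi> (eps i j) *v v p = (if i \<in> {a, p} \<longleftrightarrow> j \<in> {a, p} then 1 else - 1) *\<^sub>R v p"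
    if "i \<noteq> j" "p \<in> ?I" for i j p
    unfolding vs[OF that(1)] ss pairs[OF that(2)] ..
  have Ev: "\<phi> (eps a p) *v v r = (if p = r then 1 else - 1) *\<^sub>R v r" if "p \<in> ?I" "r \<in> ?I" for p r
  proof -
    have "a \<noteq> p" "a \<noteq> r" using that by auto
    then show ?thesis using vE[of a p r] that(2) by simp
  qed
  have sep: "\<exists>M c. (\<forall>k\<in>?I. M *v v k = c k *\<^sub>R v k) \<and> c m \<noteq> c m'"
    if "m \<in> ?I" "m' \<in> ?I" "m \<noteq> m'" for m m'
    using Ev[OF that(1)] that by (intro exI[of _ "\<phi> (eps a m)"] exI[of _ "\<lambda>r. if m = r then 1 else - 1"]) auto
  have fin: "finite ?I" by simp
  note ind = separated_eigenvectors_independent[OF fin vne sep]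
  have I3: "card ?I = 3" by simp
  have "CARD('n) = 4" using arg_cong[OF abce(2), of card] by simp
  then have "CARD('d) = 3" using dim ind(3) I3 by linarith
  moreover have "card (v ` ?I) = 3" using card_image[OF ind(1)] I3 by simp
  ultimately have sp: "span (v ` ?I) = UNIV"
    using card_ge_dim_independent[of "v ` ?I" UNIV] ind(2) by auto
  have eqI: "M = N" if "\<And>p. p \<in> ?I \<Longrightarrow> M *v v p = N *v v p" for M N :: "real^'d^'d"
    using matrix_eq_on_spanning[OF _ sp, of M N] that by auto
  have line: "\<exists>x. y = x *\<^sub>R v p" if p: "p \<in> ?I" and y: "\<phi> (eps a p) *v y = y" for p y
  proof -
    have "y \<in> span (v ` ?I)" using sp by simp
    then obtain x where x: "y = (\<Sum>w\<in>v ` ?I. x w *\<^sub>R w)" by (subst (asm) span_finite) auto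
    then have "y = (\<Sum>r\<in>?I. x (v r) *\<^sub>R v r)" using ind(1) by (subst (asm) sum.reindex) auto
    then have y': "y = x (v b) *\<^sub>R v b + x (v c) *\<^sub>R v c + x (v e) *\<^sub>R v e"
      by (simp add: algebra_simps)
    have "2 *\<^sub>R y = y + \<phi> (eps a p) *v y" using y by (simp add: scaleR_2)
    also have "\<phi> (eps a p) *v y = x (v b) *\<^sub>R (\<phi> (eps a p) *v v b) +
        x (v c) *\<^sub>R (\<phi> (eps a p) *v v c) + x (v e) *\<^sub>R (\<phi> (eps a p) *v v e)"
      unfolding y' by (simp only: matrix_vector_right_distrib matrix_vector_mult_scaleR)
    also have "y + \<dots> = 2 *\<^sub>R (x (v p) *\<^sub>R v p)"
      using p Ev[OF p, of b] Ev[OF p, of c] Ev[OF p, of e] y'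
      by (auto simp: scaleR_2) (simp_all add: vec_eq_iff)
    finally have "y = x (v p) *\<^sub>R v p" by (simp only: scaleR_cancel_left) simp
    then show ?thesis by blast
  qed
  have full: "\<phi> (eps b e) = \<phi> (eps a c)" "\<phi> (eps b c) = \<phi> (eps a e)"
    by (rule eqI, use vE in auto)+
  define w where "w = tau a b \<cdot> tau c e"
  have tC: "tau a b \<in> carrier SAut" "tau c e \<in> carrier SAut" by (simp_all add: tau)
  then have wC: "w \<in> carrier SAut" by (simp add: w_def)
  have wlet: "acts_on_letters w (\<lambda>x. tau_letter a b (tau_letter c e x))"
    unfolding w_def by (rule acts_on_letters_mult) (simp_all add: tau)
  have comm: "eps i j \<cdot> w =
      w \<cdot> eps (swap c e (swap a b i)) (swap c e (swap a b j))" if ij: "i \<noteq> j" for i j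
  proof -
    have ne': "swap a b i \<noteq> swap a b j" "swap c e (swap a b i) \<noteq> swap c e (swap a b j)"
      using ij by (simp_all add: swap_eq_iff)
    have "eps i j \<cdot> w = eps i j \<cdot> tau a b \<cdot> tau c e"
      using tC eps(1)[OF ij] by (simp add: w_def G.m_assoc)
    also have "\<dots> = tau a b \<cdot> (eps (swap a b i) (swap a b j) \<cdot> tau c e)"
      using tC eps(1)[OF ne'(1)] by (simp add: eps_tau ij G.m_assoc)
    also have "\<dots> = w \<cdot> eps (swap c e (swap a b i)) (swap c e (swap a b j))"
      using tC eps(1)[OF ne'(2)] by (simp add: w_def eps_tau ne'(1) G.m_assoc)
    finally show ?thesis .
  qed
  have wE: "\<phi> (eps a p) *v (\<phi> w *v x) = \<phi> w *v (\<phi> (eps a p) *v x)" if "p \<in> ?I" for p x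
  proof -
    let ?p = "\<lambda>i. swap c e (swap a b i)"
    have ne': "a \<noteq> p" "?p a \<noteq> ?p p" using that by (auto simp: swap_eq_iff)
    have "\<phi> (eps (?p a) (?p p)) = \<phi> (eps a p)"
      using that full by (auto simp: swap_def eps_sym[of b a])
    moreover have "\<phi> (eps a p \<cdot> w) *v x = \<phi> (w \<cdot> eps (?p a) (?p p)) *v x"
      using comm[OF ne'(1)] by simp
    ultimately show ?thesis using eps(1)[OF ne'(1)] eps(1)[OF ne'(2)] wC by (simp add: apply_mult)
  qed
  have "\<exists>x. \<phi> w *v v p = x *\<^sub>R v p" if p: "p \<in> ?I" for p
    using wE[OF p, of "v p"] Ev[OF p p] by (intro line[OF p]) simp
  then obtain \<mu> where \<mu>: "\<And>p. p \<in> ?I \<Longrightarrow> \<phi> w *v v p = \<mu> p *\<^sub>R v p" by metis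
  have ww: "w \<cdot> w = eps a b \<cdot> eps c e"
    by (rule mult_eqI_letters[OF wC wlet wC wlet _ acts_on_letters_mult[OF eps eps]])
      (auto simp: eps tau_letter_def eps_letter_def inv_letter_def)
  have \<mu>1: "\<mu> p = 1 \<or> \<mu> p = - 1" if p: "p \<in> ?I" for p
  proof -
    have "\<phi> (w \<cdot> w) *v v p = (\<mu> p * \<mu> p) *\<^sub>R v p"
      using wC \<mu>[OF p] by (simp add: apply_mult matrix_vector_mult_scaleR)
    moreover have "\<phi> (w \<cdot> w) *v v p = v p"
      using p by (auto simp: ww apply_mult eps vE matrix_vector_mult_scaleR)
    ultimately have "(\<mu> p * \<mu> p - 1) *\<^sub>R v p = 0" by (simp add: algebra_simps)
    then have "\<mu> p * \<mu> p = 1" using vne by simp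
    then show ?thesis by (simp add: square_eq_1_iff)
  qed
  obtain \<delta> t \<epsilon> where \<delta>: "\<delta> \<in> carrier SAut" "acts_on_letters \<delta> t" "\<And>x. fst (t x) = fst x"
    "\<epsilon> = 1 \<or> \<epsilon> = (- 1 :: real)" "\<phi> w = \<epsilon> *\<^sub>R \<phi> \<delta>"
  proof -
    have one_app: "\<phi> \<one>\<^bsub>SAut\<^esub> *v x = x" for x by (simp add: one)
    have sc: "(\<epsilon> *\<^sub>R M) *v x = \<epsilon> *\<^sub>R (M *v x)" for \<epsilon> and M :: "real^'d^'d" and x
      by (simp add: scaleR_matrix_vector_assoc)
    have three: "\<mu> b = 1 \<or> \<mu> b = - 1" "\<mu> c = 1 \<or> \<mu> c = - 1" "\<mu> e = 1 \<or> \<mu> e = - 1" using \<mu>1 by auto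
    \<comment> \<open>Of three signs, either all agree or one differs from the other two.\<close>
    consider "\<mu> b = \<mu> c" "\<mu> c = \<mu> e" | p where "p \<in> ?I" "\<And>r. r \<in> ?I \<Longrightarrow> r \<noteq> p \<Longrightarrow> \<mu> r = - \<mu> p"
    proof -
      have "(\<mu> b = \<mu> c \<and> \<mu> c = \<mu> e) \<or> (\<exists>p\<in>?I. \<forall>r\<in>?I. r \<noteq> p \<longrightarrow> \<mu> r = - \<mu> p)"
        using three by auto
      then show ?thesis using that by blast
    qed
    then show ?thesis
    proof cases
      case 1
      have "\<phi> w = \<mu> b *\<^sub>R \<phi> \<one>\<^bsub>SAut\<^esub>"
        by (rule eqI) (use \<mu> 1 in \<open>auto simp: sc one_app\<close>)
      then show ?thesis
        using that[OF G.one_closed acts_on_letters_one, of "\<mu> b"] three by auto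
    next
      case (2 p)
      have ap: "a \<noteq> p" using 2(1) by auto
      have "\<phi> w = \<mu> p *\<^sub>R \<phi> (eps a p)"
      proof (rule eqI)
        fix r assume r: "r \<in> ?I"
        show "\<phi> w *v v r = (\<mu> p *\<^sub>R \<phi> (eps a p)) *v v r"
          using \<mu>[OF r] 2(2)[OF r] Ev[OF 2(1) r] by (auto simp: sc)
      qed
      then show ?thesis
        using that[OF eps[OF ap], of "\<mu> p"] \<mu>1[OF 2(1)] by (auto simp: eps_letter_def)
    qed
  qed
  let ?x = "\<lambda>i. (i, True)"
  have bc: "fst (?x a) \<noteq> fst (?x c)" by simp
  have TC: "transvection x y \<in> carrier SAut" if "fst x \<noteq> fst y" for x y :: "'n \<times> bool"
    using that by (rule transvection_in_SAut)
  have same: "\<phi> (transvection (?x b) (?x e)) = \<phi> (transvection (t (?x a)) (t (?x c)))"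
  proof -
    have ne': "fst (t (?x a)) \<noteq> fst (t (?x c))" by (simp add: \<delta>(3))
    have "\<phi> w ** \<phi> (transvection (?x a) (?x c)) = \<phi> (transvection (?x b) (?x e)) ** \<phi> w"
      using arg_cong[OF acts_on_letters_conj[OF wC wlet bc], of \<phi>] wC
      by (simp add: mult TC tau_letter_def)
    moreover have "\<phi> \<delta> ** \<phi> (transvection (?x a) (?x c)) =
        \<phi> (transvection (t (?x a)) (t (?x c))) ** \<phi> \<delta>"
      using arg_cong[OF acts_on_letters_conj[OF \<delta>(1,2) bc], of \<phi>] \<delta>(1) ne'
      by (simp add: mult TC)
    ultimately have "\<epsilon> *\<^sub>R (\<phi> (transvection (t (?x a)) (t (?x c))) ** \<phi> \<delta>) =
        \<epsilon> *\<^sub>R (\<phi> (transvection (?x b) (?x e)) ** \<phi> \<delta>)"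
      by (simp add: \<delta>(5) matrix_scalar_ac flip: scalar_matrix_assoc)
    then have "\<phi> (transvection (?x b) (?x e) \<cdot> \<delta>) =
        \<phi> (transvection (t (?x a)) (t (?x c)) \<cdot> \<delta>)"
      using \<delta>(1,4) ne' by (auto simp: mult TC)
    then show ?thesis by (rule cancel_right[rotated 3]) (use \<delta>(1) ne' TC in auto)
  qed
  have "\<phi> (transvection (?x a) (?x e)) = unit"
  proof -
    let ?A = "transvection (?x a) (?x b)" and ?B = "transvection (?x b) (?x e)"
      and ?C = "transvection (?x a) (?x e)" and ?D = "transvection (t (?x a)) (t (?x c))"
    have C: "?A \<in> carrier SAut" "?B \<in> carrier SAut" "?C \<in> carrier SAut" "?D \<in> carrier SAut"
      by (auto intro!: TC simp: \<delta>(3))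
    have "?A \<cdot> ?D = ?D \<cdot> ?A"
      by (rule transvection_commute) (auto simp: \<delta>(3))
    then have "\<phi> (?A \<cdot> ?D) = \<phi> (?D \<cdot> ?A)" by (rule arg_cong)
    then have "\<phi> (?A \<cdot> ?B) = \<phi> (?B \<cdot> ?A)"
      using mult[OF C(1,4)] mult[OF C(4,1)] mult[OF C(1,2)] mult[OF C(2,1)] same by simp
    moreover have "?A \<cdot> ?B = ?B \<cdot> ?C \<cdot> ?A"
      by (rule transvection_commutator) auto
    ultimately have "\<phi> (?B \<cdot> ?C \<cdot> ?A) = \<phi> (?B \<cdot> ?A)" by simp
    then have "\<phi> (?B \<cdot> ?C) = \<phi> ?B" by (rule cancel_right[rotated 3]) (use C in auto)
    then have "\<phi> (?B \<cdot> ?C) = \<phi> (?B \<cdot> \<one>\<^bsub>SAut\<^esub>)" using C by simp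
    then show ?thesis by (rule cancel_left[rotated 3]) (use C in auto)
  qed
  then have "\<phi> (transvection x y) = unit" if "fst x \<noteq> fst y" for x y
    using kernel_transvections[of "?x a" "?x e"] that by simp
  from kernel_all[OF this] show "\<alpha> \<in> carrier SAut \<Longrightarrow> \<phi> \<alpha> = mat 1" by (simp add: one)
qed

text \<open>From a nonconstant sign pattern \<open>s\<close> one obtains \<open>n\<close> patterns: \<open>s\<close> itself, and \<open>s\<close> with the
values at \<open>k\<close> and \<open>m\<close> or at \<open>m\<close> and \<open>l\<close> exchanged, where \<open>s k \<noteq> s l\<close>. Here \<open>P m\<close> is the set of
places where the sign is flipped. Patterns count up to a global sign, so two of them coincide only
if the symmetric difference of their flip sets is everything.\<close>

lemma eps_trivial:
  assumes kl: "k \<noteq> l"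
  shows "\<phi> (eps k l) = mat 1"
proof (rule ccontr)
  assume nontriv: "\<phi> (eps k l) \<noteq> mat 1"
  obtain u s where u: "u \<noteq> 0" "\<And>i. s i = 1 \<or> s i = (- 1 :: real)"
    "\<And>i j. i \<noteq> j \<Longrightarrow> \<phi> (eps i j) *v u = (s i * s j) *\<^sub>R u" "s k \<noteq> s l"
    using signed_eigenvector[OF kl nontriv] by blast
  define P where "P = (\<lambda>m. if m = k then {} else if s m \<noteq> s k then {k, m} else {m, l})"
  define w where "w = (\<lambda>m. if m = k then u else if s m \<noteq> s k then \<phi> (tau k m) *v u
    else \<phi> (tau m l) *v u)"
  define z where "z = (\<lambda>m i. if i \<in> P m then - s i else s i)"
  have sgn: "s i \<noteq> s j \<longleftrightarrow> s i = - s j" for i j using u(2)[of i] u(2)[of j] by auto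
  have w: "\<phi> (eps i j) *v w m = (z m i * z m j) *\<^sub>R w m" if ij: "i \<noteq> j" for i j m
  proof -
    consider "m = k" | "m \<noteq> k" "s m \<noteq> s k" | "m \<noteq> k" "s m = s k" by blast
    then show ?thesis
    proof cases
      case 1
      then show ?thesis using u(3)[OF ij] by (simp add: w_def z_def P_def)
    next
      case 2
      have "s (swap k m f) = z m f" for f using 2 sgn[of m k] by (auto simp: swap_def z_def P_def)
      then show ?thesis using eigenvector_tau[OF _ u(3) ij, of k m] 2 by (simp add: w_def)
    next
      case 3
      have "m \<noteq> l" using 3 u(4) by auto
      moreover have "s l = - s k" using u(4) sgn[of l k] by metis
      then have "s (swap m l f) = z m f" for f
        using 3 by (auto simp: swap_def z_def P_def)
      ultimately show ?thesis using eigenvector_tau[OF _ u(3) ij, of m l] 3 by (simp add: w_def)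
    qed
  qed
  have wne: "w m \<noteq> 0" for m
  proof -
    have "m \<noteq> k \<Longrightarrow> tau k m \<in> carrier SAut" "m \<noteq> l \<Longrightarrow> tau m l \<in> carrier SAut" by (auto intro!: tau)
    moreover have "s m = s k \<Longrightarrow> m \<noteq> l" using u(4) by auto
    ultimately show ?thesis using u(1) apply_neq_0 by (auto simp: w_def)
  qed
  show False
  proof (cases "\<exists>m m'. m \<noteq> m' \<and> (P m - P m') \<union> (P m' - P m) = UNIV")
    case False
    show False
    proof (rule no_separated_family[OF wne])
      fix m m' :: 'n assume "m \<noteq> m'"
      then have "(P m - P m') \<union> (P m' - P m) \<noteq> UNIV" using False by blast
      then obtain j where j: "j \<in> P m \<longleftrightarrow> j \<in> P m'" by blast
      have "P m \<noteq> P m'" using \<open>m \<noteq> m'\<close> u(4) by (auto simp: P_def doubleton_eq_iff split: if_splits)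
      then obtain i where i: "i \<in> P m \<longleftrightarrow> i \<notin> P m'" by blast
      have "i \<noteq> j" using i j by auto
      have "z m i * z m j \<noteq> z m' i * z m' j"
        using i j u(2)[of i] u(2)[of j] by (auto simp: z_def)
      then show "\<exists>M c. (\<forall>k. M *v w k = c k *\<^sub>R w k) \<and> c m \<noteq> c m'"
        using w[OF \<open>i \<noteq> j\<close>] by (intro exI[of _ "\<phi> (eps i j)"] exI[of _ "\<lambda>k. z k i * z k j"]) auto
    qed
  next
    case True
    then obtain m m' where mm: "m \<noteq> m'" "(P m - P m') \<union> (P m' - P m) = UNIV" by blast
    \<comment> \<open>The empty flip set differs from every other in two indices, and so do flip sets that share \<open>k\<close> or \<open>l\<close>; two indices are not all.\<close>
    have big: "\<not> UNIV \<subseteq> {i, j}" for i j :: 'n using exists_third[OF three, of i j] by blast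
    have not_k: "m \<noteq> k" "m' \<noteq> k"
      using mm(2) big[of k m] big[of m l] big[of k m'] big[of m' l]
      by (auto simp: P_def split: if_splits)
    have *: "\<exists>c b. s c \<noteq> s k \<and> s b = s k \<and> b \<noteq> k \<and> UNIV = ({k, c} - {b, l}) \<union> ({b, l} - {k, c})"
    proof -
      consider "s m \<noteq> s k" "s m' \<noteq> s k" | "s m = s k" "s m' = s k"
        | "s m \<noteq> s k" "s m' = s k" | "s m = s k" "s m' \<noteq> s k" by blast
      then show ?thesis
      proof cases
        case 1
        then show ?thesis using mm(2) not_k big[of m m'] by (auto simp: P_def)
      next
        case 2
        then show ?thesis using mm(2) not_k big[of m m'] by (auto simp: P_def)
      next
        case 3
        then show ?thesis using mm(2) not_k
          by (intro exI[of _ m] exI[of _ m']) (simp add: P_def)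
      next
        case 4
        then show ?thesis using mm(2) not_k
          by (intro exI[of _ m'] exI[of _ m]) (simp add: P_def Un_commute)
      qed
    qed
    then obtain c b where cb: "s c \<noteq> s k" "s b = s k" "b \<noteq> k"
      "UNIV = ({k, c} - {b, l}) \<union> ({b, l} - {k, c})" by blast
    have "c \<noteq> l"
    proof
      assume "c = l"
      then have "(UNIV :: 'n set) \<subseteq> {k, b}" using cb(4) by blast
      then show False using big by blast
    qed
    moreover have "k \<noteq> c" "b \<noteq> c" "b \<noteq> l" using cb(1,2) u(4) by metis+
    ultimately have "distinct [k, b, c, l]" using cb(3) kl by simp
    moreover have "UNIV = {k, b, c, l}" using cb(4) by blast
    moreover have "s k = s b" "s c = s l" "s k \<noteq> s c" using cb(1,2) u(2)[of k] u(2)[of l] u(2)[of c] u(4) by auto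
    ultimately have "\<phi> (eps k l) = mat 1"
      using balanced_signs_trivial[of k b c l u s] u(1-3) eps(1)[OF kl] by blast
    with nontriv show False by blast
  qed
qed

theorem representation_trivial: "\<alpha> \<in> carrier SAut \<Longrightarrow> \<phi> \<alpha> = mat 1"
  using kernel_all transvections_trivial_if_eps_trivial eps_trivial by (simp add: one)

end

section \<open>Continuously differentiable maps\<close>

text \<open>The derivative is carried along as an explicit family. In finite dimension, continuity in each
direction is continuity of the derivative.\<close>

definition cont_deriv ::
    "('a::real_normed_vector \<Rightarrow> 'b::real_normed_vector) \<Rightarrow> ('a \<Rightarrow> 'a \<Rightarrow> 'b) \<Rightarrow> bool" where
  "cont_deriv f f' \<longleftrightarrow>
     (\<forall>x. (f has_derivative f' x) (at x)) \<and> (\<forall>v. continuous_on UNIV (\<lambda>x. f' x v))"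

lemma cont_derivD:
  assumes "cont_deriv f f'"
  shows "(f has_derivative f' x) (at x within S)" "continuous_on S (\<lambda>x. f' x v)"
    "linear (f' x)" "continuous_on S f"
proof -
  show d: "(f has_derivative f' x) (at x within S)" for x S
    using assms by (auto simp: cont_deriv_def intro: has_derivative_at_withinI)
  show "continuous_on S (\<lambda>x. f' x v)"
    using assms by (auto simp: cont_deriv_def intro: continuous_on_subset)
  show "linear (f' x)" using d has_derivative_linear by blast
  show "continuous_on S f" using d by (metis has_derivative_continuous_on)
qed

lemma continuous_on_det:
  fixes A :: "'a::topological_space \<Rightarrow> real^'n^'n"
  assumes "\<And>i j. continuous_on S (\<lambda>x. A x $ i $ j)"
  shows "continuous_on S (\<lambda>x. det (A x))"
  unfolding det_def by (intro continuous_intros assms)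

lemma continuous_on_det_deriv:
  fixes f :: "real^'n \<Rightarrow> real^'n"
  assumes "cont_deriv f f'"
  shows "continuous_on S (\<lambda>x. det (matrix (f' x)))"
proof (rule continuous_on_det)
  fix i j
  show "continuous_on S (\<lambda>x. matrix (f' x) $ i $ j)"
    unfolding matrix_def using cont_derivD(2)[OF assms] by (auto intro!: continuous_intros)
qed

section \<open>Integrands depending polynomially on a parameter\<close>

text \<open>Coefficients that depend continuously on the point make the integral over a box a polynomial
in the parameter.\<close>

definition poly_family :: "'a::topological_space set \<Rightarrow> (real \<Rightarrow> 'a \<Rightarrow> real) \<Rightarrow> bool" where
  "poly_family Q u \<longleftrightarrow> (\<exists>p K. (\<forall>x. degree (p x) \<le> K) \<and>
     (\<forall>k. continuous_on Q (\<lambda>x. coeff (p x) k)) \<and> (\<forall>x\<in>Q. \<forall>t. u t x = poly (p x) t))"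

lemma poly_family_const:
  assumes "continuous_on Q c"
  shows "poly_family Q (\<lambda>t. c)"
  unfolding poly_family_def
proof (intro exI conjI allI ballI)
  show "degree [:c x:] \<le> 0" for x
    by simp
  show "continuous_on Q (\<lambda>x. coeff [:c x:] k)" for k
    using assms by (cases k) auto
qed auto

lemma poly_family_linear:
  assumes "continuous_on Q c" "continuous_on Q e"
  shows "poly_family Q (\<lambda>t x. c x + t * e x)"
  unfolding poly_family_def
proof (intro exI conjI allI ballI)
  show "degree [:c x, e x:] \<le> 1" for x
    by simp
  show "continuous_on Q (\<lambda>x. coeff [:c x, e x:] k)" for k
    using assms by (cases k; cases "k - 1") auto
qed auto

lemma poly_family_add:
  assumes "poly_family Q u" "poly_family Q v"
  shows "poly_family Q (\<lambda>t x. u t x + v t x)"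
proof -
  obtain p K q L where p: "\<forall>x. degree (p x) \<le> K" "\<forall>k. continuous_on Q (\<lambda>x. coeff (p x) k)"
      "\<forall>x\<in>Q. \<forall>t. u t x = poly (p x) t"
    and q: "\<forall>x. degree (q x) \<le> L" "\<forall>k. continuous_on Q (\<lambda>x. coeff (q x) k)"
      "\<forall>x\<in>Q. \<forall>t. v t x = poly (q x) t"
    using assms unfolding poly_family_def by blast
  have "degree (p x + q x) \<le> max K L" for x
    using p(1) q(1) by (meson degree_add_le_max le_trans max.mono)
  then show ?thesis unfolding poly_family_def
    using p q by (intro exI[of _ "\<lambda>x. p x + q x"] exI[of _ "max K L"])
      (auto intro!: continuous_intros)
qed

lemma poly_family_mult:
  assumes "poly_family Q u" "poly_family Q v"
  shows "poly_family Q (\<lambda>t x. u t x * v t x)"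
proof -
  obtain p K q L where p: "\<forall>x. degree (p x) \<le> K" "\<forall>k. continuous_on Q (\<lambda>x. coeff (p x) k)"
      "\<forall>x\<in>Q. \<forall>t. u t x = poly (p x) t"
    and q: "\<forall>x. degree (q x) \<le> L" "\<forall>k. continuous_on Q (\<lambda>x. coeff (q x) k)"
      "\<forall>x\<in>Q. \<forall>t. v t x = poly (q x) t"
    using assms unfolding poly_family_def by blast
  have "degree (p x * q x) \<le> K + L" for x
    using p(1) q(1) by (meson add_mono degree_mult_le le_trans)
  then show ?thesis unfolding poly_family_def
    using p q by (intro exI[of _ "\<lambda>x. p x * q x"] exI[of _ "K + L"])
      (auto simp: coeff_mult intro!: continuous_intros)
qed

lemma poly_family_sum:
  assumes "finite I" "\<And>i. i \<in> I \<Longrightarrow> poly_family Q (u i)"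
  shows "poly_family Q (\<lambda>t x. \<Sum>i\<in>I. u i t x)"
  using assms by (induction I) (auto intro: poly_family_add poly_family_const[of _ "\<lambda>_. 0"])

lemma poly_family_prod:
  assumes "finite I" "\<And>i. i \<in> I \<Longrightarrow> poly_family Q (u i)"
  shows "poly_family Q (\<lambda>t x. \<Prod>i\<in>I. u i t x)"
  using assms by (induction I) (auto intro: poly_family_mult poly_family_const[of _ "\<lambda>_. 1"])

lemma poly_family_det:
  fixes A :: "real \<Rightarrow> 'a::topological_space \<Rightarrow> real^'n^'n"
  assumes "\<And>i j. poly_family Q (\<lambda>t x. A t x $ i $ j)"
  shows "poly_family Q (\<lambda>t x. det (A t x))"
  unfolding det_def
  by (intro poly_family_sum poly_family_mult poly_family_prod poly_family_const assms
      continuous_intros finite_permutations) auto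

lemma poly_family_polynomial_function:
  fixes q :: "'a::euclidean_space \<Rightarrow> 'a"
  assumes "real_polynomial_function \<phi>" "continuous_on Q q"
  shows "poly_family Q (\<lambda>t x. \<phi> (x + t *\<^sub>R q x))"
  using assms(1)
proof (induction rule: real_polynomial_function.induct)
  case (linear f)
  have "f (x + t *\<^sub>R q x) = f x + t * f (q x)" for t x
    using linear by (simp add: linear_add linear_scale bounded_linear.linear)
  moreover have "continuous_on Q (\<lambda>x. f (q x))" "continuous_on Q f"
    using linear assms(2) by (auto intro: bounded_linear.continuous_on continuous_on_id)
  ultimately show ?case using poly_family_linear by simp
qed (auto intro: poly_family_add poly_family_mult poly_family_const continuous_intros)

lemma poly_eq_sum_coeff:
  assumes "degree p \<le> K"
  shows "poly p (t::real) = (\<Sum>k\<le>K. coeff p k * t ^ k)"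
  using poly_as_sum_of_monoms'[OF assms] by (metis (no_types, lifting) poly_monom poly_sum sum.cong)

text \<open>A polynomial that is constant on an interval is constant; so a formula for small parameters holds
at parameter \<open>1\<close>.\<close>

lemma poly_family_integral:
  fixes a b :: "'a::euclidean_space"
  assumes u: "poly_family (cbox a b) u" and "\<delta> > 0"
    and c: "\<And>t. 0 < t \<Longrightarrow> t < \<delta> \<Longrightarrow> integral (cbox a b) (u t) = c"
  shows "integral (cbox a b) (u 1) = c"
proof -
  let ?Q = "cbox a b"
  obtain p K where p: "\<forall>x. degree (p x) \<le> K" "\<forall>k. continuous_on ?Q (\<lambda>x. coeff (p x) k)"
      "\<forall>x\<in>?Q. \<forall>t. u t x = poly (p x) t"
    using u unfolding poly_family_def by blast
  define r where "r = (\<Sum>k\<le>K. monom (integral ?Q (\<lambda>x. coeff (p x) k)) k)"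
  have I: "integral ?Q (u t) = poly r t" for t
  proof -
    have e: "poly (p x) t = (\<Sum>k\<le>K. coeff (p x) k * t ^ k)" for x
      using p(1) by (simp add: poly_eq_sum_coeff)
    have "integral ?Q (u t) = integral ?Q (\<lambda>x. \<Sum>k\<le>K. coeff (p x) k * t ^ k)"
      using p(3) by (intro integral_cong) (simp add: e)
    also have "\<dots> = (\<Sum>k\<le>K. integral ?Q (\<lambda>x. coeff (p x) k * t ^ k))"
      using p(2) by (intro integral_sum integrable_continuous) (auto intro!: continuous_intros)
    also have "\<dots> = poly r t"
      by (simp add: r_def poly_sum poly_monom)
    finally show ?thesis .
  qed
  have "poly (r - [:c:]) t = 0" if "t \<in> {0<..<\<delta>}" for t
    using c[of t] that by (simp add: I)
  then have "{0<..<\<delta>} \<subseteq> {t. poly (r - [:c:]) t = 0}" by blast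
  then have "r - [:c:] = 0"
    using poly_roots_finite[of "r - [:c:]"] infinite_Ioo[OF \<open>\<delta> > 0\<close>] finite_subset by blast
  then show ?thesis using I[of 1] by simp
qed

lemma poly_family_positive:
  fixes Q :: "'a::topological_space set"
  assumes u: "poly_family Q u" and "compact Q" and one: "\<And>x. x \<in> Q \<Longrightarrow> u 0 x = 1"
  obtains \<delta> where "\<delta> > 0" "\<And>t x. 0 < t \<Longrightarrow> t < \<delta> \<Longrightarrow> x \<in> Q \<Longrightarrow> u t x > 0"
proof -
  obtain p K where p: "\<forall>x. degree (p x) \<le> K" "\<forall>k. continuous_on Q (\<lambda>x. coeff (p x) k)"
      "\<forall>x\<in>Q. \<forall>t. u t x = poly (p x) t"
    using u unfolding poly_family_def by blast
  have "\<exists>B. \<forall>x\<in>Q. \<bar>coeff (p x) k\<bar> \<le> B" for k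
  proof -
    have "compact ((\<lambda>x. coeff (p x) k) ` Q)"
      using p(2) \<open>compact Q\<close> compact_continuous_image by blast
    then have "bounded ((\<lambda>x. coeff (p x) k) ` Q)"
      by (rule compact_imp_bounded)
    then show ?thesis by (auto simp: bounded_real)
  qed
  then obtain B where B: "\<And>k x. x \<in> Q \<Longrightarrow> \<bar>coeff (p x) k\<bar> \<le> B k" by metis
  define C where "C = (\<Sum>k\<in>{1..K}. \<bar>B k\<bar>)"
  have C: "C \<ge> 0" by (simp add: C_def sum_nonneg)
  show ?thesis
  proof (rule that[of "min 1 (1 / (C + 1))"])
    show "min 1 (1 / (C + 1)) > 0" using C by simp
    fix t x assume t: "0 < t" "t < min 1 (1 / (C + 1))" and x: "x \<in> Q"
    have c0: "coeff (p x) 0 = 1"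
      using one[OF x] p(3) x by (simp add: poly_0_coeff_0)
    have "poly (p x) t = (\<Sum>k\<le>K. coeff (p x) k * t ^ k)"
      using p(1) by (simp add: poly_eq_sum_coeff)
    also have "{..K} = insert 0 {1..K}" by auto
    finally have e: "poly (p x) t = 1 + (\<Sum>k\<in>{1..K}. coeff (p x) k * t ^ k)"
      by (simp add: c0)
    have "\<bar>\<Sum>k\<in>{1..K}. coeff (p x) k * t ^ k\<bar> \<le> (\<Sum>k\<in>{1..K}. \<bar>coeff (p x) k * t ^ k\<bar>)"
      by (rule sum_abs)
    also have "\<dots> \<le> (\<Sum>k\<in>{1..K}. \<bar>B k\<bar> * t)"
    proof (rule sum_mono)
      fix k assume k: "k \<in> {1..K}"
      have "t ^ k \<le> t ^ 1" using t k by (intro power_decreasing) auto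
      moreover have "\<bar>coeff (p x) k\<bar> \<le> \<bar>B k\<bar>" using B[OF x, of k] by linarith
      ultimately show "\<bar>coeff (p x) k * t ^ k\<bar> \<le> \<bar>B k\<bar> * t"
        using t by (simp add: abs_mult mult_mono)
    qed
    also have "\<dots> = t * C" by (simp add: C_def sum_distrib_left mult.commute)
    also have "\<dots> < 1"
    proof -
      have "t * (C + 1) < 1" using t C by (simp add: field_simps)
      then show ?thesis using t C by (simp add: algebra_simps)
    qed
    finally show "u t x > 0" using p(3) x e by (auto simp: abs_less_iff)
  qed
qed

section \<open>The degree of a compactly supported perturbation of the identity\<close>

lemma cont_deriv_zero_outside:
  fixes q :: "'a::euclidean_space \<Rightarrow> 'b::real_normed_vector"
  assumes q: "cont_deriv q q'" and "closed Q" and "\<And>x. x \<notin> Q \<Longrightarrow> q x = 0" and "x \<notin> Q"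
  shows "q' x = (\<lambda>v. 0)"
proof -
  have "(q has_derivative (\<lambda>v. 0)) (at x)"
  proof (rule has_derivative_transform_within_open)
    show "((\<lambda>x. 0) has_derivative (\<lambda>v. 0)) (at x)" by simp
    show "open (- Q)" "x \<in> - Q" using assms by auto
    show "0 = q y" if "y \<in> - Q" for y using assms(3)[of y] that by auto
  qed
  then show ?thesis using cont_derivD(1)[OF q] has_derivative_unique by blast
qed

lemma lipschitz_of_compact_support:
  fixes q :: "real^'n \<Rightarrow> real^'n"
  assumes q: "cont_deriv q q'" and "compact Q" and "\<And>x. x \<notin> Q \<Longrightarrow> q x = 0"
  obtains L where "L > 0" "\<And>x y. norm (q x - q y) \<le> L * norm (x - y)"
proof -
  have "\<exists>B. \<forall>x. norm (q' x (axis j 1)) \<le> B" for j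
  proof -
    have "compact ((\<lambda>x. q' x (axis j 1)) ` Q)"
      using cont_derivD(2)[OF q] \<open>compact Q\<close> compact_continuous_image by blast
    then obtain B where B: "\<forall>x\<in>Q. norm (q' x (axis j 1)) \<le> B"
      using compact_imp_bounded by (metis bounded_iff imageI)
    have "norm (q' x (axis j 1)) \<le> \<bar>B\<bar>" for x
    proof (cases "x \<in> Q")
      case True
      then show ?thesis using B by fastforce
    next
      case False
      then have "q' x = (\<lambda>v. 0)"
        using cont_deriv_zero_outside[OF q compact_imp_closed[OF assms(2)]] assms(3) by blast
      then show ?thesis by simp
    qed
    then show ?thesis by blast
  qed
  then obtain B where B: "\<And>j x. norm (q' x (axis j 1)) \<le> B j" by metis
  define L where "L = (\<Sum>j\<in>UNIV. B j) + 1"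
  have B0: "B j \<ge> 0" for j using B[of undefined j] norm_ge_zero order_trans by blast
  then have L: "L > 0" by (simp add: L_def sum_nonneg add_nonneg_pos)
  have "onorm (q' x) \<le> L" for x
  proof (rule onorm_le)
    fix v :: "real^'n"
    have "v = (\<Sum>j\<in>UNIV. v $ j *\<^sub>R axis j 1)"
      using basis_expansion[of v] by (simp add: scalar_mult_eq_scaleR)
    then have "q' x v = q' x (\<Sum>j\<in>UNIV. v $ j *\<^sub>R axis j 1)"
      by (rule arg_cong)
    also have "\<dots> = (\<Sum>j\<in>UNIV. v $ j *\<^sub>R q' x (axis j 1))"
      using cont_derivD(3)[OF q, of x] by (simp add: linear_sum linear_scale)
    finally have "norm (q' x v) \<le> (\<Sum>j\<in>UNIV. norm (v $ j *\<^sub>R q' x (axis j 1)))"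
      by (simp only: norm_sum)
    also have "\<dots> = (\<Sum>j\<in>UNIV. \<bar>v $ j\<bar> * norm (q' x (axis j 1)))" by simp
    also have "\<dots> \<le> (\<Sum>j\<in>UNIV. norm v * B j)"
      by (intro sum_mono mult_mono B component_le_norm_cart) auto
    also have "\<dots> = norm v * (\<Sum>j\<in>UNIV. B j)"
      by (simp only: sum_distrib_left)
    also have "\<dots> \<le> L * norm v"
      by (simp add: L_def algebra_simps)
    finally show "norm (q' x v) \<le> L * norm v" .
  qed
  then have "norm (q x - q y) \<le> L * norm (x - y)" for x y
    using differentiable_bound[of UNIV q q' L x y] cont_derivD(1)[OF q] by auto
  with L that show ?thesis by blast
qed

text \<open>Injectivity and surjectivity on the whole space come from the contraction principle. Points
outside \<open>Q\<close> are fixed, so \<open>Q\<close> is mapped onto itself.\<close>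

lemma bij_betw_small_perturbation:
  fixes q :: "'a::banach \<Rightarrow> 'a"
  assumes L: "\<And>x y. norm (q x - q y) \<le> L * norm (x - y)" and t: "0 < t" "t * L < 1" "L > 0"
    and Q: "\<And>x. x \<notin> Q \<Longrightarrow> q x = 0"
  shows "bij_betw (\<lambda>x. x + t *\<^sub>R q x) Q Q"
proof -
  let ?h = "\<lambda>x. x + t *\<^sub>R q x"
  have inj: "x = y" if "?h x = ?h y" for x y
  proof (rule ccontr)
    assume "x \<noteq> y"
    have "x - y = t *\<^sub>R (q y - q x)" using that by (simp add: algebra_simps)
    then have "norm (x - y) = t * norm (q y - q x)" using t by simp
    also have "\<dots> \<le> t * (L * norm (x - y))"
      using L[of y x] t by (simp add: norm_minus_commute)
    also have "\<dots> = (t * L) * norm (x - y)" by simp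
    also have "\<dots> < norm (x - y)" using t \<open>x \<noteq> y\<close> by simp
    finally show False by simp
  qed
  have surj: "\<exists>x. ?h x = y" for y
  proof -
    have "\<exists>!x. y - t *\<^sub>R q x = x"
    proof (rule banach_fix_type)
      show "0 \<le> t * L" "t * L < 1" using t by auto
      have "norm (t *\<^sub>R q b - t *\<^sub>R q a) \<le> t * L * norm (a - b)" for a b
      proof -
        have "norm (t *\<^sub>R q b - t *\<^sub>R q a) = t * norm (q b - q a)"
          using t by (simp add: scaleR_right_diff_distrib[symmetric])
        also have "\<dots> \<le> t * (L * norm (a - b))"
          using L[of b a] t by (simp add: norm_minus_commute)
        finally show ?thesis by simp
      qed
      then show "\<forall>a b. dist (y - t *\<^sub>R q a) (y - t *\<^sub>R q b) \<le> t * L * dist a b"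
        by (simp add: dist_norm algebra_simps)
    qed
    then show ?thesis by (metis diff_add_cancel)
  qed
  have mem: "?h x \<in> Q \<longleftrightarrow> x \<in> Q" for x
  proof (cases "q x = 0 \<or> q (?h x) = 0")
    case True
    have "?h x = x"
    proof (cases "q x = 0")
      case False
      with True have "?h (?h x) = ?h x" by simp
      then show ?thesis by (rule inj)
    qed simp
    then show ?thesis by (simp only:)
  next
    case False
    then show ?thesis using Q[of x] Q[of "?h x"] by blast
  qed
  show ?thesis
  proof (rule bij_betw_imageI)
    show "inj_on ?h Q" by (rule inj_onI) (rule inj)
    show "?h ` Q = Q"
    proof (intro equalityI subsetI)
      fix y assume "y \<in> Q"
      obtain x where "?h x = y" using surj by blast
      with mem[of x] \<open>y \<in> Q\<close> show "y \<in> ?h ` Q" by blast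
    qed (use mem in blast)
  qed
qed

lemma integral_change_of_variables_real:
  fixes g :: "real^'m::{finite,wellorder} \<Rightarrow> real^'m::_" and \<phi> :: "real^'m::_ \<Rightarrow> real"
  assumes S: "S \<in> sets lebesgue"
    and g: "\<And>x. x \<in> S \<Longrightarrow> (g has_derivative g' x) (at x within S)" "inj_on g S"
    and \<phi>: "\<phi> absolutely_integrable_on g ` S"
  shows "((\<lambda>x. \<bar>det (matrix (g' x))\<bar> * \<phi> (g x)) has_integral integral (g ` S) \<phi>) S"
proof -
  let ?f = "\<lambda>x. vec (\<phi> x) :: real^1"
  have "?f absolutely_integrable_on g ` S"
    using \<phi> by (simp add: absolutely_integrable_on_1_iff)
  then have "(\<lambda>x. \<bar>det (matrix (g' x))\<bar> *\<^sub>R ?f (g x)) absolutely_integrable_on S \<and>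
      integral S (\<lambda>x. \<bar>det (matrix (g' x))\<bar> *\<^sub>R ?f (g x)) = integral (g ` S) ?f"
    using has_absolute_integral_change_of_variables[OF S g, of ?f "integral (g ` S) ?f"] by blast
  then have "(\<lambda>x. \<bar>det (matrix (g' x))\<bar> * \<phi> (g x)) absolutely_integrable_on S \<and>
      integral S (\<lambda>x. \<bar>det (matrix (g' x))\<bar> * \<phi> (g x)) = integral (g ` S) \<phi>"
    by (simp add: absolutely_integrable_on_1_iff integral_on_1_eq vec_eq_iff)
  then show ?thesis
    by (simp add: has_integral_iff absolutely_integrable_on_def)
qed

text \<open>The perturbation \<open>x + q x\<close> has degree one, in integral form. For \<open>x + t q x\<close> with small \<open>t\<close> this is
the change of variables formula. If \<open>\<phi>\<close> is a polynomial, the left hand side is a polynomial in \<open>t\<close>,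
so the formula persists up to \<open>t = 1\<close>; the general case follows by approximating \<open>\<phi>\<close> uniformly.\<close>

lemma integral_pullback_eq:
  fixes q :: "real^'m::{finite,wellorder} \<Rightarrow> real^'m::_" and \<phi> :: "real^'m::_ \<Rightarrow> real"
  assumes q: "cont_deriv q q'" and q0: "\<And>x. x \<notin> cbox a b \<Longrightarrow> q x = 0"
    and \<phi>: "continuous_on UNIV \<phi>"
  shows "integral (cbox a b) (\<lambda>x. \<phi> (x + q x) * det (matrix (\<lambda>v. v + q' x v))) =
    integral (cbox a b) \<phi>"
proof -
  let ?Q = "cbox a b"
  let ?J = "\<lambda>t x. det (matrix (\<lambda>v. v + t *\<^sub>R q' x v))"
  have contq: "continuous_on S q" for S using cont_derivD(4)[OF q] .
  have J: "poly_family ?Q ?J"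
  proof (rule poly_family_det)
    fix i j
    have "continuous_on ?Q (\<lambda>x. q' x (axis j 1) $ i)"
      using cont_derivD(2)[OF q] by (intro continuous_intros)
    then show "poly_family ?Q (\<lambda>t x. matrix (\<lambda>v. v + t *\<^sub>R q' x v) $ i $ j)"
      unfolding matrix_def by (auto intro!: poly_family_linear continuous_intros)
  qed
  obtain \<delta> where \<delta>: "\<delta> > 0" "\<And>t x. 0 < t \<Longrightarrow> t < \<delta> \<Longrightarrow> x \<in> ?Q \<Longrightarrow> ?J t x > 0"
    using poly_family_positive[OF J compact_cbox] by (auto simp: matrix_id_mat_1[unfolded id_def])
  obtain L where L: "L > 0" "\<And>x y. norm (q x - q y) \<le> L * norm (x - y)"
    using lipschitz_of_compact_support[OF q compact_cbox q0] by blast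
  have small: "integral ?Q (\<lambda>x. \<psi> (x + t *\<^sub>R q x) * ?J t x) = integral ?Q \<psi>"
    if \<psi>: "continuous_on UNIV \<psi>" and t: "0 < t" "t < min \<delta> (1 / L)" for t and \<psi> :: "real^'m::_ \<Rightarrow> real"
  proof -
    have "t * L < 1" using t L(1) by (simp add: field_simps)
    then have bij: "bij_betw (\<lambda>x. x + t *\<^sub>R q x) ?Q ?Q"
      using bij_betw_small_perturbation[OF L(2) t(1) _ L(1) q0] by blast
    have "((\<lambda>x. \<bar>?J t x\<bar> * \<psi> (x + t *\<^sub>R q x)) has_integral
        integral ((\<lambda>x. x + t *\<^sub>R q x) ` ?Q) \<psi>) ?Q"
    proof (rule integral_change_of_variables_real)
      show "((\<lambda>x. x + t *\<^sub>R q x) has_derivative (\<lambda>v. v + t *\<^sub>R q' x v)) (at x within ?Q)" for x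
        by (intro derivative_intros cont_derivD(1)[OF q])
      show "\<psi> absolutely_integrable_on (\<lambda>x. x + t *\<^sub>R q x) ` ?Q"
        using bij \<psi> by (simp add: bij_betw_def absolutely_integrable_continuous continuous_on_subset)
      show "inj_on (\<lambda>x. x + t *\<^sub>R q x) ?Q" using bij by (simp add: bij_betw_def)
    qed auto
    moreover have "(\<lambda>x. x + t *\<^sub>R q x) ` ?Q = ?Q" using bij by (simp add: bij_betw_def)
    ultimately have "integral ?Q (\<lambda>x. \<bar>?J t x\<bar> * \<psi> (x + t *\<^sub>R q x)) = integral ?Q \<psi>"
      by (simp add: has_integral_iff)
    moreover have "integral ?Q (\<lambda>x. \<bar>?J t x\<bar> * \<psi> (x + t *\<^sub>R q x)) =
        integral ?Q (\<lambda>x. \<psi> (x + t *\<^sub>R q x) * ?J t x)"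
      using \<delta>(2) t by (intro integral_cong) (auto simp: abs_of_pos)
    ultimately show ?thesis by simp
  qed
  have poly: "integral ?Q (\<lambda>x. \<psi> (x + q x) * ?J 1 x) = integral ?Q \<psi>"
    if \<psi>: "real_polynomial_function \<psi>" for \<psi>
  proof -
    have pf: "poly_family ?Q (\<lambda>t x. \<psi> (x + t *\<^sub>R q x) * ?J t x)"
      by (intro poly_family_mult J poly_family_polynomial_function \<psi> contq)
    have "continuous_on UNIV \<psi>"
      by (rule continuous_on_polymonial_function) (use \<psi> real_polynomial_function_eq in blast)
    note c\<psi> = this
    have "integral ?Q (\<lambda>x. \<psi> (x + 1 *\<^sub>R q x) * ?J 1 x) = integral ?Q \<psi>"
      by (rule poly_family_integral[OF pf, of "min \<delta> (1 / L)"])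
        (use \<delta>(1) L(1) c\<psi> in \<open>auto intro!: small\<close>)
    then show ?thesis by simp
  qed
  define J1 where "J1 = (\<lambda>x. det (matrix (\<lambda>v. v + q' x v)))"
  have cJ: "continuous_on S J1" for S
  proof -
    have "cont_deriv (\<lambda>x. x + q x) (\<lambda>x v. v + q' x v)"
      using q unfolding cont_deriv_def by (auto intro!: derivative_intros continuous_intros)
    then show ?thesis unfolding J1_def by (rule continuous_on_det_deriv)
  qed
  have "\<bar>integral ?Q (\<lambda>x. \<phi> (x + q x) * J1 x) - integral ?Q \<phi>\<bar> \<le> e" if "e > 0" for e
  proof -
    define C where "C = integral ?Q (\<lambda>x. \<bar>J1 x\<bar>) + integral ?Q (\<lambda>x. 1)"
    have C: "C \<ge> 0" unfolding C_def
      by (intro add_nonneg_nonneg integral_nonneg integrable_continuous)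
        (auto intro!: continuous_intros cJ)
    define \<epsilon> where "\<epsilon> = e / (C + 1)"
    have \<epsilon>: "\<epsilon> > 0" using \<open>e > 0\<close> C by (simp add: \<epsilon>_def)
    have "compact (?Q \<union> (\<lambda>x. x + q x) ` ?Q)"
      by (intro compact_Un compact_continuous_image compact_cbox continuous_intros contq)
    moreover have "continuous_on (?Q \<union> (\<lambda>x. x + q x) ` ?Q) \<phi>"
      using \<phi> by (rule continuous_on_subset) simp
    ultimately obtain \<psi> where \<psi>: "real_polynomial_function \<psi>"
        "\<And>x. x \<in> ?Q \<union> (\<lambda>x. x + q x) ` ?Q \<Longrightarrow> \<bar>\<phi> x - \<psi> x\<bar> < \<epsilon>"
      using Stone_Weierstrass_real_polynomial_function[OF _ _ \<epsilon>] by blast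
    have c\<psi>: "continuous_on S \<psi>" for S
      by (rule continuous_on_polymonial_function) (use \<psi>(1) real_polynomial_function_eq in blast)
    have c\<phi>: "continuous_on S \<phi>" for S using \<phi> continuous_on_subset by blast
    have ch: "continuous_on S (\<lambda>x. x + q x)" for S by (intro continuous_intros contq)
    have "continuous_on S (\<lambda>x. \<phi> (x + q x))" "continuous_on S (\<lambda>x. \<psi> (x + q x))" for S
      using continuous_on_compose2[OF c\<phi>[of UNIV] ch] continuous_on_compose2[OF c\<psi>[of UNIV] ch]
      by simp_all
    note cc = this c\<phi> c\<psi> cJ
    have i1: "(\<lambda>x. \<phi> (x + q x) * J1 x) integrable_on ?Q" "(\<lambda>x. \<psi> (x + q x) * J1 x) integrable_on ?Q"
        "\<phi> integrable_on ?Q" "\<psi> integrable_on ?Q" "J1 integrable_on ?Q"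
        "(\<lambda>x. \<bar>J1 x\<bar>) integrable_on ?Q"
      by (intro integrable_continuous cc continuous_on_mult continuous_on_rabs)+
    have i2: "(\<lambda>x. \<epsilon> * \<bar>J1 x\<bar>) integrable_on ?Q"
      by (intro integrable_continuous continuous_on_mult continuous_on_const continuous_on_rabs cJ)
    have "\<bar>integral ?Q (\<lambda>x. \<phi> (x + q x) * J1 x) - integral ?Q (\<lambda>x. \<psi> (x + q x) * J1 x)\<bar>
        \<le> integral ?Q (\<lambda>x. \<epsilon> * \<bar>J1 x\<bar>)"
      unfolding integral_diff[OF i1(1,2), symmetric] real_norm_def[symmetric]
    proof (rule integral_norm_bound_integral)
      fix x assume "x \<in> ?Q"
      then have "\<bar>\<phi> (x + q x) - \<psi> (x + q x)\<bar> \<le> \<epsilon>" using \<psi>(2)[of "x + q x"] by auto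
      then show "norm (\<phi> (x + q x) * J1 x - \<psi> (x + q x) * J1 x) \<le> \<epsilon> * norm (J1 x)"
        by (simp add: left_diff_distrib[symmetric] abs_mult mult_right_mono)
    qed (use i1 i2 in \<open>auto intro: integrable_diff\<close>)
    moreover have "\<bar>integral ?Q \<phi> - integral ?Q \<psi>\<bar> \<le> integral ?Q (\<lambda>x. \<epsilon> * 1)"
      unfolding integral_diff[OF i1(3,4), symmetric] real_norm_def[symmetric]
    proof (rule integral_norm_bound_integral)
      fix x assume "x \<in> ?Q"
      then show "norm (\<phi> x - \<psi> x) \<le> \<epsilon> * 1" using \<psi>(2)[of x] by auto
    qed (use i1 in \<open>auto intro: integrable_diff\<close>)
    moreover have "integral ?Q (\<lambda>x. \<psi> (x + q x) * J1 x) = integral ?Q \<psi>"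
      using poly[OF \<psi>(1)] by (simp add: J1_def)
    ultimately have "\<bar>integral ?Q (\<lambda>x. \<phi> (x + q x) * J1 x) - integral ?Q \<phi>\<bar>
        \<le> integral ?Q (\<lambda>x. \<epsilon> * \<bar>J1 x\<bar>) + integral ?Q (\<lambda>x. \<epsilon> * 1)" by linarith
    also have "\<dots> = \<epsilon> * C" unfolding C_def integral_mult_right by (simp add: distrib_left)
    also have "\<dots> \<le> e" using \<open>e > 0\<close> C by (simp add: \<epsilon>_def field_simps)
    finally show ?thesis .
  qed
  then have "integral ?Q (\<lambda>x. \<phi> (x + q x) * J1 x) = integral ?Q \<phi>"
    using field_le_epsilon[of "\<bar>integral ?Q (\<lambda>x. \<phi> (x + q x) * J1 x) - integral ?Q \<phi>\<bar>" 0] by simp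
  then show ?thesis by (simp add: J1_def)
qed

lemma local_diffeo:
  fixes h :: "real^'n \<Rightarrow> real^'n"
  assumes h: "cont_deriv h h'" and det: "det (matrix (h' x)) \<noteq> 0"
  obtains U where "open U" "x \<in> U" "inj_on h U" "\<And>V. open V \<Longrightarrow> V \<subseteq> U \<Longrightarrow> open (h ` V)"
    "\<And>z. z \<in> U \<Longrightarrow> sgn (det (matrix (h' z))) = sgn (det (matrix (h' x)))"
proof -
  define H where "H = (\<lambda>x. Blinfun (h' x))"
  have H: "blinfun_apply (H x) = h' x" for x
    unfolding H_def using cont_derivD(3)[OF h]
    by (intro bounded_linear_Blinfun_apply) (simp add: linear_conv_bounded_linear)
  have "inj (h' x)" using det det_nz_iff_inj[OF cont_derivD(3)[OF h]] by blast
  then obtain g where g: "linear g" "g \<circ> h' x = id"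
    using linear_injective_left_inverse[OF cont_derivD(3)[OF h]] by blast
  have "blinfun_apply (Blinfun g) = g"
    using g(1) by (intro bounded_linear_Blinfun_apply) (simp add: linear_conv_bounded_linear)
  then have inv: "Blinfun g o\<^sub>L H x = id_blinfun"
    using g(2) by (intro blinfun_eqI) (simp add: H o_def fun_eq_iff id_def)
  have contH: "continuous_on UNIV H"
    by (rule continuous_on_blinfun_componentwise) (simp add: H cont_derivD(2)[OF h])
  obtain U V g where U: "open U" "x \<in> U" and V: "open V" and hom: "homeomorphism U V h g"
    by (rule inverse_function_theorem[of UNIV h H x "Blinfun g"])
      (use contH inv cont_derivD(1)[OF h] in \<open>auto simp: H\<close>)
  let ?D = "\<lambda>z. det (matrix (h' z))"
  \<comment> \<open>Shrink the neighbourhood so that the Jacobian keeps its sign.\<close>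
  define U' where "U' = U \<inter> {z. ?D z * ?D x > 0}"
  show ?thesis
  proof (rule that)
    have "open {z. ?D z * ?D x > 0}"
      by (intro open_Collect_less continuous_intros continuous_on_det_deriv[OF h])
    then show "open U'" using U by (auto simp: U'_def)
    show "x \<in> U'" using U det by (auto simp: U'_def zero_less_mult_iff linorder_neq_iff)
    show "inj_on h U'" using hom unfolding homeomorphism_def U'_def inj_on_def by (metis IntD1)
    show "open (h ` W)" if W: "open W" "W \<subseteq> U'" for W
    proof -
      have "h ` W = V \<inter> g -` W"
        using hom W(2) unfolding homeomorphism_def U'_def by force
      then show ?thesis
        using continuous_open_preimage[OF _ V W(1)] hom unfolding homeomorphism_def by metis
    qed
    show "sgn (?D z) = sgn (?D x)" if "z \<in> U'" for z
      using that by (auto simp: U'_def zero_less_mult_iff)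
  qed
qed

text \<open>Near a regular value the map is a finite union of diffeomorphisms onto a common ball. Testing
the integral formula with a bump function on that ball, each sheet contributes the integral of
the bump with the sign of its Jacobian.\<close>

lemma sum_sgn_fibre_eq_one:
  fixes q :: "real^'m::{finite,wellorder} \<Rightarrow> real^'m::_"
  assumes q: "cont_deriv q q'" and q0: "\<And>x. x \<notin> cbox a b \<Longrightarrow> q x = 0"
    and y: "y \<in> box a b"
    and reg: "\<And>x. x + q x = y \<Longrightarrow> det (matrix (\<lambda>v. v + q' x v)) \<noteq> 0"
  shows "finite {x. x + q x = y}"
    "(\<Sum>x | x + q x = y. sgn (det (matrix (\<lambda>v. v + q' x v)))) = 1"
proof -
  let ?Q = "cbox a b"
  define k where "k = (\<lambda>x. x + q x)"
  define k' where "k' = (\<lambda>x v. v + q' x v)"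
  define D where "D = (\<lambda>x. det (matrix (k' x)))"
  have k: "cont_deriv k k'"
    using q unfolding cont_deriv_def k_def k'_def
    by (auto intro!: derivative_intros continuous_intros)
  have contk: "continuous_on S k" for S using cont_derivD(4)[OF k] .
  have contD: "continuous_on S D" for S unfolding D_def by (rule continuous_on_det_deriv[OF k])
  define S where "S = {x. k x = y}"
  have kQ: "x \<in> ?Q" if "k x \<in> ?Q" for x
    using that q0[of x] by (cases "x \<in> ?Q") (auto simp: k_def)
  have "y \<in> ?Q" using y box_subset_cbox by blast
  then have SQ: "S \<subseteq> ?Q" using kQ by (auto simp: S_def)
  have "closed S"
    unfolding S_def by (intro closed_Collect_eq contk continuous_intros)
  then have "compact S" using SQ compact_cbox compact_Int_closed by (metis inf.absorb_iff2)
  define P where "P = (\<lambda>x U. open U \<and> x \<in> U \<and> inj_on k U \<and>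
      (\<forall>V. open V \<longrightarrow> V \<subseteq> U \<longrightarrow> open (k ` V)) \<and> (\<forall>z\<in>U. sgn (D z) = sgn (D x)))"
  have "\<exists>U. P x U" if "x \<in> S" for x
  proof -
    have "det (matrix (k' x)) \<noteq> 0" using reg[of x] that by (simp add: S_def k_def k'_def)
    then show ?thesis
    proof (rule local_diffeo[OF k])
      fix U
      assume U: "open U" "x \<in> U" "inj_on k U" "\<And>V. open V \<Longrightarrow> V \<subseteq> U \<Longrightarrow> open (k ` V)"
        "\<And>z. z \<in> U \<Longrightarrow> sgn (det (matrix (k' z))) = sgn (det (matrix (k' x)))"
      have "P x U" unfolding P_def D_def by (intro conjI allI impI ballI U)
      then show ?thesis ..
    qed
  qed
  then obtain U where PU: "\<And>x. x \<in> S \<Longrightarrow> P x (U x)" by metis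
  have U: "\<And>x. x \<in> S \<Longrightarrow> open (U x)" "\<And>x. x \<in> S \<Longrightarrow> x \<in> U x"
      "\<And>x. x \<in> S \<Longrightarrow> inj_on k (U x)" "\<And>x V. x \<in> S \<Longrightarrow> open V \<Longrightarrow> V \<subseteq> U x \<Longrightarrow> open (k ` V)"
      "\<And>x z. x \<in> S \<Longrightarrow> z \<in> U x \<Longrightarrow> sgn (D z) = sgn (D x)"
    using PU unfolding P_def by blast+
  have US: "z = x" if "x \<in> S" "z \<in> S" "z \<in> U x" for x z
    using U(3)[OF that(1)] U(2)[OF that(1)] that unfolding inj_on_def S_def by auto
  obtain C where C: "C \<subseteq> S" "finite C" "S \<subseteq> (\<Union>x\<in>C. U x)"
    using compactE_image[OF \<open>compact S\<close>, of S U] U(1,2) by blast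
  have "S \<subseteq> C" using C US by blast
  then have fin: "finite S" using C(2) finite_subset by blast
  have "\<exists>d>0. \<forall>z\<in>S. z \<noteq> x \<longrightarrow> d \<le> dist x z" for x
    using finite_set_avoid[OF fin, of x] by (metis dist_commute)
  then obtain d where d: "\<And>x. d x > 0" "\<And>x z. z \<in> S \<Longrightarrow> z \<noteq> x \<Longrightarrow> d x \<le> dist x z" by metis
  define W where "W = (\<lambda>x. U x \<inter> ball x (d x / 2))"
  have Wdisj: "W x \<inter> W z = {}" if xz: "x \<in> S" "z \<in> S" "x \<noteq> z" for x z
  proof (rule ccontr)
    assume "W x \<inter> W z \<noteq> {}"
    then obtain w where "dist x w < d x / 2" "dist z w < d z / 2" by (auto simp: W_def)
    moreover have "dist x z \<le> dist x w + dist z w" by (metis dist_triangle2)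
    moreover have "d x \<le> dist x z" "d z \<le> dist x z"
      using d(2)[of z x] d(2)[of x z] xz by (auto simp: dist_commute)
    ultimately show False by linarith
  qed
  have Wopen: "open (W x)" if "x \<in> S" for x using U(1) that by (auto simp: W_def)
  \<comment> \<open>Over \<open>N\<close> every sheet is onto, and there are no points of the fibre outside the sheets.\<close>
  define N where "N = (\<Inter>x\<in>S. k ` W x) \<inter> box a b \<inter> - k ` (?Q - (\<Union>x\<in>S. W x))"
  have "open N"
  proof -
    have "open (\<Inter>x\<in>S. k ` W x)"
      using fin U(4) Wopen by (intro open_INT) (auto simp: W_def)
    moreover have "compact (?Q - (\<Union>x\<in>S. W x))"
      using Wopen by (intro compact_diff compact_cbox open_UN) auto
    then have "closed (k ` (?Q - (\<Union>x\<in>S. W x)))"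
      by (intro compact_imp_closed compact_continuous_image contk)
    ultimately show ?thesis unfolding N_def by (intro open_Int open_Compl open_box)
  qed
  moreover have xW: "x \<in> W x" if "x \<in> S" for x using U(2) that d(1) by (auto simp: W_def)
  have "y \<in> N"
  proof -
    have "y \<in> k ` W x" if "x \<in> S" for x using xW[OF that] that by (auto simp: S_def)
    moreover have "y \<notin> k ` (?Q - (\<Union>x\<in>S. W x))" using xW by (auto simp: S_def)
    ultimately show ?thesis using y by (auto simp: N_def)
  qed
  ultimately obtain r where r: "r > 0" "ball y r \<subseteq> N" by (metis openE)
  define \<phi> where "\<phi> = (\<lambda>z. max 0 (r - dist y z))"
  have \<phi>: "continuous_on T \<phi>" for T unfolding \<phi>_def by (intro continuous_intros)
  have \<phi>0: "\<phi> z = 0" if "z \<notin> ball y r" for z using that by (auto simp: \<phi>_def)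
  have ball: "ball y r \<subseteq> ?Q"
    using r(2) box_subset_cbox[of a b] unfolding N_def by blast
  have \<phi>i: "\<phi> absolutely_integrable_on ball y r"
    by (rule set_integrable_subset[OF absolutely_integrable_continuous[OF \<phi>] _ ball]) auto
  define I where "I = integral (ball y r) \<phi>"
  have "(\<phi> has_integral I) (ball y r)"
    using \<phi>i unfolding I_def absolutely_integrable_on_def by (simp add: integrable_integral)
  then have \<phi>I: "(\<phi> has_integral I) ?Q"
    by (rule has_integral_on_superset) (use \<phi>0 ball in auto)
  have "I \<noteq> 0"
  proof
    assume "I = 0"
    then have "\<phi> y = 0"
      using \<phi>I y \<open>y \<in> ?Q\<close> by (intro has_integral_0_cbox_imp_0[OF \<phi>]) (auto simp: \<phi>_def)
    then show False using r by (simp add: \<phi>_def)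
  qed
  define V where "V = (\<lambda>x. W x \<inter> k -` ball y r)"
  let ?f = "\<lambda>z. \<phi> (k z) * D z"
  have V: "(?f has_integral sgn (D x) * I) (V x)" if x: "x \<in> S" for x
  proof -
    have "k ` V x = ball y r"
    proof -
      have "ball y r \<subseteq> k ` W x" using r x by (auto simp: N_def)
      then show ?thesis unfolding V_def by auto
    qed
    moreover have "open (V x)"
      unfolding V_def using contk Wopen[OF x] by (intro continuous_open_preimage) auto
    moreover have "inj_on k (V x)"
      using U(3)[OF x] by (rule inj_on_subset) (auto simp: V_def W_def)
    ultimately have "((\<lambda>z. \<bar>D z\<bar> * \<phi> (k z)) has_integral I) (V x)"
      unfolding D_def I_def using integral_change_of_variables_real[of "V x" k k' \<phi>]
        cont_derivD(1)[OF k] \<phi>i by simp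
    then have "((\<lambda>z. sgn (D x) * (\<bar>D z\<bar> * \<phi> (k z))) has_integral sgn (D x) * I) (V x)"
      by (rule has_integral_mult_right)
    moreover have "sgn (D x) * (\<bar>D z\<bar> * \<phi> (k z)) = ?f z" if "z \<in> V x" for z
    proof -
      have "sgn (D x) = sgn (D z)" using U(5)[OF x, of z] that by (simp add: V_def W_def)
      then show ?thesis by (simp add: sgn_mult_abs mult.assoc[symmetric])
    qed
    ultimately show ?thesis by (rule has_integral_eq[rotated])
  qed
  have "(?f has_integral (\<Sum>x\<in>S. sgn (D x) * I)) (\<Union>(V ` S))"
  proof (rule has_integral_UN[OF fin V])
    show "pairwise (\<lambda>i i'. negligible (V i \<inter> V i')) S"
      unfolding pairwise_def
    proof (intro ballI impI)
      fix x z assume "x \<in> S" "z \<in> S" "x \<noteq> z"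
      then have "V x \<inter> V z = {}" using Wdisj[of x z] by (auto simp: V_def)
      then show "negligible (V x \<inter> V z)" by simp
    qed
  qed auto
  then have "(?f has_integral (\<Sum>x\<in>S. sgn (D x) * I)) ?Q"
  proof (rule has_integral_on_superset)
    show "?f z = 0" if z: "z \<notin> \<Union>(V ` S)" for z
    proof (cases "k z \<in> ball y r")
      case True
      then have "k z \<in> N" using r by blast
      then have "z \<in> ?Q" "z \<notin> ?Q - (\<Union>x\<in>S. W x)"
        using kQ box_subset_cbox unfolding N_def by blast+
      with True z show ?thesis by (auto simp: V_def)
    qed (simp add: \<phi>0)
    show "\<Union>(V ` S) \<subseteq> ?Q" using kQ ball by (auto simp: V_def)
  qed
  moreover have "integral ?Q ?f = integral ?Q \<phi>"
    unfolding D_def k_def k'_def by (rule integral_pullback_eq[OF q q0 \<phi>])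
  ultimately have "(\<Sum>x\<in>S. sgn (D x) * I) = I"
    using \<phi>I by (simp add: integral_unique)
  then have "(\<Sum>x\<in>S. sgn (D x)) = 1"
    using \<open>I \<noteq> 0\<close> by (simp add: sum_distrib_right[symmetric])
  then show "finite {x. x + q x = y}"
    "(\<Sum>x | x + q x = y. sgn (det (matrix (\<lambda>v. v + q' x v)))) = 1"
    using fin by (simp_all add: S_def D_def k_def k'_def)
qed

section \<open>Fibres of bounded perturbations of the identity\<close>

lemma DERIV_square_pos_part: "((\<lambda>u. (max 0 u)\<^sup>2) has_real_derivative 2 * max 0 u) (at u)"
proof -
  consider "u < 0" | "u > 0" | "u = 0" by linarith
  then show ?thesis
  proof cases
    case 1
    have "((\<lambda>u. 0) has_real_derivative 0) (at u)" by simp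
    then have "((\<lambda>u. (max 0 u)\<^sup>2) has_real_derivative 0) (at u)"
      by (rule has_field_derivative_transform_within_open[where S = "{..<0}"]) (use 1 in auto)
    then show ?thesis using 1 by simp
  next
    case 2
    have "((\<lambda>u. u\<^sup>2) has_real_derivative 2 * u) (at u)" by (auto intro!: derivative_eq_intros)
    then have "((\<lambda>u. (max 0 u)\<^sup>2) has_real_derivative 2 * u) (at u)"
      by (rule has_field_derivative_transform_within_open[where S = "{0<..}"]) (use 2 in auto)
    then show ?thesis using 2 by simp
  next
    case 3
    have "((\<lambda>h. ((max 0 (0 + h))\<^sup>2 - (max 0 (0::real))\<^sup>2) / h) \<longlongrightarrow> 0) (at 0)"
    proof (rule Lim_null_comparison)
      have "norm (((max 0 (0 + h))\<^sup>2 - (max 0 (0::real))\<^sup>2) / h) \<le> \<bar>h\<bar>" for h :: real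
        by (cases "h > 0") (auto simp: power2_eq_square max_def)
      then show "\<forall>\<^sub>F h in at 0. norm (((max 0 (0 + h))\<^sup>2 - (max 0 (0::real))\<^sup>2) / h) \<le> \<bar>h\<bar>"
        by simp
      show "((\<lambda>h::real. \<bar>h\<bar>) \<longlongrightarrow> 0) (at 0)" using tendsto_rabs_zero[OF tendsto_ident_at] by simp
    qed
    then show ?thesis using 3 by (simp add: DERIV_def)
  qed
qed

text \<open>The square of the positive part, \<open>\<sigma>\<close>, is continuously differentiable, and of \<open>\<sigma> (b - s)\<close> and
\<open>\<sigma> (s - a)\<close> at least one is positive when \<open>a < b\<close>. So the quotient of the first by the sum of both
is a cutoff in \<open>s = x \<bullet> x\<close> between \<open>a = r\<^sup>2\<close> and \<open>b = (r + 1)\<^sup>2\<close>.\<close>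

lemma cutoff_function:
  fixes r :: real
  assumes "r > 0"
  obtains \<eta> :: "'a::real_inner \<Rightarrow> real" and \<eta>' where "cont_deriv \<eta> \<eta>'"
    "\<And>x. norm x \<le> r \<Longrightarrow> \<eta> x = 1" "\<And>x. norm x \<ge> r + 1 \<Longrightarrow> \<eta> x = 0" "\<And>x. 0 \<le> \<eta> x \<and> \<eta> x \<le> 1"
proof -
  define a b where "a = r\<^sup>2" and "b = (r + 1)\<^sup>2"
  have ab: "a < b" using assms by (simp add: a_def b_def power2_eq_square algebra_simps)
  define n m where "n = (\<lambda>s. (max 0 (b - s))\<^sup>2)" and "m = (\<lambda>s. (max 0 (b - s))\<^sup>2 + (max 0 (s - a))\<^sup>2)"
  define n' m' where "n' = (\<lambda>s. - 2 * max 0 (b - s))"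
    and "m' = (\<lambda>s. - 2 * max 0 (b - s) + 2 * max 0 (s - a))"
  have m: "m s > 0" for s
  proof (cases "s < b")
    case True
    then show ?thesis by (auto simp: m_def intro!: add_pos_nonneg)
  next
    case False
    then show ?thesis using ab by (auto simp: m_def intro!: add_nonneg_pos)
  qed
  have dl: "((\<lambda>s. (max 0 (b - s))\<^sup>2) has_real_derivative n' s) (at s)" for s
  proof -
    have "((\<lambda>s. b - s) has_real_derivative - 1) (at s)" by (auto intro!: derivative_eq_intros)
    from DERIV_chain2[OF DERIV_square_pos_part this] show ?thesis by (simp add: n'_def)
  qed
  have dr: "((\<lambda>s. (max 0 (s - a))\<^sup>2) has_real_derivative 2 * max 0 (s - a)) (at s)" for s
  proof -
    have "((\<lambda>s. s - a) has_real_derivative 1) (at s)" by (auto intro!: derivative_eq_intros)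
    from DERIV_chain2[OF DERIV_square_pos_part this] show ?thesis by simp
  qed
  have dn: "(n has_real_derivative n' s) (at s)" for s
    unfolding n_def by (rule dl)
  have dm: "(m has_real_derivative m' s) (at s)" for s
    using DERIV_add[OF dl dr] unfolding m_def m'_def n'_def by simp
  define \<rho>' where "\<rho>' = (\<lambda>s. (n' s * m s - n s * m' s) / (m s * m s))"
  have d\<rho>: "((\<lambda>s. n s / m s) has_real_derivative \<rho>' s) (at s)" for s
    unfolding \<rho>'_def using m[of s] dn dm by (auto intro!: derivative_eq_intros)
  have c\<rho>: "continuous_on T \<rho>'" for T
  proof -
    have "continuous_on T n'" "continuous_on T m'" "continuous_on T n" "continuous_on T m"
      unfolding n'_def m'_def n_def m_def by (intro continuous_intros)+
    then show ?thesis unfolding \<rho>'_def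
      using m by (intro continuous_intros) (auto simp: less_imp_neq[symmetric])
  qed
  show ?thesis
  proof (rule that[of "\<lambda>x. n (x \<bullet> x) / m (x \<bullet> x)" "\<lambda>x v. \<rho>' (x \<bullet> x) * (2 * (x \<bullet> v))"])
    show "cont_deriv (\<lambda>x::'a. n (x \<bullet> x) / m (x \<bullet> x)) (\<lambda>x v. \<rho>' (x \<bullet> x) * (2 * (x \<bullet> v)))"
      unfolding cont_deriv_def
    proof (intro conjI allI)
      fix x :: 'a
      have "((\<lambda>x. x \<bullet> x) has_derivative (\<lambda>v. 2 * (x \<bullet> v))) (at x)"
        by (auto intro!: derivative_eq_intros simp: inner_commute)
      moreover have "((\<lambda>s. n s / m s) has_derivative (*) (\<rho>' (x \<bullet> x))) (at (x \<bullet> x))"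
        using d\<rho> by (simp add: has_field_derivative_def)
      ultimately show "((\<lambda>x. n (x \<bullet> x) / m (x \<bullet> x)) has_derivative (\<lambda>v. \<rho>' (x \<bullet> x) * (2 * (x \<bullet> v)))) (at x)"
        using has_derivative_compose by fastforce
    next
      fix v :: 'a
      show "continuous_on UNIV (\<lambda>x. \<rho>' (x \<bullet> x) * (2 * (x \<bullet> v)))"
        by (intro continuous_intros continuous_on_compose2[OF c\<rho>[of UNIV]]) auto
    qed
    show "n (x \<bullet> x) / m (x \<bullet> x) = 1" if "norm x \<le> r" for x :: 'a
    proof -
      have "x \<bullet> x \<le> a" using that by (simp add: a_def power2_norm_eq_inner[symmetric] power_mono)
      then show ?thesis using m[of "x \<bullet> x"] by (auto simp: n_def m_def)
    qed
    show "n (x \<bullet> x) / m (x \<bullet> x) = 0" if "norm x \<ge> r + 1" for x :: 'a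
    proof -
      have "x \<bullet> x \<ge> b" using that assms by (simp add: b_def power2_norm_eq_inner[symmetric] power_mono)
      then show ?thesis by (auto simp: n_def)
    qed
    show "0 \<le> n (x \<bullet> x) / m (x \<bullet> x) \<and> n (x \<bullet> x) / m (x \<bullet> x) \<le> 1" for x :: 'a
      using m[of "x \<bullet> x"] by (auto simp: n_def m_def)
  qed
qed

lemma even_card_involution:
  assumes "finite S" and "\<And>x. x \<in> S \<Longrightarrow> f x \<in> S \<and> f (f x) = x \<and> f x \<noteq> x"
  shows "even (card S)"
  using assms
proof (induction "card S" arbitrary: S rule: less_induct)
  case less
  show ?case
  proof (cases "S = {}")
    case False
    then obtain x where x: "x \<in> S" by blast
    let ?S = "S - {x, f x}"
    have xf: "{x, f x} \<subseteq> S" "card {x, f x} = 2" using less.prems(2)[OF x] x by auto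
    then have c: "card S = card ?S + 2"
      using card_Diff_subset[of "{x, f x}" S] card_mono[OF less.prems(1) xf(1)] by simp
    have "f z \<in> ?S \<and> f (f z) = z \<and> f z \<noteq> z" if "z \<in> ?S" for z
      using less.prems(2)[OF x] less.prems(2)[of z] that by auto
    then have "even (card ?S)" using less.hyps[of ?S] less.prems(1) c by auto
    then show ?thesis using c by simp
  qed simp
qed

text \<open>Cutting off the displacement far away from \<open>y\<close> changes neither the fibre over \<open>y\<close> nor the
derivative along it, and makes the perturbation compactly supported. A sum of signs equal to one
has an odd number of terms.\<close>

lemma odd_card_regular_fibre:
  fixes h :: "real^'m::{finite,wellorder} \<Rightarrow> real^'m::_"
  assumes h: "cont_deriv h h'" and bdd: "\<And>x. norm (h x - x) \<le> M"
    and reg: "\<And>x. h x = y \<Longrightarrow> det (matrix (h' x)) \<noteq> 0"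
  shows "finite {x. h x = y}" "odd (card {x. h x = y})"
proof -
  define r where "r = norm y + M + 1"
  have "M \<ge> 0" using bdd[of 0] norm_ge_zero order_trans by blast
  then have r: "r > 0" "norm y + M < r" by (auto simp: r_def add_nonneg_pos)
  obtain \<eta> :: "real^'m::_ \<Rightarrow> real" and \<eta>' where \<eta>: "cont_deriv \<eta> \<eta>'"
    "\<And>x. norm x \<le> r \<Longrightarrow> \<eta> x = 1"
    "\<And>x. norm x \<ge> r + 1 \<Longrightarrow> \<eta> x = 0" "\<And>x. 0 \<le> \<eta> x \<and> \<eta> x \<le> 1"
    using cutoff_function[OF r(1)] by blast
  define q where "q = (\<lambda>x. \<eta> x *\<^sub>R (h x - x))"
  define q' where "q' = (\<lambda>x v. \<eta> x *\<^sub>R (h' x v - v) + \<eta>' x v *\<^sub>R (h x - x))"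
  have q: "cont_deriv q q'"
    using h \<eta>(1) cont_derivD(4)[OF h] cont_derivD(4)[OF \<eta>(1)]
    unfolding cont_deriv_def q_def q'_def by (auto intro!: derivative_intros continuous_intros)
  let ?b = "\<chi> i. r + 1 :: real^'m::_"
  have "x \<in> cbox (- ?b) ?b" if "norm x \<le> r + 1" for x
    using that component_le_norm_cart[of x] by (simp add: mem_box_cart) (smt (verit))
  then have q0: "q x = 0" if "x \<notin> cbox (- ?b) ?b" for x
    using that \<eta>(3)[of x] by (cases "norm x \<le> r + 1") (auto simp: q_def)
  have y: "y \<in> box (- ?b) ?b"
    using component_le_norm_cart[of y] r \<open>M \<ge> 0\<close> by (simp add: mem_box_cart) (smt (verit))
  have near: "norm x < r" if "x + q x = y" for x
  proof -
    have "norm (q x) \<le> 1 * M" unfolding q_def norm_scaleR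
      using \<eta>(4)[of x] bdd[of x] by (intro mult_mono) auto
    moreover have "norm x \<le> norm y + norm (q x)"
      using that norm_triangle_ineq4[of y "q x"] by (metis add_diff_cancel)
    ultimately show ?thesis using r by simp
  qed
  have near': "norm x < r" if "h x = y" for x
    using bdd[of x] that r norm_triangle_ineq2[of x y] by (simp add: norm_minus_commute)
  have same: "x + q x = h x" if "norm x < r" for x using \<eta>(2)[of x] that by (simp add: q_def)
  then have fibre: "{x. x + q x = y} = {x. h x = y}" using near near' by metis
  have D: "(\<lambda>v. v + q' x v) = h' x" if x: "norm x < r" for x
  proof -
    have "((\<lambda>x. x + q x) has_derivative (\<lambda>v. v + q' x v)) (at x)"
      by (intro derivative_intros cont_derivD(1)[OF q])
    then have "(h has_derivative (\<lambda>v. v + q' x v)) (at x)"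
      by (rule has_derivative_transform_within_open[OF _ open_ball[of 0 r]]) (use x same in auto)
    then show ?thesis using cont_derivD(1)[OF h] has_derivative_unique by blast
  qed
  have reg': "det (matrix (\<lambda>v. v + q' x v)) \<noteq> 0" if "x + q x = y" for x
    using D[OF near[OF that]] reg[of x] that same[OF near[OF that]] by simp
  note one = sum_sgn_fibre_eq_one[OF q q0 y reg']
  show fin: "finite {x. h x = y}" using one(1) fibre by simp
  define s :: "real^'m::_ \<Rightarrow> int" where "s = (\<lambda>x. if det (matrix (h' x)) > 0 then 1 else - 1)"
  have "(\<Sum>x | h x = y. sgn (det (matrix (h' x)))) = (\<Sum>x | h x = y. real_of_int (s x))"
    using reg by (intro sum.cong) (auto simp: s_def sgn_if)
  moreover have "(\<Sum>x | h x = y. sgn (det (matrix (h' x)))) = 1"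
  proof -
    have "(\<Sum>x | h x = y. sgn (det (matrix (h' x)))) =
        (\<Sum>x | x + q x = y. sgn (det (matrix (\<lambda>v. v + q' x v))))"
      using D near' by (intro sum.cong) (auto simp: fibre)
    then show ?thesis using one(2) by simp
  qed
  ultimately have "real_of_int (\<Sum>x | h x = y. s x) = 1" by simp
  then have "odd (\<Sum>x | h x = y. s x)" by (metis of_int_eq_1_iff odd_one)
  then have "odd (card {x \<in> {x. h x = y}. odd (s x)})"
    using even_sum_iff[OF fin, of s] by simp
  moreover have "{x \<in> {x. h x = y}. odd (s x)} = {x. h x = y}" by (auto simp: s_def)
  ultimately show "odd (card {x. h x = y})" by simp
qed

section \<open>Involutions with bounded displacement\<close>

text \<open>The average \<open>h\<close> of the identity and \<open>F\<close> is invariant under \<open>F\<close>. If a regular value \<open>y\<close> is not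
fixed by \<open>F\<close>, then \<open>F\<close> acts on the fibre over \<open>y\<close> without fixed points, since \<open>h\<close> fixes the fixed
points of \<open>F\<close>; so the fibre would have even cardinality.\<close>

lemma bounded_involution_eq_id_wellorder:
  fixes F :: "real^'m::{finite,wellorder} \<Rightarrow> real^'m::_"
  assumes F: "cont_deriv F F'" and bdd: "\<And>x. norm (F x - x) \<le> M" and inv: "\<And>x. F (F x) = x"
  shows "F x = x"
proof (rule ccontr)
  assume "F x \<noteq> x"
  define h where "h = (\<lambda>x. (1/2) *\<^sub>R (x + F x))"
  define h' where "h' = (\<lambda>x v. (1/2) *\<^sub>R (v + F' x v))"
  have h: "cont_deriv h h'"
    using F unfolding cont_deriv_def h_def h'_def
    by (auto intro!: derivative_intros continuous_intros)
  have bh: "norm (h z - z) \<le> M" for z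
  proof -
    have "h z - z = (1/2) *\<^sub>R (F z - z)"
      by (simp add: h_def vec_eq_iff field_simps)
    then show ?thesis using bdd[of z] norm_ge_zero[of "F z - z"] by (simp del: norm_ge_zero)
  qed
  have hF: "h (F z) = h z" for z by (simp add: h_def inv add.commute)
  define C where "C = {z. det (matrix (h' z)) = 0}"
  have "negligible (h ` C)"
  proof (rule baby_Sard)
    show "(h has_derivative h' z) (at z within C)" for z by (rule cont_derivD(1)[OF h])
    show "rank (matrix (h' z)) < CARD('m)" if "z \<in> C" for z
      using that by (simp add: C_def det_eq_0_rank)
  qed simp
  moreover have "open {z. F z \<noteq> z}"
    by (intro open_Collect_neq cont_derivD(4)[OF F] continuous_intros)
  ultimately have "\<not> {z. F z \<noteq> z} \<subseteq> h ` C"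
    using \<open>F x \<noteq> x\<close> open_not_negligible negligible_subset by blast
  then obtain y where y: "F y \<noteq> y" "y \<notin> h ` C" by blast
  then have "det (matrix (h' z)) \<noteq> 0" if "h z = y" for z using that by (auto simp: C_def)
  note odd_card_regular_fibre[OF h bh this]
  moreover have "even (card {z. h z = y})"
  proof (rule even_card_involution[where f = F])
    fix z assume z: "z \<in> {z. h z = y}"
    have "F z \<noteq> z"
    proof
      assume "F z = z"
      then have "h z = z" unfolding h_def by (simp only: scaleR_half_double)
      with z y \<open>F z = z\<close> show False by simp
    qed
    with z show "F z \<in> {z. h z = y} \<and> F (F z) = z \<and> F z \<noteq> z" by (simp add: hF inv)
  qed (use calculation in auto)
  ultimately show False by blast
qed

text \<open>The change of variables formula asks for a well-ordered index type. This is a copy of the index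
type \<open>'d\<close> by an initial segment of the natural numbers, to which the result is transported.\<close>

typedef (overloaded) 'd::finite idx = "{..<CARD('d)}"
  by (rule exI[of _ 0]) simp

instantiation idx :: (finite) linorder
begin
definition "i \<le> j \<longleftrightarrow> Rep_idx i \<le> Rep_idx j"
definition "i < j \<longleftrightarrow> Rep_idx i < Rep_idx j"
instance by standard (auto simp: less_eq_idx_def less_idx_def Rep_idx_inject)
end

lemma bij_Rep_idx: "bij_betw Rep_idx (UNIV :: 'd::finite idx set) {..<CARD('d)}"
  by (intro bij_betwI[where g = Abs_idx]) (use Rep_idx Rep_idx_inverse Abs_idx_inverse in auto)

instance idx :: (finite) finite
proof
  show "finite (UNIV :: 'a idx set)" using bij_betw_finite[OF bij_Rep_idx] by auto
qed

instance idx :: (finite) wellorder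
proof
  fix P :: "'a idx \<Rightarrow> bool" and i
  assume step: "\<And>i. (\<And>j. j < i \<Longrightarrow> P j) \<Longrightarrow> P i"
  show "P i"
    by (induction i rule: measure_induct_rule[of Rep_idx]) (auto intro: step simp: less_idx_def)
qed

theorem bounded_involution_eq_id:
  fixes F :: "real^'d \<Rightarrow> real^'d"
  assumes F: "cont_deriv F F'" and bdd: "\<And>x. norm (F x - x) \<le> M" and inv: "\<And>x. F (F x) = x"
  shows "F x = x"
proof -
  have "card (UNIV :: 'd idx set) = CARD('d)"
    using bij_betw_same_card[OF bij_Rep_idx] by simp
  then obtain \<pi> :: "'d idx \<Rightarrow> 'd" where \<pi>: "bij \<pi>"
    using finite_same_card_bij[of "UNIV :: 'd idx set" "UNIV :: 'd set"] by auto
  define T :: "real^'d \<Rightarrow> real^('d idx)" where "T = (\<lambda>x. \<chi> i. x $ \<pi> i)"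
  define R :: "real^('d idx) \<Rightarrow> real^'d" where "R = (\<lambda>x. \<chi> i. x $ inv_into UNIV \<pi> i)"
  have TR: "T (R x) = x" "R (T z) = z" for x z
    using \<pi> by (simp_all add: T_def R_def vec_eq_iff bij_is_inj inv_f_f bij_is_surj surj_f_inv_f)
  have lin: "linear T" "linear R" by (auto simp: T_def R_def linear_iff vec_eq_iff)
  then have bl: "bounded_linear T" "bounded_linear R" by (simp_all add: linear_conv_bounded_linear)
  define G where "G = (\<lambda>x. T (F (R x)))"
  define G' where "G' = (\<lambda>x v. T (F' (R x) (R v)))"
  have G: "cont_deriv G G'"
    unfolding cont_deriv_def
  proof (intro conjI allI)
    fix x
    have "((\<lambda>x. F (R x)) has_derivative (\<lambda>v. F' (R x) (R v))) (at x)"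
      using has_derivative_compose[OF bounded_linear_imp_has_derivative[OF bl(2)] cont_derivD(1)[OF F]] .
    then show "(G has_derivative G' x) (at x)"
      unfolding G_def G'_def by (rule bounded_linear.has_derivative[OF bl(1)])
  next
    fix v
    have "continuous_on UNIV (\<lambda>x. F' (R x) (R v))"
      using continuous_on_compose2[OF cont_derivD(2)[OF F, of UNIV]]
        linear_continuous_on[OF bl(2)] by auto
    then show "continuous_on UNIV (\<lambda>x. G' x v)"
      unfolding G'_def by (rule bounded_linear.continuous_on[OF bl(1)])
  qed
  obtain K where K: "K > 0" "\<And>x. norm (T x) \<le> norm x * K"
    using bounded_linear.pos_bounded[OF bl(1)] by blast
  have bG: "norm (G x - x) \<le> M * K" for x
  proof -
    have "G x - x = T (F (R x) - R x)" by (simp add: G_def linear_diff[OF lin(1)] TR)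
    then have "norm (G x - x) \<le> norm (F (R x) - R x) * K" using K(2) by simp
    also have "\<dots> \<le> M * K" using bdd K(1) by (intro mult_right_mono) auto
    finally show ?thesis .
  qed
  have "G (G x) = x" for x by (simp add: G_def TR inv)
  from bounded_involution_eq_id_wellorder[OF G bG this, of "T x"]
  have "R (T (F x)) = R (T x)" by (simp add: G_def TR)
  then show ?thesis by (simp add: TR)
qed

lemma continuous_on_linear_family:
  fixes L :: "'x::topological_space \<Rightarrow> 'a::euclidean_space \<Rightarrow> 'b::real_normed_vector"
  assumes "\<And>x. x \<in> S \<Longrightarrow> linear (L x)" "\<And>b. continuous_on S (\<lambda>x. L x b)" "continuous_on S w"
  shows "continuous_on S (\<lambda>x. L x (w x))"
proof -
  have "L x (w x) = (\<Sum>b\<in>Basis. (w x \<bullet> b) *\<^sub>R L x b)" if "x \<in> S" for x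
  proof -
    have "L x (w x) = L x (\<Sum>b\<in>Basis. (w x \<bullet> b) *\<^sub>R b)" by (simp only: euclidean_representation)
    also have "\<dots> = (\<Sum>b\<in>Basis. (w x \<bullet> b) *\<^sub>R L x b)"
      using assms(1)[OF that] by (simp only: linear_sum linear_scale)
    finally show ?thesis .
  qed
  moreover have "continuous_on S (\<lambda>x. \<Sum>b\<in>Basis. (w x \<bullet> b) *\<^sub>R L x b)"
    by (intro continuous_intros assms)
  ultimately show ?thesis by (simp cong: continuous_on_cong)
qed

lemma cont_deriv_compose:
  fixes f :: "'b::euclidean_space \<Rightarrow> 'c::real_normed_vector" and g :: "'a::real_normed_vector \<Rightarrow> 'b"
  assumes f: "cont_deriv f f'" and g: "cont_deriv g g'"
  shows "cont_deriv (\<lambda>x. f (g x)) (\<lambda>x v. f' (g x) (g' x v))"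
  unfolding cont_deriv_def
proof (intro conjI allI)
  show "((\<lambda>x. f (g x)) has_derivative (\<lambda>v. f' (g x) (g' x v))) (at x)" for x
    by (rule has_derivative_compose[OF cont_derivD(1)[OF g] cont_derivD(1)[OF f]])
  show "continuous_on UNIV (\<lambda>x. f' (g x) (g' x v))" for v
  proof (rule continuous_on_linear_family[where L = "\<lambda>x. f' (g x)"])
    show "continuous_on UNIV (\<lambda>x. f' (g x) b)" for b
      by (rule continuous_on_compose2[OF cont_derivD(2)[OF f, of UNIV] cont_derivD(4)[OF g]]) simp
  qed (simp_all add: cont_derivD(3)[OF f] cont_derivD(2)[OF g])
qed

section \<open>The universal covering of the torus\<close>

definition torus_cover :: "real^'d \<Rightarrow> complex^'d" where
  "torus_cover x = (\<chi> j. cis (2 * pi * x $ j))"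

text \<open>The kernel of the covering, that is, the group of deck translations.\<close>

definition int_lattice :: "(real^'d) set" where
  "int_lattice = {k. \<forall>j. k $ j \<in> \<int>}"

lemma lattice_closed:
  "0 \<in> int_lattice" "k \<in> int_lattice \<Longrightarrow> l \<in> int_lattice \<Longrightarrow> k + l \<in> int_lattice"
  "k \<in> int_lattice \<Longrightarrow> l \<in> int_lattice \<Longrightarrow> k - l \<in> int_lattice" "axis j 1 \<in> int_lattice"
  by (auto simp: int_lattice_def axis_def)

lemma cis_2pi_eq_iff: "cis (2 * pi * x) = cis (2 * pi * y) \<longleftrightarrow> x - y \<in> \<int>"
proof -
  have "cis (2 * pi * x) = cis (2 * pi * y) \<longleftrightarrow> cis (2 * pi * (x - y)) = 1"
    by (simp add: right_diff_distrib flip: cis_divide)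
  also have "\<dots> \<longleftrightarrow> (\<exists>n::int. 2 * pi * (x - y) = of_int n * (2 * pi))"
    using cos_one_2pi_int[of "2 * pi * (x - y)"]
    by (auto simp: complex_eq_iff cos_one_sin_zero mult_ac)
  also have "\<dots> \<longleftrightarrow> x - y \<in> \<int>"
    by (auto simp: Ints_def mult.commute)
  finally show ?thesis .
qed

lemma torus_cover_eq_iff: "torus_cover x = torus_cover y \<longleftrightarrow> x - y \<in> int_lattice"
  by (simp add: torus_cover_def int_lattice_def vec_eq_iff cis_2pi_eq_iff)

lemma torus_cover_add: "k \<in> int_lattice \<Longrightarrow> torus_cover (x + k) = torus_cover x"
  by (simp add: torus_cover_eq_iff)

lemma range_torus_cover: "range torus_cover = (torus :: (complex^'d) set)"
proof (intro equalityI subsetI)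
  fix z :: "complex^'d" assume "z \<in> torus"
  then have "norm (z $ j) = 1" for j by (simp add: torus_def)
  then have "z $ j = cis (Arg (z $ j))" for j using rcis_cmod_Arg[of "z $ j"] by (simp add: rcis_def)
  then have "z = torus_cover (\<chi> j. Arg (z $ j) / (2 * pi))" by (simp add: torus_cover_def vec_eq_iff)
  then show "z \<in> range torus_cover" by blast
qed (auto simp: torus_def torus_cover_def)

lemma torus_cover_in_torus: "torus_cover x \<in> torus"
  using range_torus_cover by blast

definition torus_cover' :: "real^'d \<Rightarrow> real^'d \<Rightarrow> complex^'d" where
  "torus_cover' x v = (\<chi> j. (\<i> * cis (2 * pi * x $ j)) * of_real (2 * pi * v $ j))"

lemma has_derivative_vec_lambda:
  fixes f :: "'n::finite \<Rightarrow> 'a::real_normed_vector \<Rightarrow> 'b::euclidean_space"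
  assumes "\<And>j. (f j has_derivative f' j) F"
  shows "((\<lambda>x. \<chi> j. f j x) has_derivative (\<lambda>v. \<chi> j. f' j v)) F"
proof -
  have lin: "bounded_linear (axis j :: 'b \<Rightarrow> 'b^'n)" for j
    unfolding linear_conv_bounded_linear[symmetric] by (auto simp: linear_iff axis_def vec_eq_iff)
  have eq: "(\<chi> j. h j) = (\<Sum>j\<in>UNIV. axis j (h j))" for h :: "'n \<Rightarrow> 'b"
    by (simp add: vec_eq_iff axis_def)
  have "((\<lambda>x. \<Sum>j\<in>UNIV. axis j (f j x)) has_derivative (\<lambda>v. \<Sum>j\<in>UNIV. axis j (f' j v))) F"
    by (intro has_derivative_sum bounded_linear.has_derivative[OF lin] assms)
  then show ?thesis by (simp only: eq)
qed

lemma cont_deriv_torus_cover: "cont_deriv torus_cover torus_cover'"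
  unfolding cont_deriv_def
proof (intro conjI allI)
  fix x :: "real^'d"
  have "((\<lambda>x. cis (2 * pi * x $ j)) has_derivative
      (\<lambda>v. (\<i> * cis (2 * pi * x $ j)) * of_real (2 * pi * v $ j))) (at x)" for j
  proof -
    have "((\<lambda>t. cis t) has_vector_derivative \<i> * cis (2 * pi * x $ j)) (at (2 * pi * x $ j))"
      unfolding cis_conv_exp
      by (auto intro!: derivative_eq_intros has_vector_derivative_real_field simp: field_simps)
    then have "((\<lambda>t. cis t) has_derivative (\<lambda>h. h *\<^sub>R (\<i> * cis (2 * pi * x $ j)))) (at (2 * pi * x $ j))"
      by (simp add: has_vector_derivative_def)
    note dcis = this
    have lin: "((\<lambda>x. 2 * pi * x $ j) has_derivative (\<lambda>v. 2 * pi * v $ j)) (at x)"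
      by (intro has_derivative_mult_right bounded_linear_imp_has_derivative bounded_linear_vec_nth)
    have "(\<lambda>v :: real^'d. (2 * pi * v $ j) *\<^sub>R (\<i> * cis (2 * pi * x $ j))) =
        (\<lambda>v. (\<i> * cis (2 * pi * x $ j)) * of_real (2 * pi * v $ j))"
      by (simp add: scaleR_conv_of_real mult.commute)
    then show ?thesis using has_derivative_compose[OF lin dcis] by simp
  qed
  then show "(torus_cover has_derivative torus_cover' x) (at x)"
    unfolding torus_cover_def torus_cover'_def by (rule has_derivative_vec_lambda)
next
  show "continuous_on UNIV (\<lambda>x. torus_cover' x v)" for v :: "real^'d"
    unfolding torus_cover'_def by (intro continuous_intros)
qed

text \<open>Near each point the map is the restriction of a smooth map of an open set of the ambient space,
to which the chain rule applies.\<close>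

lemma smooth_map_on_torus_cont_deriv:
  fixes f :: "complex^'d \<Rightarrow> complex^'d"
  assumes "smooth_map_on torus f"
  obtains g' where "cont_deriv (\<lambda>x. f (torus_cover x)) g'"
proof -
  let ?g = "\<lambda>x. f (torus_cover x)"
  let ?g' = "\<lambda>x. frechet_derivative ?g (at x)"
  have loc: "(?g has_derivative ?g' x) (at x)" "isCont (\<lambda>x. ?g' x v) x" for x v
  proof -
    have "\<exists>U G. open U \<and> torus_cover x \<in> U \<and> (\<forall>k. higher_differentiable_on U G k) \<and>
        (\<forall>y\<in>torus \<inter> U. G y = f y)"
      using assms torus_cover_in_torus[of x] unfolding smooth_map_on_def by (rule bspec)
    then obtain U and G :: "complex^'d \<Rightarrow> complex^'d" where U: "open U" "torus_cover x \<in> U"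
      and "\<forall>k. higher_differentiable_on U G k" and eq: "\<And>y. y \<in> torus \<inter> U \<Longrightarrow> G y = f y" by metis
    then have G: "higher_differentiable_on U G (Suc 0)" by metis
    define V where "V = torus_cover -` U"
    have V: "open V" "x \<in> V"
      unfolding V_def
      using U open_vimage[OF U(1) cont_derivD(4)[OF cont_deriv_torus_cover]] by simp_all
    let ?G' = "\<lambda>y. frechet_derivative G (at y)"
    have dG: "(G has_derivative ?G' z) (at z)" if "z \<in> U" for z
      using G that by (simp flip: frechet_derivative_works)
    have d: "(?g has_derivative (\<lambda>v. ?G' (torus_cover y) (torus_cover' y v))) (at y)" if y: "y \<in> V" for y
    proof (rule has_derivative_transform_within_open[OF _ V(1) y])
      have "torus_cover y \<in> U" using y by (simp add: V_def)
      from has_derivative_compose[OF cont_derivD(1)[OF cont_deriv_torus_cover] dG[OF this]]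
      show "((\<lambda>y. G (torus_cover y)) has_derivative (\<lambda>v. ?G' (torus_cover y) (torus_cover' y v))) (at y)" .
      show "G (torus_cover z) = f (torus_cover z)" if "z \<in> V" for z
        using eq[of "torus_cover z"] that torus_cover_in_torus by (auto simp: V_def)
    qed
    then have g': "?g' y = (\<lambda>v. ?G' (torus_cover y) (torus_cover' y v))" if "y \<in> V" for y
      using frechet_derivative_at that by metis
    show "(?g has_derivative ?g' x) (at x)" using d[OF V(2)] g'[OF V(2)] by simp
    have "continuous_on V (\<lambda>y. ?G' (torus_cover y) (torus_cover' y v))"
    proof (rule continuous_on_linear_family[where L = "\<lambda>y. ?G' (torus_cover y)"])
      show "linear (?G' (torus_cover y))" if "y \<in> V" for y
        using has_derivative_linear[OF dG[of "torus_cover y"]] that by (simp add: V_def)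
      show "continuous_on V (\<lambda>y. ?G' (torus_cover y) b)" for b
        by (rule continuous_on_compose2[of U "\<lambda>z. ?G' z b"])
          (use G cont_derivD(4)[OF cont_deriv_torus_cover, of V] in \<open>auto simp: V_def\<close>)
      show "continuous_on V (\<lambda>y. torus_cover' y v)" by (rule cont_derivD(2)[OF cont_deriv_torus_cover])
    qed
    moreover have "?g' y v = ?G' (torus_cover y) (torus_cover' y v)" if "y \<in> V" for y
      unfolding g'[OF that] ..
    ultimately have "continuous_on V (\<lambda>y. ?g' y v)" using continuous_on_cong by (metis (mono_tags, lifting))
    then show "isCont (\<lambda>x. ?g' x v) x" using V continuous_on_eq_continuous_at by blast
  qed
  have "cont_deriv ?g ?g'"
    unfolding cont_deriv_def using loc by (auto simp: continuous_on_eq_continuous_at)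
  then show ?thesis by (rule that)
qed

text \<open>Near \<open>x\<close> the continuous logarithm is a constant plus the principal branch of \<open>g y / g x\<close>.\<close>

lemma continuous_logarithm_has_derivative:
  fixes g L :: "'a::real_normed_vector \<Rightarrow> complex"
  assumes g: "(g has_derivative g') (at x)" and L: "continuous_on UNIV L" and gL: "\<And>y. g y = exp (L y)"
  shows "(L has_derivative (\<lambda>v. g' v / g x)) (at x)"
proof -
  let ?V = "{y. norm (L y - L x) < 1}"
  have "open ?V" by (intro open_Collect_less continuous_intros L)
  have quot: "((\<lambda>y. g y / g x) has_derivative (\<lambda>v. g' v / g x)) (at x)"
    using bounded_linear.has_derivative[OF bounded_linear_divide g] .
  have "(Ln has_derivative (\<lambda>h. h)) (at (g x / g x))"
    using has_field_derivative_Ln[of 1] gL[of x] by (simp add: has_field_derivative_def lambda_one)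
  from has_derivative_compose[OF quot this]
  have "((\<lambda>y. L x + Ln (g y / g x)) has_derivative (\<lambda>v. 0 + g' v / g x)) (at x)"
    by (intro has_derivative_add has_derivative_const)
  then have "((\<lambda>y. L x + Ln (g y / g x)) has_derivative (\<lambda>v. g' v / g x)) (at x)" by simp
  then show ?thesis
  proof (rule has_derivative_transform_within_open[OF _ \<open>open ?V\<close>])
    fix y assume y: "y \<in> ?V"
    have "\<bar>Im (L y - L x)\<bar> < 1" using y abs_Im_le_cmod[of "L y - L x"] by simp
    then have "Ln (exp (L y - L x)) = L y - L x" using pi_gt3 by (intro Ln_exp) auto
    then show "L x + Ln (g y / g x) = L y" by (simp add: gL exp_diff)
  qed simp
qed

section \<open>Lifts of smooth maps of the torus\<close>

text \<open>Differentiability is part of the notion because the theorem on involutions is applied to composites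
of lifts.\<close>

definition is_lift :: "(real^'d \<Rightarrow> real^'d) \<Rightarrow> (complex^'d \<Rightarrow> complex^'d) \<Rightarrow> bool" where
  "is_lift F f \<longleftrightarrow> (\<exists>F'. cont_deriv F F') \<and> (\<forall>x. torus_cover (F x) = f (torus_cover x))"

text \<open>Each coordinate of \<open>f \<circ> torus_cover\<close> is a map from a contractible space to the unit circle and so
has a continuous logarithm, which is purely imaginary.\<close>

lemma lift_exists:
  fixes f :: "complex^'d \<Rightarrow> complex^'d"
  assumes "smooth_map_on torus f" "f ` torus \<subseteq> torus"
  shows "\<exists>F. is_lift F f"
proof -
  let ?g = "\<lambda>x. f (torus_cover x)"
  obtain g' where g: "cont_deriv ?g g'" using smooth_map_on_torus_cont_deriv[OF assms(1)] .
  have norm1: "norm (?g x $ j) = 1" for x j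
    using assms(2) torus_cover_in_torus[of x] by (auto simp: torus_def)
  have "\<exists>L. continuous_on UNIV L \<and> (\<forall>x. ?g x $ j = exp (L x))" for j
  proof -
    have "continuous_on UNIV (\<lambda>x. ?g x $ j)" by (intro continuous_intros cont_derivD(4)[OF g])
    moreover have "?g x $ j \<noteq> 0" for x using norm1[of x j] by auto
    ultimately show ?thesis
      using continuous_logarithm_on_contractible[of UNIV "\<lambda>x. ?g x $ j"] by (metis UNIV_I contractible_UNIV)
  qed
  then obtain L where L: "\<And>j. continuous_on UNIV (L j)" "\<And>j x. ?g x $ j = exp (L j x)" by metis
  define F where "F = (\<lambda>x. \<chi> j. Im (L j x) / (2 * pi))"
  define F' where "F' = (\<lambda>x v. \<chi> j. Im (g' x v $ j / ?g x $ j) / (2 * pi))"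
  have "cont_deriv F F'"
    unfolding cont_deriv_def
  proof (intro conjI allI)
    fix x
    have "(L j has_derivative (\<lambda>v. g' x v $ j / ?g x $ j)) (at x)" for j
      by (rule continuous_logarithm_has_derivative[OF _ L])
        (rule bounded_linear.has_derivative[OF bounded_linear_vec_nth cont_derivD(1)[OF g]])
    then have "((\<lambda>x. Im (L j x) / (2 * pi)) has_derivative (\<lambda>v. Im (g' x v $ j / ?g x $ j) / (2 * pi))) (at x)" for j
      by (intro bounded_linear.has_derivative[OF bounded_linear_divide]
          bounded_linear.has_derivative[OF bounded_linear_Im])
    then show "(F has_derivative F' x) (at x)"
      unfolding F_def F'_def by (rule has_derivative_vec_lambda)
  next
    fix v
    have "?g x $ j \<noteq> 0" for x j using norm1[of x j] by auto
    then show "continuous_on UNIV (\<lambda>x. F' x v)"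
      unfolding F'_def
      by (intro continuous_intros cont_derivD(2)[OF g] cont_derivD(4)[OF g]) auto
  qed
  moreover have "torus_cover (F x) = f (torus_cover x)" for x
  proof -
    have "cis (Im (L j x)) = ?g x $ j" for j
    proof -
      have "Re (L j x) = 0" using norm1[of x j] by (simp add: L(2))
      then have "L j x = \<i> * of_real (Im (L j x))" by (simp add: complex_eq_iff)
      then show ?thesis unfolding L(2) cis_conv_exp by metis
    qed
    then show ?thesis by (simp add: torus_cover_def F_def vec_eq_iff)
  qed
  ultimately show ?thesis unfolding is_lift_def by blast
qed

lemma is_liftD:
  assumes "is_lift F f"
  shows "continuous_on S F" "torus_cover (F x) = f (torus_cover x)"
  using assms cont_derivD(4) by (auto simp: is_lift_def)

lemma is_lift_compose:
  "is_lift F f \<Longrightarrow> is_lift G g \<Longrightarrow> is_lift (\<lambda>x. F (G x)) (\<lambda>z. f (g z))"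
  unfolding is_lift_def using cont_deriv_compose by metis

lemma is_lift_cong:
  "is_lift F f \<Longrightarrow> (\<And>z. z \<in> torus \<Longrightarrow> f z = g z) \<Longrightarrow> is_lift F g"
  unfolding is_lift_def using torus_cover_in_torus by metis

lemma is_lift_shift:
  assumes F: "is_lift F f" and ab: "a \<in> int_lattice" "b \<in> int_lattice"
  shows "is_lift (\<lambda>x. F (x + a) + b) f"
proof -
  obtain F' where F': "cont_deriv F F'" using F by (auto simp: is_lift_def)
  have "cont_deriv (\<lambda>x. F (x + a) + b) (\<lambda>x. F' (x + a))"
    unfolding cont_deriv_def
  proof (intro conjI allI)
    fix x
    have "((\<lambda>x. x + a) has_derivative (\<lambda>v. v)) (at x)" by (auto intro!: derivative_eq_intros)
    from has_derivative_compose[OF this cont_derivD(1)[OF F']]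
    show "((\<lambda>x. F (x + a) + b) has_derivative F' (x + a)) (at x)"
      by (simp add: has_derivative_add_const)
    show "continuous_on UNIV (\<lambda>x. F' (x + a) v)" for v
      by (rule continuous_on_compose2[OF cont_derivD(2)[OF F', of UNIV v]])
        (auto intro!: continuous_intros)
  qed
  then show ?thesis
    using is_liftD(2)[OF F] ab by (auto simp: is_lift_def torus_cover_add)
qed

text \<open>The difference of two lifts is continuous with integral coordinates.\<close>

lemma lift_unique:
  fixes F G :: "real^'d \<Rightarrow> real^'d"
  assumes "is_lift F f" "is_lift G f"
  obtains k where "k \<in> int_lattice" "\<And>x. F x = G x + k"
proof -
  have int: "F x - G x \<in> int_lattice" for x
    using is_liftD(2)[OF assms(1), of x] is_liftD(2)[OF assms(2), of x] torus_cover_eq_iff by metis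
  have "(\<lambda>x. (F x - G x) $ j) constant_on UNIV" for j
  proof (rule continuous_discrete_range_constant)
    show "continuous_on UNIV (\<lambda>x. (F x - G x) $ j)" 
      by (intro continuous_intros is_liftD(1)[OF assms(1)] is_liftD(1)[OF assms(2)])
    fix x
    have "1 \<le> norm ((F y - G y) $ j - (F x - G x) $ j)" if "(F y - G y) $ j \<noteq> (F x - G x) $ j" for y
    proof -
      have "(F y - G y) $ j - (F x - G x) $ j \<in> \<int>"
        using int[of x] int[of y] unfolding int_lattice_def by (intro Ints_diff) blast+
      then show ?thesis
        using that Ints_nonzero_abs_ge1[of "(F y - G y) $ j - (F x - G x) $ j"] by simp
    qed
    then show "\<exists>e>0. \<forall>y. y \<in> UNIV \<and> (F y - G y) $ j \<noteq> (F x - G x) $ j \<longrightarrow>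
        e \<le> norm ((F y - G y) $ j - (F x - G x) $ j)"
      by (intro exI[of _ 1]) auto
  qed (rule connected_UNIV)
  then have "\<exists>c. \<forall>x. (F x - G x) $ j = c" for j unfolding constant_on_def by simp
  then obtain c where c: "\<And>j x. (F x - G x) $ j = c j" by metis
  define k where "k = (\<chi> j. c j)"
  have k: "F x - G x = k" for x using c unfolding k_def by (simp add: vec_eq_iff)
  show ?thesis
  proof (rule that)
    show "k \<in> int_lattice" using int[of 0] k[of 0] by simp
    show "F x = G x + k" for x using k[of x] by (simp add: algebra_simps)
  qed
qed

section \<open>The action on the fundamental group of the torus\<close>

text \<open>The matrix of the map induced on the fundamental group.\<close>

definition lift_matrix :: "(real^'d \<Rightarrow> real^'d) \<Rightarrow> real^'d^'d" where
  "lift_matrix F = (\<chi> i j. (F (axis j 1) - F 0) $ i)"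

text \<open>An additive map on the integral vectors is determined by the standard basis.\<close>

lemma additive_lattice:
  fixes c :: "real^'d \<Rightarrow> real^'d"
  assumes add: "\<And>k l. k \<in> int_lattice \<Longrightarrow> l \<in> int_lattice \<Longrightarrow> c (k + l) = c k + c l" and k: "k \<in> int_lattice"
  shows "c k = (\<Sum>j\<in>UNIV. k $ j *\<^sub>R c (axis j 1))"
proof -
  have c0: "c 0 = 0" using add[of 0 0] lattice_closed(1) by simp
  have nat: "c (real n *\<^sub>R l) = real n *\<^sub>R c l \<and> real n *\<^sub>R l \<in> int_lattice" if l: "l \<in> int_lattice" for n l
  proof (induction n)
    case (Suc n)
    then show ?case using add[of l "real n *\<^sub>R l"] l lattice_closed(2)[OF l]
      by (simp add: scaleR_add_left)
  qed (simp add: c0 lattice_closed)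
  have neg: "c (- l) = - c l \<and> - l \<in> int_lattice" if l: "l \<in> int_lattice" for l
  proof -
    have m: "- l \<in> int_lattice" using lattice_closed(3)[OF lattice_closed(1) l] by simp
    have "c l + c (- l) = 0" using add[OF l m] c0 by simp
    then have "- c l = c (- l)" by (rule add.inverse_unique)
    with m show ?thesis by simp
  qed
  have int: "c (t *\<^sub>R l) = t *\<^sub>R c l \<and> t *\<^sub>R l \<in> int_lattice" if l: "l \<in> int_lattice" and t: "t \<in> \<int>" for t l
  proof -
    obtain z where z: "t = of_int z" using t by (auto elim: Ints_cases)
    show ?thesis
    proof (cases z rule: int_cases2)
      case (nonneg n)
      then show ?thesis using nat[OF l, of n] z by simp
    next
      case (nonpos n)
      then show ?thesis using nat[OF l, of n] neg[of "real n *\<^sub>R l"] z by simp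
    qed
  qed
  have ax: "c (k $ j *\<^sub>R axis j 1) = k $ j *\<^sub>R c (axis j 1)" "k $ j *\<^sub>R axis j 1 \<in> int_lattice" for j
    using int[OF lattice_closed(4), of "k $ j" j] k by (auto simp: int_lattice_def)
  have "c (\<Sum>j\<in>J. k $ j *\<^sub>R axis j 1) = (\<Sum>j\<in>J. k $ j *\<^sub>R c (axis j 1)) \<and>
      (\<Sum>j\<in>J. k $ j *\<^sub>R axis j 1) \<in> int_lattice" if "finite J" for J
    using that by induction (auto simp: c0 lattice_closed add ax)
  then have "c (\<Sum>j\<in>UNIV. k $ j *\<^sub>R axis j 1) = (\<Sum>j\<in>UNIV. k $ j *\<^sub>R c (axis j 1))" by simp
  moreover have "(\<Sum>j\<in>UNIV. k $ j *\<^sub>R axis j 1) = k"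
    using basis_expansion[of k] by (simp add: scalar_mult_eq_scaleR)
  ultimately show ?thesis by metis
qed

lemma lift_matrix:
  fixes F :: "real^'d \<Rightarrow> real^'d"
  assumes F: "is_lift F f" and k: "k \<in> int_lattice"
  shows "F (x + k) = F x + lift_matrix F *v k" "lift_matrix F *v k \<in> int_lattice"
proof -
  have "\<exists>c. c \<in> int_lattice \<and> (\<forall>x. F (x + l) = F x + c)" if l: "l \<in> int_lattice" for l
  proof -
    obtain c where "c \<in> int_lattice" "\<And>x. F (x + l) + 0 = F x + c"
      using lift_unique[OF is_lift_shift[OF F l lattice_closed(1)] F] by blast
    then show ?thesis by (intro exI[of _ c]) simp
  qed
  then obtain c where c: "\<And>k. k \<in> int_lattice \<Longrightarrow> c k \<in> int_lattice"
    "\<And>k x. k \<in> int_lattice \<Longrightarrow> F (x + k) = F x + c k" by metis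
  have "c (k + l) = c k + c l" if k: "k \<in> int_lattice" and l: "l \<in> int_lattice" for k l
  proof -
    have "F 0 + c (k + l) = F (0 + (k + l))" using c(2)[OF lattice_closed(2)[OF k l]] by metis
    also have "\<dots> = F ((0 + k) + l)" by (simp only: add.assoc)
    also have "\<dots> = F 0 + (c k + c l)" using c(2)[OF l, of "0 + k"] c(2)[OF k, of 0] by (simp only: add.assoc)
    finally show ?thesis by simp
  qed
  from additive_lattice[OF this k] have "c k = (\<Sum>j\<in>UNIV. k $ j *\<^sub>R c (axis j 1))" .
  also have "c (axis j 1) = F (axis j 1) - F 0" for j
    using c(2)[OF lattice_closed(4), of 0 j] by simp
  then have "(\<Sum>j\<in>UNIV. k $ j *\<^sub>R c (axis j 1)) = lift_matrix F *v k"
    by (simp add: lift_matrix_def vec_eq_iff matrix_vector_mult_def mult.commute)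
  finally have e: "c k = lift_matrix F *v k" .
  show "F (x + k) = F x + lift_matrix F *v k" using c(2)[OF k, of x] e by simp
  show "lift_matrix F *v k \<in> int_lattice" using c(1)[OF k] e by simp
qed

lemma lift_matrix_compose:
  assumes F: "is_lift F f" and G: "is_lift G g" and H: "is_lift H (\<lambda>z. f (g z))"
  shows "lift_matrix H = lift_matrix F ** lift_matrix G"
proof -
  obtain m where m: "\<And>x. H x = F (G x) + m"
    using lift_unique[OF H is_lift_compose[OF F G]] by blast
  have "lift_matrix H *v axis j 1 = (lift_matrix F ** lift_matrix G) *v axis j 1" for j
  proof -
    have "H (0 + axis j 1) = H 0 + lift_matrix H *v axis j 1"
      by (rule lift_matrix(1)[OF H lattice_closed(4)])
    moreover have "G (0 + axis j 1) = G 0 + lift_matrix G *v axis j 1"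
      by (rule lift_matrix(1)[OF G lattice_closed(4)])
    moreover have "F (G 0 + lift_matrix G *v axis j 1) =
        F (G 0) + lift_matrix F *v (lift_matrix G *v axis j 1)"
      by (rule lift_matrix(1)[OF F lift_matrix(2)[OF G lattice_closed(4)]])
    ultimately have "F (G 0) + m + lift_matrix H *v axis j 1 =
        F (G 0) + lift_matrix F *v (lift_matrix G *v axis j 1) + m" unfolding m by metis
    then show ?thesis by (simp add: matrix_vector_mul_assoc)
  qed
  then have "column j (lift_matrix H) = column j (lift_matrix F ** lift_matrix G)" for j
    by (simp only: matrix_vector_mult_basis)
  then show ?thesis by (simp add: column_def vec_eq_iff)
qed

lemma lift_matrix_id: "lift_matrix (\<lambda>x. x) = mat 1"
  by (simp add: lift_matrix_def mat_def vec_eq_iff axis_def)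

definition equivariant :: "(real^'d \<Rightarrow> real^'d) \<Rightarrow> bool" where
  "equivariant F \<longleftrightarrow> (\<forall>x. \<forall>k\<in>int_lattice. F (x + k) = F x + k)"

lemma equivariant_bounded_displacement:
  fixes F :: "real^'d \<Rightarrow> real^'d"
  assumes "continuous_on UNIV F" "equivariant F"
  obtains M where "\<And>x. norm (F x - x) \<le> M"
proof -
  let ?Q = "cbox 0 (\<chi> i. 1) :: (real^'d) set"
  have "compact ((\<lambda>x. F x - x) ` ?Q)"
    using assms(1) continuous_on_subset by (intro compact_continuous_image continuous_intros) auto
  then have "bounded ((\<lambda>x. F x - x) ` ?Q)" by (rule compact_imp_bounded)
  then obtain M where "\<forall>y\<in>(\<lambda>x. F x - x) ` ?Q. norm y \<le> M" unfolding bounded_iff by blast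
  then have M: "norm (F x - x) \<le> M" if "x \<in> ?Q" for x using that by blast
  have "norm (F x - x) \<le> M" for x
  proof -
    define k :: "real^'d" where "k = (\<chi> i. of_int \<lfloor>x $ i\<rfloor>)"
    have k: "k \<in> int_lattice" by (simp add: k_def int_lattice_def)
    have "0 \<le> (x - k) $ i \<and> (x - k) $ i \<le> 1" for i
      using floor_correct[of "x $ i", simplified]
      unfolding k_def vector_minus_component vec_lambda_beta by linarith
    then have "x - k \<in> ?Q" by (simp add: mem_box_cart)
    moreover have "F x = F (x - k) + k"
      using assms(2) k unfolding equivariant_def by (metis diff_add_cancel)
    then have "F x - x = F (x - k) - (x - k)" by simp
    ultimately show ?thesis using M by metis
  qed
  then show ?thesis by (rule that)
qed

section \<open>Actions on the torus\<close>

locale torus_action =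
  fixes \<Phi> :: "('n::finite word \<Rightarrow> 'n word) \<Rightarrow> (complex^'d \<Rightarrow> complex^'d)"
  assumes three_gens: "CARD('n) \<ge> 3" and hom: "\<Phi> \<in> hom SAut (Diff torus)"
    and dim_less: "CARD('d) < CARD('n)"
begin

lemma action_bij: "\<alpha> \<in> carrier SAut \<Longrightarrow> \<Phi> \<alpha> \<in> Bij torus"
  and action_smooth: "\<alpha> \<in> carrier SAut \<Longrightarrow> smooth_map_on torus (\<Phi> \<alpha>)"
  using hom by (auto simp: hom_def Diff_def)

lemma action_maps: "\<alpha> \<in> carrier SAut \<Longrightarrow> z \<in> torus \<Longrightarrow> \<Phi> \<alpha> z \<in> torus"
  using action_bij by (auto dest: Bij_imp_funcset)

lemma action_mult:
  "\<alpha> \<in> carrier SAut \<Longrightarrow> \<beta> \<in> carrier SAut \<Longrightarrow>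
    \<Phi> (\<alpha> \<cdot> \<beta>) = compose torus (\<Phi> \<alpha>) (\<Phi> \<beta>)"
  using hom action_bij[of \<alpha>] action_bij[of \<beta>] by (simp add: hom_mult Diff_def BijGroup_def)

sublocale A: SAut_hom \<Phi> "compose torus"
  by standard (use action_mult three_gens in auto)

lemma action_apply:
  "\<alpha> \<in> carrier SAut \<Longrightarrow> \<beta> \<in> carrier SAut \<Longrightarrow> z \<in> torus \<Longrightarrow>
    \<Phi> (\<alpha> \<cdot> \<beta>) z = \<Phi> \<alpha> (\<Phi> \<beta> z)"
  by (simp add: action_mult compose_def)

lemma action_one: "\<Phi> \<one>\<^bsub>SAut\<^esub> = (\<lambda>z\<in>torus. z)"
proof (rule extensionalityI)
  show "\<Phi> \<one>\<^bsub>SAut\<^esub> \<in> extensional torus" using action_bij[OF A.G.one_closed] by (rule Bij_imp_extensional)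
  show "(\<lambda>z\<in>torus. z) \<in> extensional torus" by simp
  fix z :: "complex^'d" assume z: "z \<in> torus"
  have "bij_betw (\<Phi> \<one>\<^bsub>SAut\<^esub>) torus torus" using action_bij[OF A.G.one_closed] by (simp add: Bij_def)
  then obtain w where w: "w \<in> torus" "z = \<Phi> \<one>\<^bsub>SAut\<^esub> w" using z by (auto simp: bij_betw_def)
  have "\<Phi> \<one>\<^bsub>SAut\<^esub> z = z" using action_apply[OF A.G.one_closed A.G.one_closed w(1)] w(2) by simp
  then show "\<Phi> \<one>\<^bsub>SAut\<^esub> z = (\<lambda>z\<in>torus. z) z" using z by simp
qed

definition lift :: "('n word \<Rightarrow> 'n word) \<Rightarrow> real^'d \<Rightarrow> real^'d" where
  "lift \<alpha> = (SOME F. is_lift F (\<Phi> \<alpha>))"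

lemma lift:
  assumes \<alpha>: "\<alpha> \<in> carrier SAut"
  shows "is_lift (lift \<alpha>) (\<Phi> \<alpha>)"
proof -
  have "\<Phi> \<alpha> ` torus \<subseteq> torus" using action_maps[OF \<alpha>] by blast
  from lift_exists[OF action_smooth[OF \<alpha>] this] show ?thesis unfolding lift_def by (rule someI_ex)
qed

lemma lift_mult:
  assumes "\<alpha> \<in> carrier SAut" "\<beta> \<in> carrier SAut" "is_lift F (\<Phi> \<alpha>)" "is_lift G (\<Phi> \<beta>)"
  shows "is_lift (\<lambda>x. F (G x)) (\<Phi> (\<alpha> \<cdot> \<beta>))"
  by (rule is_lift_cong[OF is_lift_compose[OF assms(3,4)]]) (simp add: action_apply assms)

lemma lift_id: "is_lift (\<lambda>x. x) (\<Phi> \<one>\<^bsub>SAut\<^esub>)"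
proof -
  have "cont_deriv (\<lambda>x :: real^'d. x) (\<lambda>x v. v)" by (auto simp: cont_deriv_def)
  then show ?thesis by (auto simp: is_lift_def action_one torus_cover_in_torus)
qed

sublocale rep: SAut_rep "\<lambda>\<alpha>. lift_matrix (lift \<alpha>)"
proof
  fix \<alpha> \<beta> :: "'n word \<Rightarrow> 'n word" assume ab: "\<alpha> \<in> carrier SAut" "\<beta> \<in> carrier SAut"
  have "is_lift (lift (\<alpha> \<cdot> \<beta>)) (\<lambda>z. \<Phi> \<alpha> (\<Phi> \<beta> z))"
    by (rule is_lift_cong[OF lift[OF A.G.m_closed[OF ab]]]) (simp add: action_apply ab)
  then show "lift_matrix (lift (\<alpha> \<cdot> \<beta>)) = lift_matrix (lift \<alpha>) ** lift_matrix (lift \<beta>)"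
    by (rule lift_matrix_compose[OF lift[OF ab(1)] lift[OF ab(2)]])
next
  obtain m where "\<And>x. lift \<one>\<^bsub>SAut\<^esub> x = x + m"
    using lift_unique[OF lift[OF A.G.one_closed] lift_id] by blast
  then show "lift_matrix (lift \<one>\<^bsub>SAut\<^esub>) = mat 1"
    using lift_matrix_id by (simp add: lift_matrix_def)
qed (rule three_gens dim_less)+

text \<open>The matrices of the lifts form a representation of dimension \<open>d < n\<close>, which is trivial.\<close>

lemma lift_equivariant:
  assumes \<alpha>: "\<alpha> \<in> carrier SAut" and F: "is_lift F (\<Phi> \<alpha>)"
  shows "equivariant F"
proof -
  obtain m where m: "\<And>x. F x = lift \<alpha> x + m" using lift_unique[OF F lift[OF \<alpha>]] by blast
  show ?thesis
    unfolding equivariant_def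
  proof (intro allI ballI)
    fix x k :: "real^'d" assume "k \<in> int_lattice"
    from lift_matrix(1)[OF lift[OF \<alpha>] this, of x] show "F (x + k) = F x + k"
      by (simp add: m rep.representation_trivial[OF \<alpha>])
  qed
qed

text \<open>Lifts of equal maps differ by translations, which are central. Choose lifts with \<open>Y S = S X\<close>; then
\<open>X\<close> and \<open>Y\<close> have the same square \<open>z + a\<close>. They commute up to a translation \<open>t\<close>, and moving \<open>Y\<close> past
\<open>X \<circ> X\<close> gives \<open>t + t = 0\<close>. So \<open>X (Y z) - a\<close> is an involution with bounded displacement.\<close>

lemma commuting_conjugate_involution:
  assumes x: "x \<in> carrier SAut" and s: "s \<in> carrier SAut" and y: "y \<in> carrier SAut"
    and conj: "\<Phi> (y \<cdot> s) = \<Phi> (s \<cdot> x)"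
    and sq: "\<Phi> (x \<cdot> x) = \<Phi> \<one>\<^bsub>SAut\<^esub>" "\<Phi> (y \<cdot> y) = \<Phi> \<one>\<^bsub>SAut\<^esub>"
    and comm: "\<Phi> (x \<cdot> y) = \<Phi> (y \<cdot> x)"
  shows "\<Phi> x = \<Phi> y"
proof -
  define X S Y0 where "X = lift x" and "S = lift s" and "Y0 = lift y"
  have XS: "is_lift X (\<Phi> x)" "is_lift S (\<Phi> s)" "is_lift Y0 (\<Phi> y)"
    using lift x s y by (simp_all add: X_def S_def Y0_def)
  obtain m where m: "m \<in> int_lattice" "\<And>z. S (X z) = Y0 (S z) + m"
    using lift_unique[OF lift_mult[OF s x XS(2,1)] lift_mult[OF y s XS(3,2), unfolded conj]] by blast
  define Y where "Y = (\<lambda>z. Y0 (z + 0) + m)"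
  have Y: "is_lift Y (\<Phi> y)" unfolding Y_def by (rule is_lift_shift[OF XS(3) lattice_closed(1) m(1)])
  have YS: "Y (S z) = S (X z)" for z using m(2)[of z] by (simp add: Y_def)
  note eqX = lift_equivariant[OF x XS(1), unfolded equivariant_def, rule_format]
    and eqS = lift_equivariant[OF s XS(2), unfolded equivariant_def, rule_format]
    and eqY = lift_equivariant[OF y Y, unfolded equivariant_def, rule_format]
  obtain a where a: "a \<in> int_lattice" "\<And>z. X (X z) = z + a"
    using lift_unique[OF lift_mult[OF x x XS(1,1), unfolded sq] lift_id] by blast
  obtain a' where a': "a' \<in> int_lattice" "\<And>z. Y (Y z) = z + a'"
    using lift_unique[OF lift_mult[OF y y Y Y, unfolded sq] lift_id] by blast
  \<comment> \<open>\<open>Y \<circ> Y\<close> and \<open>X \<circ> X\<close> are conjugate translations, and conjugation by \<open>S\<close> fixes translations.\<close>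
  have "S 0 + a' = S 0 + a" using a'(2)[of "S 0"] YS a(2)[of 0] eqS[OF a(1), of 0] by simp
  then have YY: "Y (Y z) = z + a" for z using a'(2) by simp
  obtain t where t: "t \<in> int_lattice" "\<And>z. X (Y z) = Y (X z) + t"
    using lift_unique[OF lift_mult[OF x y XS(1) Y, unfolded comm] lift_mult[OF y x Y XS(1)]] by blast
  have "Y 0 + a = X (X (Y 0))" using a(2) by simp
  also have "\<dots> = X (Y (X 0)) + t" using t eqX by simp
  also have "\<dots> = Y (X (X 0)) + t + t" using t(2) by simp
  also have "\<dots> = Y 0 + a + (t + t)" using a(2)[of 0] eqY[OF a(1), of 0] by (simp add: add.assoc)
  finally have "t + t = 0" by simp
  then have t0: "t = 0" by (simp add: scaleR_2[symmetric] del: mult_2)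
  define F where "F = (\<lambda>z. X (Y (z + 0)) + (0 - a))"
  have Flift: "is_lift F (\<Phi> (x \<cdot> y))"
    unfolding F_def
    by (rule is_lift_shift[OF lift_mult[OF x y XS(1) Y] lattice_closed(1) lattice_closed(3)[OF lattice_closed(1) a(1)]])
  have negX: "X (z - a) = X z - a" and negY: "Y (z - a) = Y z - a" for z
    using eqX[OF a(1), of "z - a"] eqY[OF a(1), of "z - a"] by (simp_all add: algebra_simps)
  have FF: "F (F z) = z" for z
  proof -
    have "F (F z) = X (Y (X (Y z))) - a - a" by (simp add: F_def negX negY)
    also have "Y (X (Y z)) = X (Y (Y z))" using t(2)[of "Y z"] t0 by simp
    finally show ?thesis by (simp add: a(2) YY)
  qed
  have "equivariant F" using lift_equivariant[OF A.G.m_closed[OF x y] Flift] .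
  then obtain M where M: "\<And>z. norm (F z - z) \<le> M"
    using equivariant_bounded_displacement[OF is_liftD(1)[OF Flift]] by blast
  obtain F' where F': "cont_deriv F F'" using Flift by (auto simp: is_lift_def)
  have F: "F z = z" for z by (rule bounded_involution_eq_id[OF F' M FF])
  have XY: "X z = Y z" for z
  proof -
    have "X (Y z) = X (X z)" using F[of z] a(2)[of z] by (simp add: F_def algebra_simps)
    then have "X (X (Y z)) = X (X (X z))" by simp
    then show ?thesis by (simp add: a(2) eqX[OF a(1)])
  qed
  show ?thesis
  proof (rule extensionalityI)
    show "\<Phi> x \<in> extensional torus" "\<Phi> y \<in> extensional torus"
      using action_bij x y Bij_imp_extensional by blast+
    fix z :: "complex^'d" assume "z \<in> torus"
    then obtain w where "z = torus_cover w" using range_torus_cover by blast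
    then show "\<Phi> x z = \<Phi> y z" using is_liftD(2)[OF XS(1), of w] is_liftD(2)[OF Y, of w] XY by simp
  qed
qed

text \<open>Sign changes \<open>eps k i\<close> and \<open>eps l i\<close> are commuting involutions conjugate under \<open>tau k l\<close>, and their
product is \<open>eps k l\<close>.\<close>

lemma eps_acts_trivially:
  assumes kl: "k \<noteq> l"
  shows "\<Phi> (eps k l) = \<Phi> \<one>\<^bsub>SAut\<^esub>"
proof -
  obtain i where i: "i \<noteq> k" "i \<noteq> l" using exists_third[OF three_gens] by metis
  have e: "eps k i \<in> carrier SAut" "eps l i \<in> carrier SAut" "tau k l \<in> carrier SAut"
    using i kl by (simp_all add: eps tau)
  have "\<Phi> (eps k i) = \<Phi> (eps l i)"
  proof (rule commuting_conjugate_involution[OF e(1,3,2)])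
    show "\<Phi> (eps l i \<cdot> tau k l) = \<Phi> (tau k l \<cdot> eps k i)"
      using eps_tau[OF kl, of l i] i kl by (simp add: swap_def)
    show "\<Phi> (eps k i \<cdot> eps k i) = \<Phi> \<one>\<^bsub>SAut\<^esub>" "\<Phi> (eps l i \<cdot> eps l i) = \<Phi> \<one>\<^bsub>SAut\<^esub>"
      using i by (simp_all add: eps_square)
    show "\<Phi> (eps k i \<cdot> eps l i) = \<Phi> (eps l i \<cdot> eps k i)"
      using i eps_commute[of k i l i] by simp
  qed
  then have "\<Phi> (eps i k \<cdot> eps i l) = \<Phi> (eps i l \<cdot> eps i l)"
    using e i eps_sym[of k i] eps_sym[of l i] by (simp add: action_mult)
  then show ?thesis using eps_mult[OF i kl] eps_square[OF i(2)] by simp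
qed

text \<open>With the sign changes gone, \<open>transvection b d\<close> is an involution, and its conjugate under
\<open>transvection c b\<close> is its product with \<open>transvection c d\<close>, with which it commutes.\<close>

lemma transvections_act_trivially:
  assumes cd: "fst c \<noteq> fst d"
  shows "\<Phi> (transvection c d) = \<Phi> \<one>\<^bsub>SAut\<^esub>"
proof -
  obtain i where i: "i \<noteq> fst c" "i \<noteq> fst d" using exists_third[OF three_gens] by metis
  define b where "b = (i, True)"
  have ne: "fst c \<noteq> fst b" "fst b \<noteq> fst d" "fst b \<noteq> fst c" using i by (auto simp: b_def)
  let ?x = "transvection b d" and ?t = "transvection c d" and ?s = "transvection c b"
  have T: "?x \<in> carrier SAut" "?t \<in> carrier SAut" "?s \<in> carrier SAut"
    using ne cd by (auto intro!: transvection_in_SAut)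
  note ker = eps_acts_trivially
  have sq: "\<Phi> (?x \<cdot> ?x) = \<Phi> \<one>\<^bsub>SAut\<^esub>" "\<Phi> (?t \<cdot> ?t) = \<Phi> \<one>\<^bsub>SAut\<^esub>"
    using A.transvection_sign_independent(3)[OF ker ne(2)] A.transvection_sign_independent(3)[OF ker cd]
    by simp_all
  have cm: "\<Phi> (?x \<cdot> ?t) = \<Phi> (?t \<cdot> ?x)"
    by (rule A.transvection_images_commute[OF ker ne(2) cd])
  let ?y = "?x \<cdot> ?t"
  have y: "?y \<in> carrier SAut" using T by simp
  have xy: "\<Phi> (?x \<cdot> ?y) = \<Phi> ?t" "\<Phi> (?y \<cdot> ?x) = \<Phi> ?t"
    "\<Phi> (?y \<cdot> ?t) = \<Phi> ?x"
  proof -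
    show 1: "\<Phi> (?x \<cdot> ?y) = \<Phi> ?t"
      using T A.kernel_mult(2)[OF T(2) _ sq(1)] by (simp add: A.G.m_assoc)
    have "\<Phi> (?y \<cdot> ?x) = \<Phi> (?t \<cdot> ?x \<cdot> ?x)"
      using T y cm by (simp only: action_mult A.G.m_closed)
    also have "\<dots> = \<Phi> ?t"
      using T A.kernel_mult(1)[OF T(2) _ sq(1)] by (simp add: A.G.m_assoc)
    finally show "\<Phi> (?y \<cdot> ?x) = \<Phi> ?t" .
    show "\<Phi> (?y \<cdot> ?t) = \<Phi> ?x"
      using T A.kernel_mult(1)[OF T(1) _ sq(2)] by (simp add: A.G.m_assoc)
  qed
  have "\<Phi> ?x = \<Phi> ?y"
  proof (rule commuting_conjugate_involution[OF T(1,3) y])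
    show "\<Phi> (?y \<cdot> ?s) = \<Phi> (?s \<cdot> ?x)"
      using transvection_commutator[OF ne(1,2) cd] by simp
    show "\<Phi> (?x \<cdot> ?x) = \<Phi> \<one>\<^bsub>SAut\<^esub>" by (rule sq)
    have "\<Phi> (?y \<cdot> ?y) = \<Phi> ((?y \<cdot> ?x) \<cdot> ?t)"
      using T by (simp add: A.G.m_assoc)
    also have "\<dots> = \<Phi> (?t \<cdot> ?t)" using T y xy(2) by (simp only: action_mult A.G.m_closed)
    finally show "\<Phi> (?y \<cdot> ?y) = \<Phi> \<one>\<^bsub>SAut\<^esub>" using sq(2) by simp
    show "\<Phi> (?x \<cdot> ?y) = \<Phi> (?y \<cdot> ?x)" using xy by simp
  qed
  then have "\<Phi> (?x \<cdot> \<one>\<^bsub>SAut\<^esub>) = \<Phi> (?x \<cdot> ?t)" using T by simp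
  then show ?thesis using A.cancel_left[OF A.G.one_closed T(2,1)] by simp
qed

lemma action_trivial: "\<alpha> \<in> carrier SAut \<Longrightarrow> \<Phi> \<alpha> = (\<lambda>z\<in>torus. z)"
  using A.kernel_all[OF transvections_act_trivially] action_one by simp

end

theorem theorem3p2:
  fixes \<Phi> :: "('n::finite word \<Rightarrow> 'n word) \<Rightarrow> (complex ^ 'd::finite \<Rightarrow> complex ^ 'd)"
  assumes "CARD('n) \<ge> 3"
    and "\<Phi> \<in> hom SAut (Diff torus)"
    and "CARD('d) < CARD('n)"
  shows "\<forall>\<alpha>\<in>carrier SAut. \<Phi> \<alpha> = (\<lambda>z\<in>torus. z)"
proof -
  interpret torus_action \<Phi> using assms by unfold_locales
  show ?thesis using action_trivial by blast
qed

end
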